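(* Let $A$ be a finite alphabet with at least two letters, let $Z\subset A^{\mathbb{N}}$ be a topological Markov chain, and let $\{\phi_i\}_{i\in A}$ be a conformal graph directed Markov system (CGDMS) over $A$ defined by $Z$. Then the restricted extended Hausdorff dimension spectrum is maximal: $$\{HD(J(X)) \ :\ X\subset Z \text{ a subshift}\}=[0,HD(J(Z))],$$ where $HD$ denotes Hausdorff dimension.
   Context: **Symbolic notation.** $A^{\mathbb{N}}$ is the set of sequences $x=(x_1,x_2,\ldots)$ with $x_i\in A$, with the product of the discrete topology. The left shift is $\sigma(x_1,x_2,\ldots)=(x_2,x_3,\ldots)$. A subshift over $A$ is a closed set $X\subset A^{\mathbb{N}}$ with $x\in X\Rightarrow\sigma x\in X$. A topological Markov chain is a subshift of the form $\{x\in A^{\mathbb{N}}: (x_n,x_{n+1})\in S \text{ for all } n\}$ for some $S\subset A^2$. $\mathcal{L}_2(Z)$ denotes the set of two-letter words occurring (as consecutive letters) in points of $Z$. **CGDMS.** A conformal graph directed Markov system over $A$ (with at least two letters) defined by the topological Markov chain $Z$ consists of a non-empty compact set $Y\subset\mathbb{R}^d$ ($d\ge1$), non-empty compact subsets $Y_e\subset Y$ ($e\in A$), and one-to-one contractions $\phi_e:Y_e\to Y$, $e\in A$, whose contraction ratios are all at most some $s\in(0,1)$, with $\phi_f(Y_f)\subseteq Y_e$ whenever $ef\in\mathcal{L}_2(Z)$, such that: (i) each $Y_e$ is connected and $Y_e=\overline{\mathrm{Int}_{\mathbb{R}^d}(Y_e)}$; (ii) (Open Set Condition) $\phi_e(\mathrm{Int}(Y_e))\cap\phi_f(\mathrm{Int}(Y_f))=\emptyset$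 for all $e\neq f$ in $A$; (iii) for every $f\in A$ there is a connected open set $W_f$ with $Y_f\subseteq W_f\subseteq\mathbb{R}^d$ such that $\phi_f$ extends to a $C^1$ conformal diffeomorphism of $W_f$ into $\bigcap_{e\in A:\,ef\in\mathcal{L}_2(Z)}W_e$; (iv) there are constants $L\ge1$, $\alpha>0$ such that $\bigl||\phi_e'(x)|-|\phi_e'(y)|\bigr|\le L\,\|(\phi_e')^{-1}\|^{-1}\,|x-y|^\alpha$ for all $e\in A$ and $x,y\in Y_e$, where $|\phi_e'(x)|$ is the norm of the derivative at $x$ and $\|(\phi_e')^{-1}\|$ is the supremum over $Y_e$ of the norm of the inverse of the derivative; (v) (Cone Property) there exist $\gamma,l>0$, $\gamma<\pi/2$, such that for every $x\in Y$ there is an open cone $\mathrm{Con}(x,\gamma,l)\subseteq\mathrm{Int}(Y)$ with vertex $x$, central angle $\gamma$ and altitude $l$. **Limit sets.** The coding map $\pi:Z\to Y$ is defined by $\{\pi(\omega)\}=\bigcap_{n\ge1}\phi_{\omega_1}\circ\cdots\circ\phi_{\omega_n}(Y_{\omega_n})$ (the intersection is a singleton). For a subshift $X\subset Z$, its limit set is $J(X)=\pi(X)$. *)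

theory Defs
  imports "HOL-Analysis.Analysis"
begin

section \<open>Subshifts\<close>

text \<open>Points of the sequence space are functions on \<open>nat\<close>, so the first letter of \<open>x\<close> is \<open>x 0\<close>.\<close>

definition full_shift :: "'a set \<Rightarrow> (nat \<Rightarrow> 'a) topology" where
  "full_shift A = product_topology (\<lambda>_. discrete_topology A) UNIV"

definition left_shift :: "(nat \<Rightarrow> 'a) \<Rightarrow> nat \<Rightarrow> 'a" where
  "left_shift x = (\<lambda>n. x (Suc n))"

definition subshift :: "'a set \<Rightarrow> (nat \<Rightarrow> 'a) set \<Rightarrow> bool" where
  "subshift A X \<longleftrightarrow> closedin (full_shift A) X \<and> (\<forall>x\<in>X. left_shift x \<in> X)"

definition topological_markov_chain :: "'a set \<Rightarrow> (nat \<Rightarrow> 'a) set \<Rightarrow> bool" where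
  "topological_markov_chain A Z \<longleftrightarrow>
     subshift A Z \<and>
     (\<exists>S \<subseteq> A \<times> A. Z = {x \<in> topspace (full_shift A). \<forall>n. (x n, x (Suc n)) \<in> S})"

definition two_letter_words :: "(nat \<Rightarrow> 'a) set \<Rightarrow> ('a \<times> 'a) set" where
  "two_letter_words Z = {(x n, x (Suc n)) | x n. x \<in> Z}"


section \<open>Hausdorff dimension\<close>

text \<open>
  The contribution \<open>(diam U)\<^sup>s\<close> of a covering set, with the usual conventions that the empty set
  contributes \<open>0\<close> and that \<open>0\<^sup>0 = 1\<close> for nonempty \<open>U\<close> (whereas \<open>0 powr 0 = 0\<close> in HOL).
\<close>

definition hausdorff_gauge :: "real \<Rightarrow> 'v::metric_space set \<Rightarrow> ennreal" where
  "hausdorff_gauge s U =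
     (if U = {} then 0 else if s = 0 then 1 else ennreal (diameter U powr s))"

text \<open>Boundedness is required because \<open>diameter\<close> is a junk value on unbounded sets.\<close>

definition hausdorff_premeasure :: "real \<Rightarrow> real \<Rightarrow> 'v::metric_space set \<Rightarrow> ennreal" where
  "hausdorff_premeasure s \<delta> E =
     (INF U \<in> {U :: nat \<Rightarrow> 'v set. E \<subseteq> (\<Union>i. U i) \<and> (\<forall>i. bounded (U i) \<and> diameter (U i) \<le> \<delta>)}.
        \<Sum>i. hausdorff_gauge s (U i))"

definition hausdorff_measure :: "real \<Rightarrow> 'v::metric_space set \<Rightarrow> ennreal" where
  "hausdorff_measure s E = (SUP \<delta> \<in> {0<..}. hausdorff_premeasure s \<delta> E)"

definition hausdorff_dim :: "'v::metric_space set \<Rightarrow> ennreal" where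
  "hausdorff_dim E = (INF s \<in> {s. 0 \<le> s \<and> hausdorff_measure s E = 0}. ennreal s)"


section \<open>Conformal diffeomorphisms and cones\<close>

definition C1_on :: "'v::euclidean_space set \<Rightarrow> ('v \<Rightarrow> 'v) \<Rightarrow> bool" where
  "C1_on U f \<longleftrightarrow>
     (\<exists>f' :: 'v \<Rightarrow> 'v \<Rightarrow>\<^sub>L 'v.
        (\<forall>x\<in>U. (f has_derivative blinfun_apply (f' x)) (at x)) \<and> continuous_on U f')"

text \<open>Conformality means that the derivative is a similarity; it may reverse orientation.\<close>

definition conformal_at :: "('v::euclidean_space \<Rightarrow> 'v) \<Rightarrow> 'v \<Rightarrow> bool" where
  "conformal_at f x \<longleftrightarrow>
     (\<exists>c>0. \<exists>T. orthogonal_transformation T \<and> (f has_derivative (\<lambda>v. c *\<^sub>R T v)) (at x))"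

definition C1_conformal_diffeo_into ::
    "'v::euclidean_space set \<Rightarrow> 'v set \<Rightarrow> ('v \<Rightarrow> 'v) \<Rightarrow> bool" where
  "C1_conformal_diffeo_into U V f \<longleftrightarrow>
     inj_on f U \<and> f ` U \<subseteq> V \<and> open (f ` U) \<and>
     C1_on U f \<and> C1_on (f ` U) (inv_into U f) \<and> (\<forall>x\<in>U. conformal_at f x)"

text \<open>
  The open cone with vertex \<open>x\<close>, axis direction \<open>u\<close> (a unit vector), central angle \<open>\<gamma>\<close> and
  altitude \<open>l\<close>; the central angle is the full opening angle, so directions in the cone make an
  angle less than \<open>\<gamma> / 2\<close> with \<open>u\<close>.
\<close>

definition open_cone :: "'v::euclidean_space \<Rightarrow> 'v \<Rightarrow> real \<Rightarrow> real \<Rightarrow> 'v set" where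
  "open_cone x u \<gamma> l = {x + v | v. 0 < v \<bullet> u \<and> v \<bullet> u < l \<and> norm v * cos (\<gamma> / 2) < v \<bullet> u}"

definition cone_property :: "'v::euclidean_space set \<Rightarrow> bool" where
  "cone_property Y \<longleftrightarrow>
     (\<exists>\<gamma> l. 0 < \<gamma> \<and> \<gamma> < pi / 2 \<and> 0 < l \<and>
        (\<forall>x\<in>Y. \<exists>u. norm u = 1 \<and> open_cone x u \<gamma> l \<subseteq> interior Y))"


section \<open>Conformal graph directed Markov systems\<close>

definition conformal_extension ::
    "'a set \<Rightarrow> (nat \<Rightarrow> 'a) set \<Rightarrow> ('a \<Rightarrow> 'v::euclidean_space set) \<Rightarrow> ('a \<Rightarrow> 'v \<Rightarrow> 'v)
      \<Rightarrow> ('a \<Rightarrow> 'v set) \<Rightarrow> ('a \<Rightarrow> 'v \<Rightarrow> 'v) \<Rightarrow> bool" where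
  "conformal_extension A Z Ye \<phi> W \<Phi> \<longleftrightarrow>
     (\<forall>f\<in>A. open (W f) \<and> connected (W f) \<and> Ye f \<subseteq> W f \<and>
        (\<forall>x\<in>Ye f. \<Phi> f x = \<phi> f x) \<and>
        C1_conformal_diffeo_into (W f) (\<Inter>e\<in>{e\<in>A. (e, f) \<in> two_letter_words Z}. W e) (\<Phi> f))"

definition deriv_norm :: "('v::euclidean_space \<Rightarrow> 'v) \<Rightarrow> 'v \<Rightarrow> real" where
  "deriv_norm f x = onorm (frechet_derivative f (at x))"

definition inv_deriv_norm :: "'v::euclidean_space set \<Rightarrow> ('v \<Rightarrow> 'v) \<Rightarrow> real" where
  "inv_deriv_norm E f = (SUP x\<in>E. onorm (inv (frechet_derivative f (at x))))"

definition holder_derivatives ::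
    "'a set \<Rightarrow> ('a \<Rightarrow> 'v::euclidean_space set) \<Rightarrow> ('a \<Rightarrow> 'v \<Rightarrow> 'v) \<Rightarrow> bool" where
  "holder_derivatives A Ye \<Phi> \<longleftrightarrow>
     (\<exists>L \<alpha>. 1 \<le> L \<and> 0 < \<alpha> \<and>
        (\<forall>e\<in>A. \<forall>x\<in>Ye e. \<forall>y\<in>Ye e.
           \<bar>deriv_norm (\<Phi> e) x - deriv_norm (\<Phi> e) y\<bar>
             \<le> L * inverse (inv_deriv_norm (Ye e) (\<Phi> e)) * dist x y powr \<alpha>))"

text \<open>
  The map \<open>\<phi> e\<close> only matters on \<open>Ye e\<close>; its values elsewhere are irrelevant.  Its derivative on
  \<open>Ye e\<close> is that of a \<open>C\<^sup>1\<close> extension \<open>\<Phi> e\<close>, which does not depend on the choice of the extension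
  since \<open>Ye e\<close> is the closure of its interior.
\<close>

locale conformal_gdms =
  fixes A :: "'a set"
    and Z :: "(nat \<Rightarrow> 'a) set"
    and Y :: "'v::euclidean_space set"
    and Ye :: "'a \<Rightarrow> 'v set"
    and \<phi> :: "'a \<Rightarrow> 'v \<Rightarrow> 'v"
  assumes two_letters: "\<exists>a\<in>A. \<exists>b\<in>A. a \<noteq> b"
    and markov_chain: "topological_markov_chain A Z"
    and Y_compact: "compact Y" "Y \<noteq> {}"
    and Ye_compact: "\<And>e. e \<in> A \<Longrightarrow> compact (Ye e)"
    and Ye_nonempty: "\<And>e. e \<in> A \<Longrightarrow> Ye e \<noteq> {}"
    and Ye_subset: "\<And>e. e \<in> A \<Longrightarrow> Ye e \<subseteq> Y"
    and maps_into: "\<And>e. e \<in> A \<Longrightarrow> \<phi> e ` Ye e \<subseteq> Y"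
    and maps_inj: "\<And>e. e \<in> A \<Longrightarrow> inj_on (\<phi> e) (Ye e)"
    and maps_contract: "\<exists>s. 0 < s \<and> s < 1 \<and> (\<forall>e\<in>A. s-lipschitz_on (Ye e) (\<phi> e))"
    and maps_compose: "\<And>e f. (e, f) \<in> two_letter_words Z \<Longrightarrow> \<phi> f ` Ye f \<subseteq> Ye e"
    and Ye_connected: "\<And>e. e \<in> A \<Longrightarrow> connected (Ye e)"
    and Ye_regular_closed: "\<And>e. e \<in> A \<Longrightarrow> Ye e = closure (interior (Ye e))"
    and open_set_condition:
      "\<And>e f. e \<in> A \<Longrightarrow> f \<in> A \<Longrightarrow> e \<noteq> f \<Longrightarrow>
         \<phi> e ` interior (Ye e) \<inter> \<phi> f ` interior (Ye f) = {}"
    and conformal_holder_extension: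
      "\<exists>W \<Phi>. conformal_extension A Z Ye \<phi> W \<Phi> \<and> holder_derivatives A Ye \<Phi>"
    and cone_property: "cone_property Y"


section \<open>Limit sets\<close>

primrec word_map :: "('a \<Rightarrow> 'v \<Rightarrow> 'v) \<Rightarrow> (nat \<Rightarrow> 'a) \<Rightarrow> nat \<Rightarrow> 'v \<Rightarrow> 'v" where
  "word_map \<phi> \<omega> 0 = id"
| "word_map \<phi> \<omega> (Suc n) = word_map \<phi> \<omega> n \<circ> \<phi> (\<omega> n)"

definition coding_map ::
    "('a \<Rightarrow> 'v set) \<Rightarrow> ('a \<Rightarrow> 'v \<Rightarrow> 'v) \<Rightarrow> (nat \<Rightarrow> 'a) \<Rightarrow> 'v" where
  "coding_map Ye \<phi> \<omega> = (THE p. {p} = (\<Inter>n. word_map \<phi> \<omega> (Suc n) ` Ye (\<omega> n)))"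

definition limit_set ::
    "('a \<Rightarrow> 'v set) \<Rightarrow> ('a \<Rightarrow> 'v \<Rightarrow> 'v) \<Rightarrow> (nat \<Rightarrow> 'a) set \<Rightarrow> 'v set" where
  "limit_set Ye \<phi> X = coding_map Ye \<phi> ` X"

end

theory Submission
  imports Defs
begin

text \<open>
  Let \<open>0 < t < HD(J(Z))\<close>.  The Hoelder condition gives bounded distortion, so the derivative \<open>r w\<close> of the
  map of a word \<open>w\<close> is multiplicative up to a constant, and up to exponents close to \<open>1\<close> it is comparable
  both to the diameter of the image and to the radius of an inner ball.  Since the Hausdorff measure of
  \<open>J(Z)\<close> is positive at some exponent above \<open>t\<close>, there are a letter \<open>a\<close> and a finite set \<open>F\<close> of words
  returning to \<open>a\<close>, none a prefix of another, whose sum of the \<open>r u powr t\<close> is large.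

  Concatenations of words of \<open>F\<close> are thinned out by a Toeplitz pattern \<open>P\<close>: at positions in \<open>P\<close> the word
  is free, elsewhere it is a fixed \<open>f0\<close>.  Freeing one position changes the sums over words of a given
  length by a bounded factor, so bisection over the periods \<open>2 ^ j\<close> produces a \<open>P\<close> between periodic
  patterns \<open>L j\<close> and \<open>U j\<close> for which the sums at exponent \<open>t\<close> neither grow nor decay exponentially.
  The subshift of all factors of such words has a limit set of dimension \<open>t\<close>: the cylinders of the
  patterns \<open>U j\<close> give the upper bound, and for the lower bound the open set condition limits the number of
  cylinders of comparable size that meet a ball.
\<close>

section \<open>Null sets and Hausdorff dimension\<close>

text \<open>Subshifts of finite type form a countable family, so their limit sets realise only
  countably many dimensions; an arbitrary \<open>t\<close> requires an infinite amount of
  information, and the pattern \<open>P\<close> carries it. That the sums are balanced means that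
  the pressure at exponent \<open>t\<close> vanishes, which by Bowen's formula is the expected
  condition for dimension \<open>t\<close>. The chain \<open>Z\<close> need not be transitive;
  returning to a fixed letter is what makes words freely concatenable.

  The domains need not be convex, so the mean value inequality does not bound the diameter of an
  image by the derivative. Distances are therefore compared letter by letter, with an error
  \<open>exp \<epsilon>\<close> per letter. Since \<open>r\<close> decays exponentially with the
  length, an error \<open>exp (\<epsilon> * n)\<close> is at most a small negative power of
  \<open>r\<close>, and the dimension does not see it. The same slack allows a pattern that is
  balanced only up to subexponential factors, and a lower bound that counts words in finite sums
  instead of building a measure.\<close>

lemma hausdorff_measure_zeroI:
  fixes E :: "'v::metric_space set"
  assumes s: "0 < s"
    and cov: "\<And>\<eta>. 0 < \<eta> \<Longrightarrow> \<exists>(I::'i set) U. countable I \<and> E \<subseteq> (\<Union>i\<in>I. U i) \<and>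
      (\<forall>i\<in>I. bounded (U i)) \<and> (\<forall>J\<subseteq>I. finite J \<longrightarrow> (\<Sum>i\<in>J. diameter (U i) powr s) \<le> \<eta>)"
  shows "hausdorff_measure s E = 0"
proof -
  have "hausdorff_premeasure s \<delta> E \<le> ennreal \<eta>" if \<delta>: "0 < \<delta>" and \<eta>: "0 < \<eta>" for \<delta> \<eta>
  proof -
    \<comment> \<open>A total below \<open>\<delta> powr s\<close> forces each single diameter below
      \<open>\<delta>\<close>, so a bound on the sums controls the mesh as well.\<close>
    have "0 < min \<eta> (\<delta> powr s)" using that by simp
    from cov[OF this] obtain I :: "'i set" and U where I: "countable I" "E \<subseteq> (\<Union>i\<in>I. U i)"
      "\<And>i. i \<in> I \<Longrightarrow> bounded (U i)"
      and sm: "\<And>J. J \<subseteq> I \<Longrightarrow> finite J \<Longrightarrow> (\<Sum>i\<in>J. diameter (U i) powr s) \<le> min \<eta> (\<delta> powr s)"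
      by metis
    have dm: "diameter (U i) \<le> \<delta>" if "i \<in> I" for i
    proof (rule ccontr)
      assume "\<not> ?thesis"
      then have "\<delta> powr s < diameter (U i) powr s" using \<delta> s by (intro powr_less_mono2) auto
      with sm[of "{i}"] that show False by auto
    qed
    define f where "f = to_nat_on I"
    have inj: "inj_on f I" unfolding f_def by (rule inj_on_to_nat_on[OF I(1)])
    define V where "V n = (if n \<in> f ` I then U (inv_into I f n) else {})" for n
    have Vf: "V (f i) = U i" if "i \<in> I" for i using that inj by (simp add: V_def)
    have cV: "E \<subseteq> (\<Union>n. V n)"
    proof
      fix x assume "x \<in> E"
      then obtain i where "i \<in> I" "x \<in> U i" using I(2) by blast
      then have "x \<in> V (f i)" using Vf by simp
      then show "x \<in> (\<Union>n. V n)" by blast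
    qed
    have bV: "bounded (V n) \<and> diameter (V n) \<le> \<delta>" for n
      using I(3) dm \<delta> by (auto simp: V_def inv_into_into)
    have g: "hausdorff_gauge s (V n) = ennreal (diameter (V n) powr s)" for n
      using s by (auto simp: hausdorff_gauge_def)
    have ps: "(\<Sum>n<N. hausdorff_gauge s (V n)) \<le> ennreal \<eta>" for N
    proof -
      define J where "J = {i\<in>I. f i < N}"
      have finJ: "finite J"
      proof (rule inj_on_finite)
        show "inj_on f J" using inj by (auto simp: J_def inj_on_def)
        show "f ` J \<subseteq> {..<N}" by (auto simp: J_def)
      qed simp
      have "(\<Sum>n<N. diameter (V n) powr s) = (\<Sum>n\<in>f ` J. diameter (V n) powr s)"
        using s by (intro sum.mono_neutral_right) (auto simp: J_def V_def)
      also have "\<dots> = (\<Sum>i\<in>J. diameter (U i) powr s)"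
        using inj Vf by (subst sum.reindex) (auto simp: J_def inj_on_def)
      also have "\<dots> \<le> \<eta>" using sm[of J] finJ by (auto simp: J_def)
      finally show ?thesis unfolding g by (subst sum_ennreal) (auto intro: ennreal_leI)
    qed
    have "hausdorff_premeasure s \<delta> E \<le> (\<Sum>n. hausdorff_gauge s (V n))"
      unfolding hausdorff_premeasure_def using cV bV by (intro INF_lower) auto
    also have "\<dots> \<le> ennreal \<eta>" by (intro suminf_le_const ps) simp
    finally show ?thesis .
  qed
  then have "hausdorff_premeasure s \<delta> E \<le> 0 + ennreal \<eta>" if "0 < \<delta>" "0 < \<eta>" for \<delta> \<eta>
    unfolding add_0 using that .
  then have "hausdorff_premeasure s \<delta> E \<le> 0" if "0 < \<delta>" for \<delta>
    by (rule ennreal_le_epsilon[OF _]) (use that in simp)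
  then show ?thesis unfolding hausdorff_measure_def by (simp add: SUP_eq_const)
qed

lemma hausdorff_measure_empty: "hausdorff_measure s ({} :: 'v::metric_space set) = 0"
proof -
  have "hausdorff_premeasure s \<delta> ({} :: 'v set) \<le> 0" if "0 < \<delta>" for \<delta>
  proof -
    have "hausdorff_premeasure s \<delta> ({} :: 'v set) \<le> (\<Sum>n::nat. hausdorff_gauge s ({} :: 'v set))"
      unfolding hausdorff_premeasure_def using that by (intro INF_lower) auto
    then show ?thesis by (simp add: hausdorff_gauge_def)
  qed
  then show ?thesis unfolding hausdorff_measure_def by (simp add: SUP_eq_const)
qed

text \<open>The value \<open>0\<close> of the spectrum is attained by the empty subshift.\<close>

lemma hausdorff_dim_empty: "hausdorff_dim ({} :: 'v::metric_space set) = 0"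
proof -
  have "hausdorff_dim ({} :: 'v set) \<le> ennreal 0"
    unfolding hausdorff_dim_def by (rule INF_lower) (simp add: hausdorff_measure_empty)
  then show ?thesis by simp
qed

lemma hausdorff_measure_mono: "E \<subseteq> E' \<Longrightarrow> hausdorff_measure s E \<le> hausdorff_measure s E'"
  unfolding hausdorff_measure_def hausdorff_premeasure_def
  by (intro SUP_mono' INF_superset_mono) auto

lemma hausdorff_dim_mono:
  assumes "E \<subseteq> E'"
  shows "hausdorff_dim E \<le> hausdorff_dim E'"
  unfolding hausdorff_dim_def
proof (rule INF_superset_mono)
  show "{s. 0 \<le> s \<and> hausdorff_measure s E' = 0} \<subseteq> {s. 0 \<le> s \<and> hausdorff_measure s E = 0}"
    using hausdorff_measure_mono[OF assms] by (metis (mono_tags, lifting) Collect_mono le_zero_eq)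
qed simp

text \<open>The measure is a supremum over the mesh, so a null set already has premeasure
  \<open>0\<close> at the single mesh \<open>1\<close>.\<close>

lemma hausdorff_measure_zero_cover:
  assumes "hausdorff_measure s E = 0" "0 < \<eta>"
  obtains U :: "nat \<Rightarrow> 'v::metric_space set" where "E \<subseteq> (\<Union>i. U i)" "\<And>i. bounded (U i)"
    "(\<Sum>i. hausdorff_gauge s (U i)) < ennreal \<eta>"
proof -
  have "hausdorff_premeasure s 1 E \<le> hausdorff_measure s E"
    unfolding hausdorff_measure_def by (rule SUP_upper) simp
  then have "hausdorff_premeasure s 1 E < ennreal \<eta>" using assms by simp
  then show thesis unfolding hausdorff_premeasure_def INF_less_iff using that by auto
qed

lemma sum_half_powers_le: "(\<Sum>i<N. (1/2)^Suc i) \<le> (1::real)"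
proof -
  have "(\<Sum>i<N. (1/2)^Suc i) = 1 - (1/2::real)^N" by (induction N) auto
  then show ?thesis by simp
qed

text \<open>Counting words near a covering set works with balls of positive radius. Points among the
  covering sets have diameter \<open>0\<close>, so each \<open>diameter (U i) powr s\<close> is
  enlarged by a term of a geometric series with total at most \<open>\<eta>/2\<close> before the
  root is taken.\<close>

lemma hausdorff_measure_zeroD:
  fixes E :: "'v::metric_space set"
  assumes s: "0 < s" and "hausdorff_measure s E = 0" and \<eta>: "0 < \<eta>"
  shows "\<exists>c d. (\<forall>i::nat. 0 < d i) \<and> E \<subseteq> (\<Union>i. ball (c i) (d i)) \<and> (\<forall>N. (\<Sum>i<N. d i powr s) \<le> \<eta>)"
proof -
  obtain U :: "nat \<Rightarrow> 'v set" where U: "E \<subseteq> (\<Union>i. U i)" "\<And>i. bounded (U i)"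
    "(\<Sum>i. hausdorff_gauge s (U i)) < ennreal (\<eta>/2)"
    using hausdorff_measure_zero_cover[OF assms(2), of "\<eta>/2"] \<eta> by auto
  define b where "b i = diameter (U i) powr s + \<eta>/2 * (1/2)^Suc i" for i
  define d where "d i = b i powr (1/s)" for i
  define c where "c i = (SOME x. x \<in> U i)" for i
  have bpos: "0 < b i" for i using \<eta> by (auto simp: b_def intro: add_nonneg_pos)
  have ds: "d i powr s = b i" for i using s bpos[of i] by (simp add: d_def powr_powr)
  have dpos: "0 < d i" for i using bpos[of i] by (simp add: d_def)
  have du: "diameter (U i) < d i" for i
  proof (rule ccontr)
    assume "\<not> ?thesis"
    then have "d i powr s \<le> diameter (U i) powr s" using dpos[of i] s by (intro powr_mono2) auto
    moreover have "0 < \<eta>/2 * (1/2)^Suc i" using \<eta> by (intro mult_pos_pos zero_less_power) auto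
    ultimately show False unfolding ds b_def by linarith
  qed
  have "dist (c i) x \<le> diameter (U i)" if "x \<in> U i" for x i
    unfolding c_def by (rule diameter_bounded_bound[OF U(2) someI that]) (rule that)
  then have "x \<in> ball (c i) (d i)" if "x \<in> U i" for x i
    unfolding mem_ball using le_less_trans[OF _ du] that by simp
  then have "(\<Union>i. U i) \<subseteq> (\<Union>i. ball (c i) (d i))" by (intro UN_mono) auto
  with U(1) have cov: "E \<subseteq> (\<Union>i. ball (c i) (d i))" by (rule order_trans)
  have "(\<Sum>i<N. d i powr s) \<le> \<eta>" for N
  proof -
    have "hausdorff_gauge s (U i) = ennreal (diameter (U i) powr s)" for i
      using s by (auto simp: hausdorff_gauge_def)
    then have "ennreal (\<Sum>i<N. diameter (U i) powr s) = (\<Sum>i<N. hausdorff_gauge s (U i))" by simp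
    also have "\<dots> \<le> (\<Sum>i. hausdorff_gauge s (U i))" by (intro sum_le_suminf) auto
    also have "\<dots> < ennreal (\<eta>/2)" by (rule U)
    finally have 1: "(\<Sum>i<N. diameter (U i) powr s) < \<eta>/2"
      by (subst (asm) ennreal_less_iff) (auto intro: sum_nonneg)
    have "\<eta>/2 * (\<Sum>i<N. (1/2)^Suc i) \<le> \<eta>/2 * 1"
      using \<eta> by (intro mult_left_mono sum_half_powers_le) auto
    then have "(\<Sum>i<N. \<eta>/2 * (1/2)^Suc i) \<le> \<eta>/2" by (simp only: sum_distrib_left mult_1_right)
    then show ?thesis using 1 unfolding ds b_def by (simp add: sum.distrib)
  qed
  with dpos cov show ?thesis by (intro exI[of _ c] exI[of _ d] conjI allI)
qed

lemma diameter_ball_powr_le: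
  assumes "0 < d" "0 \<le> s"
  shows "diameter (ball (c::'v::metric_space) d) powr s \<le> 2 powr s * d powr s"
proof -
  have "diameter (ball c d) \<le> 2 * d"
  proof -
    have "dist x y \<le> 2 * d" if "x \<in> ball c d" "y \<in> ball c d" for x y
      using that dist_triangle[of x y c] by (simp add: dist_commute)
    then have "(SUP (x,y)\<in>ball c d \<times> ball c d. dist x y) \<le> 2 * d"
      using assms by (intro cSUP_least) auto
    then show ?thesis unfolding diameter_def using assms by auto
  qed
  then have "diameter (ball c d) powr s \<le> (2 * d) powr s"
    using assms by (intro powr_mono2 diameter_ge_0) auto
  then show ?thesis using assms by (simp add: powr_mult)
qed

lemma hausdorff_measure_zero_exponent_mono:
  fixes E :: "'v::metric_space set"
  assumes "hausdorff_measure s E = 0" "0 \<le> s" "s < \<tau>"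
  shows "hausdorff_measure \<tau> E = 0"
proof (cases "s = 0")
  case True
  \<comment> \<open>At exponent \<open>0\<close> the gauge counts the nonempty sets, so a total
    below \<open>1\<close> leaves only empty ones.\<close>
  obtain U :: "nat \<Rightarrow> 'v set" where U: "E \<subseteq> (\<Union>i. U i)"
    "(\<Sum>i. hausdorff_gauge s (U i)) < ennreal 1"
    using hausdorff_measure_zero_cover[OF assms(1), of 1] by (metis zero_less_one)
  have "U i = {}" for i
  proof (rule ccontr)
    assume "U i \<noteq> {}"
    then have "1 = (\<Sum>j\<in>{i}. hausdorff_gauge s (U j))" using True by (simp add: hausdorff_gauge_def)
    also have "\<dots> \<le> (\<Sum>i. hausdorff_gauge s (U i))" by (rule sum_le_suminf) auto
    finally show False using U(2) by simp
  qed
  then show ?thesis using U(1) hausdorff_measure_empty by auto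
next
  case False
  then have s: "0 < s" using assms by simp
  show ?thesis
  proof (rule hausdorff_measure_zeroI)
    fix \<eta> :: real assume \<eta>: "0 < \<eta>"
    \<comment> \<open>The bound \<open>1\<close> forces all radii below \<open>1\<close>, where
      raising the exponent decreases the power; \<open>2 powr \<tau>\<close> pays for passing from
      radius to diameter.\<close>
    define \<eta>' where "\<eta>' = min 1 (\<eta> / 2 powr \<tau>)"
    have "0 < \<eta>'" using \<eta> by (simp add: \<eta>'_def)
    from hausdorff_measure_zeroD[OF s assms(1) this] obtain c :: "nat \<Rightarrow> 'v" and d where
      cd: "\<forall>i. 0 < d i" "E \<subseteq> (\<Union>i. ball (c i) (d i))" "\<forall>N. (\<Sum>i<N. d i powr s) \<le> \<eta>'"
      by (elim exE conjE)
    have d1: "d i \<le> 1" for i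
    proof (rule ccontr)
      assume "\<not> ?thesis"
      then have "1 < d i powr s" using s by simp
      also have "\<dots> \<le> (\<Sum>i<Suc i. d i powr s)" by (rule member_le_sum) auto
      also have "\<dots> \<le> 1" using cd(3)[rule_format, of "Suc i"] by (simp add: \<eta>'_def)
      finally show False by simp
    qed
    have "(\<Sum>i\<in>J. diameter (ball (c i) (d i)) powr \<tau>) \<le> \<eta>" if J: "finite J" for J
    proof -
      obtain N where N: "J \<subseteq> {..<N}" using J finite_nat_iff_bounded by blast
      have "(\<Sum>i\<in>J. diameter (ball (c i) (d i)) powr \<tau>) \<le> (\<Sum>i<N. diameter (ball (c i) (d i)) powr \<tau>)"
        using N by (intro sum_mono2) auto
      also have "\<dots> \<le> (\<Sum>i<N. 2 powr \<tau> * d i powr s)"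
      proof (rule sum_mono)
        fix i
        have "diameter (ball (c i) (d i)) powr \<tau> \<le> 2 powr \<tau> * d i powr \<tau>"
          using cd(1) assms by (intro diameter_ball_powr_le) auto
        also have "\<dots> \<le> 2 powr \<tau> * d i powr s"
          using d1[of i] cd(1)[rule_format, of i] assms by (intro mult_left_mono powr_mono') auto
        finally show "diameter (ball (c i) (d i)) powr \<tau> \<le> 2 powr \<tau> * d i powr s" .
      qed
      also have "\<dots> \<le> 2 powr \<tau> * \<eta>'" using cd(3)[rule_format, of N] by (simp add: sum_distrib_left[symmetric])
      also have "\<dots> \<le> \<eta>" using \<eta> by (simp add: \<eta>'_def min_def field_simps)
      finally show ?thesis .
    qed
    then show "\<exists>(I::nat set) U. countable I \<and> E \<subseteq> (\<Union>i\<in>I. U i) \<and>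
      (\<forall>i\<in>I. bounded (U i)) \<and> (\<forall>J\<subseteq>I. finite J \<longrightarrow> (\<Sum>i\<in>J. diameter (U i) powr \<tau>) \<le> \<eta>)"
      using cd(2) by (intro exI[of _ UNIV] exI[of _ "\<lambda>i. ball (c i) (d i)"] conjI ballI allI impI
          countableI_type bounded_ball) simp_all
  next
    show "0 < \<tau>" using assms by linarith
  qed
qed

lemma hausdorff_dim_le:
  assumes "0 \<le> t" "\<And>\<tau>. t < \<tau> \<Longrightarrow> hausdorff_measure \<tau> E = 0"
  shows "hausdorff_dim E \<le> ennreal t"
proof (rule ennreal_le_epsilon)
  fix e :: real assume e: "0 < e"
  have "hausdorff_dim E \<le> ennreal (t + e)"
    unfolding hausdorff_dim_def by (rule INF_lower) (use assms e in auto)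
  then show "hausdorff_dim E \<le> ennreal t + ennreal e" using assms e by simp
qed

lemma hausdorff_dim_ge:
  fixes E :: "'v::metric_space set"
  assumes "\<And>\<tau>. 0 < \<tau> \<Longrightarrow> \<tau> < t \<Longrightarrow> hausdorff_measure \<tau> E \<noteq> 0"
  shows "ennreal t \<le> hausdorff_dim E"
  unfolding hausdorff_dim_def
proof (rule INF_greatest)
  fix s assume "s \<in> {s. 0 \<le> s \<and> hausdorff_measure s E = 0}"
  then have s: "0 \<le> s" "hausdorff_measure s E = 0" by auto
  have "t \<le> s"
  proof (rule ccontr)
    assume "\<not> ?thesis"
    then obtain \<tau> where "s < \<tau>" "\<tau> < t" using dense by (meson not_le)
    with s assms[of \<tau>] hausdorff_measure_zero_exponent_mono[OF s(2,1)] show False by auto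
  qed
  then show "ennreal t \<le> ennreal s" by (rule ennreal_leI)
qed

lemma hausdorff_measure_zero_Union:
  fixes E :: "nat \<Rightarrow> 'v::metric_space set"
  assumes s: "0 < s" and E: "\<And>n. hausdorff_measure s (E n) = 0"
  shows "hausdorff_measure s (\<Union>n. E n) = 0"
proof (rule hausdorff_measure_zeroI[OF s])
  fix \<eta> :: real assume \<eta>: "0 < \<eta>"
  define Q where "Q n c d \<longleftrightarrow> (\<forall>i::nat. 0 < d i) \<and> E n \<subseteq> (\<Union>i. ball (c i) (d i)) \<and>
      (\<forall>N. (\<Sum>i<N. d i powr s) \<le> \<eta> / 2 powr s * (1/2)^Suc n)" for n c d
  have "\<exists>c d. Q n c d" for n
    unfolding Q_def by (rule hausdorff_measure_zeroD[OF s E]) (use \<eta> in simp)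
  then obtain c d where "\<And>n. Q n (c n) (d n)" by metis
  then have cd: "\<And>n i. 0 < d n i" "\<And>n. E n \<subseteq> (\<Union>i. ball (c n i) (d n i))"
    "\<And>n N. (\<Sum>i<N. d n i powr s) \<le> \<eta> / 2 powr s * (1/2)^Suc n" by (simp_all add: Q_def)
  define U where "U = (\<lambda>(n,i). ball (c n i) (d n i))"
  have "(\<Sum>p\<in>J. diameter (U p) powr s) \<le> \<eta>" if J: "finite J" for J
  proof -
    obtain N where N: "fst ` J \<subseteq> {..<N}"
      using finite_imageI[OF J, of fst] unfolding finite_nat_iff_bounded by (elim exE)
    obtain M where M: "snd ` J \<subseteq> {..<M}"
      using finite_imageI[OF J, of snd] unfolding finite_nat_iff_bounded by (elim exE)
    have "J \<subseteq> {..<N}\<times>{..<M}" using N M by (auto simp: image_subset_iff)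
    then have "(\<Sum>p\<in>J. diameter (U p) powr s) \<le> (\<Sum>p\<in>{..<N}\<times>{..<M}. diameter (U p) powr s)"
      by (intro sum_mono2) auto
    also have "\<dots> = (\<Sum>n<N. \<Sum>i<M. diameter (ball (c n i) (d n i)) powr s)"
      by (subst sum.cartesian_product) (auto simp: U_def intro!: sum.cong)
    also have "\<dots> \<le> (\<Sum>n<N. \<Sum>i<M. 2 powr s * d n i powr s)"
      using cd(1) s by (intro sum_mono diameter_ball_powr_le) auto
    also have "\<dots> = (\<Sum>n<N. 2 powr s * (\<Sum>i<M. d n i powr s))" by (simp add: sum_distrib_left)
    also have "\<dots> \<le> (\<Sum>n<N. 2 powr s * (\<eta> / 2 powr s * (1/2)^Suc n))"
      by (intro sum_mono mult_left_mono cd) auto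
    also have "\<dots> = \<eta> * (\<Sum>n<N. (1/2)^Suc n)" by (simp add: sum_distrib_left)
    also have "\<dots> \<le> \<eta> * 1"
      using \<eta> by (intro mult_left_mono sum_half_powers_le) auto
    finally show ?thesis by simp
  qed
  moreover have "(\<Union>n. E n) \<subseteq> (\<Union>p. U p)"
  proof
    fix x assume "x \<in> (\<Union>n. E n)"
    then obtain n where "x \<in> E n" by blast
    then obtain i where "x \<in> ball (c n i) (d n i)" using cd(2)[of n] by blast
    then have "x \<in> U (n, i)" by (simp add: U_def)
    then show "x \<in> (\<Union>p. U p)" by blast
  qed
  moreover have "bounded (U p)" for p by (simp add: U_def split: prod.split)
  ultimately show "\<exists>(I::(nat\<times>nat) set) U. countable I \<and> (\<Union>n. E n) \<subseteq> (\<Union>i\<in>I. U i) \<and>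
      (\<forall>i\<in>I. bounded (U i)) \<and> (\<forall>J\<subseteq>I. finite J \<longrightarrow> (\<Sum>i\<in>J. diameter (U i) powr s) \<le> \<eta>)"
    by (intro exI[of _ UNIV] exI[of _ U] conjI ballI allI impI countableI_type) simp_all
qed

section \<open>Words acting on a graph directed system\<close>

text \<open>The conformal structure enters only through the scalar \<open>g\<close>, the norm of the
  derivative: distances are multiplied by \<open>g\<close> to first order, uniformly on the compact
  sets \<open>K e\<close>, and \<open>g\<close> satisfies a multiplicative Hoelder bound. The
  normalisations \<open>gmin \<le> 1\<close> and \<open>1 \<le> gmax\<close> make their powers
  monotone in the length of a word.\<close>

locale metric_gdms =
  fixes A :: "'a set" and T :: "('a \<times> 'a) set"
    and K :: "'a \<Rightarrow> 'v::euclidean_space set" and \<phi> :: "'a \<Rightarrow> 'v \<Rightarrow> 'v"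
    and g :: "'a \<Rightarrow> 'v \<Rightarrow> real" and y :: "'a \<Rightarrow> 'v"
    and s L \<alpha> \<rho> Dm gmin gmax :: real
  assumes finite_A: "finite A" and T_subset: "T \<subseteq> A \<times> A"
    and K_compact: "e \<in> A \<Longrightarrow> compact (K e)"
    and s_bounds: "0 < s" "s < 1"
    and contraction: "e \<in> A \<Longrightarrow> x \<in> K e \<Longrightarrow> z \<in> K e \<Longrightarrow> dist (\<phi> e x) (\<phi> e z) \<le> s * dist x z"
    and injective: "e \<in> A \<Longrightarrow> inj_on (\<phi> e) (K e)"
    and composable: "(e, f) \<in> T \<Longrightarrow> x \<in> K f \<Longrightarrow> \<phi> f x \<in> K e"
    and osc: "e \<in> A \<Longrightarrow> f \<in> A \<Longrightarrow> e \<noteq> f \<Longrightarrow> \<phi> e ` interior (K e) \<inter> \<phi> f ` interior (K f) = {}"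
    and L_nonneg: "0 \<le> L" and alpha_pos: "0 < \<alpha>"
    and holder: "e \<in> A \<Longrightarrow> x \<in> K e \<Longrightarrow> z \<in> K e \<Longrightarrow> g e x \<le> g e z * exp (L * dist x z powr \<alpha>)"
    and gmin: "0 < gmin" "gmin \<le> 1" "e \<in> A \<Longrightarrow> x \<in> K e \<Longrightarrow> gmin \<le> g e x"
    and gmax: "1 \<le> gmax" "e \<in> A \<Longrightarrow> x \<in> K e \<Longrightarrow> g e x \<le> gmax"
    and deriv_approx: "0 < \<eta> \<Longrightarrow> \<exists>\<delta>>0. \<forall>e\<in>A. \<forall>x\<in>K e. \<forall>z\<in>K e. dist x z \<le> \<delta> \<longrightarrow>
        \<bar>dist (\<phi> e x) (\<phi> e z) - g e x * dist x z\<bar> \<le> \<eta> * dist x z"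
    and centre: "e \<in> A \<Longrightarrow> cball (y e) \<rho> \<subseteq> interior (K e)" and rho_pos: "0 < \<rho>"
    and Dm: "e \<in> A \<Longrightarrow> x \<in> K e \<Longrightarrow> z \<in> K e \<Longrightarrow> dist x z \<le> Dm" "0 < Dm"
begin

abbreviation wm :: "'a list \<Rightarrow> 'v \<Rightarrow> 'v" where "wm \<equiv> foldr \<phi>"

text \<open>The chain rule for similarities: in the conformal case this product is the norm of the
  derivative of \<open>wm w\<close> at \<open>x\<close>.\<close>

primrec gp :: "'a list \<Rightarrow> 'v \<Rightarrow> real" where
  "gp [] x = 1"
| "gp (e # w) x = g e (wm w x) * gp w x"

definition adm :: "'a list \<Rightarrow> bool" where
  "adm w \<longleftrightarrow> set w \<subseteq> A \<and> successively (\<lambda>e f. (e, f) \<in> T) w"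

text \<open>The map of the last letter acts first, so its domain decides; the empty word is the
  identity of the whole space.\<close>

definition wdom :: "'a list \<Rightarrow> 'v set" where
  "wdom w = (if w = [] then UNIV else K (last w))"

text \<open>One reference point per letter is enough, since moving it changes the value by a factor
  of at most \<open>\<kappa>\<close>.\<close>

definition r :: "'a list \<Rightarrow> real" where "r w = gp w (y (last w))"

lemma adm_Nil [simp]: "adm []" by (simp add: adm_def)

lemma adm_Cons: "adm (e # w) \<longleftrightarrow> e \<in> A \<and> adm w \<and> (w = [] \<or> (e, hd w) \<in> T)"
  by (auto simp: adm_def successively_Cons)

lemma adm_append: "adm (u @ v) \<longleftrightarrow> adm u \<and> adm v \<and> (u = [] \<or> v = [] \<or> (last u, hd v) \<in> T)"
  by (auto simp: adm_def successively_append_iff)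

lemma adm_last: "adm w \<Longrightarrow> w \<noteq> [] \<Longrightarrow> last w \<in> A"
  by (auto simp: adm_def)

lemma gp_append: "gp (u @ v) x = gp u (wm v x) * gp v x"
  by (induction u) auto

lemma wdom_Cons: "x \<in> wdom (e # w) \<Longrightarrow> x \<in> wdom w"
  by (auto simp: wdom_def split: if_splits)

lemma wm_in: "adm (e # w) \<Longrightarrow> x \<in> wdom (e # w) \<Longrightarrow> wm w x \<in> K e"
proof (induction w arbitrary: e)
  case (Cons f w)
  then have "wm w x \<in> K f" using wdom_Cons by (auto simp: adm_Cons)
  then show ?case using Cons.prems composable by (auto simp: adm_Cons)
qed (simp add: wdom_def)

lemma wm_in_append:
  assumes "adm (u @ v)" "u \<noteq> []" "x \<in> wdom (u @ v)"
  shows "wm v x \<in> K (last u)"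
  using assms
proof (induction u)
  case (Cons e u)
  show ?case
  proof (cases "u = []")
    case True
    then show ?thesis using Cons.prems wm_in[of e v x] by simp
  next
    case False
    then show ?thesis using Cons wdom_Cons by (auto simp: adm_Cons)
  qed
qed simp

lemma y_in: "e \<in> A \<Longrightarrow> y e \<in> interior (K e)"
  using centre[of e] rho_pos by auto

lemma y_in_K: "e \<in> A \<Longrightarrow> y e \<in> K e"
  using y_in interior_subset by blast

lemma y_wdom: "adm w \<Longrightarrow> w \<noteq> [] \<Longrightarrow> y (last w) \<in> wdom w"
  using y_in_K adm_last by (auto simp: wdom_def)

section \<open>Contraction and bounded distortion\<close>

lemma wm_dist:
  assumes "adm w" "x \<in> wdom w" "z \<in> wdom w"
  shows "dist (wm w x) (wm w z) \<le> s ^ length w * dist x z"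
  using assms
proof (induction w)
  case (Cons e w)
  have "dist (wm (e # w) x) (wm (e # w) z) \<le> s * dist (wm w x) (wm w z)"
    using contraction[of e] wm_in[of e w] Cons.prems by (auto simp: adm_Cons)
  also have "\<dots> \<le> s * (s ^ length w * dist x z)"
    using Cons s_bounds by (intro mult_left_mono Cons.IH) (auto simp: adm_Cons intro: wdom_Cons)
  finally show ?case by (simp add: mult_ac)
qed simp

lemma wm_dist_Dm:
  assumes "adm w" "w \<noteq> []" "x \<in> wdom w" "z \<in> wdom w"
  shows "dist (wm w x) (wm w z) \<le> s ^ length w * Dm"
proof -
  have "dist (wm w x) (wm w z) \<le> s ^ length w * dist x z" by (rule wm_dist[OF assms(1,3,4)])
  also have "\<dots> \<le> s ^ length w * Dm"
    using Dm(1)[of "last w" x z] assms adm_last[of w] s_bounds by (intro mult_left_mono) (auto simp: wdom_def)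
  finally show ?thesis .
qed

lemma gp_ge: "adm w \<Longrightarrow> x \<in> wdom w \<Longrightarrow> gmin ^ length w \<le> gp w x"
proof (induction w)
  case (Cons e w)
  then have "e \<in> A" "wm w x \<in> K e" by (auto simp: adm_Cons intro: wm_in)
  from gmin(3)[OF this] Cons have "gmin * gmin ^ length w \<le> g e (wm w x) * gp w x"
    using gmin(1) wdom_Cons by (intro mult_mono) (auto simp: adm_Cons)
  then show ?case by simp
qed simp

lemma gp_pos: "adm w \<Longrightarrow> x \<in> wdom w \<Longrightarrow> 0 < gp w x"
  using gp_ge[of w x] gmin(1) by (meson less_le_trans zero_less_power)

lemma gp_le: "adm w \<Longrightarrow> x \<in> wdom w \<Longrightarrow> gp w x \<le> gmax ^ length w"
proof (induction w)
  case (Cons e w)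
  then have "g e (wm w x) * gp w x \<le> gmax * gmax ^ length w"
    using gmax wm_in[of e w x] wdom_Cons gp_pos[of w x] by (intro mult_mono) (auto simp: adm_Cons)
  then show ?case by simp
qed simp

lemma r_pos: "adm w \<Longrightarrow> w \<noteq> [] \<Longrightarrow> 0 < r w"
  unfolding r_def by (intro gp_pos y_wdom)

text \<open>The exponent is the sum of the Hoelder errors
  \<open>L * (s ^ k * Dm) powr \<alpha>\<close> over all \<open>k\<close>, a geometric
  series.\<close>

definition \<kappa> :: real where "\<kappa> = exp (L * Dm powr \<alpha> * (1 / (1 - s powr \<alpha>)))"

lemma s_powr_bounds: "0 < s powr \<alpha>" "s powr \<alpha> < 1"
proof -
  show "0 < s powr \<alpha>" using s_bounds by simp
  show "s powr \<alpha> < 1" using s_bounds alpha_pos powr_less_mono2[of \<alpha> s 1] by simp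
qed

lemma kappa_ge: "1 \<le> \<kappa>"
  unfolding \<kappa>_def using s_powr_bounds L_nonneg by simp

text \<open>Two points reach the letter \<open>e\<close> after \<open>w\<close> has brought them
  within \<open>s ^ length w * Dm\<close> of each other, so this letter contributes one term of the
  geometric series.\<close>

lemma gp_distortion_sum:
  assumes "adm w" "x \<in> wdom w" "z \<in> wdom w"
  shows "gp w x \<le> gp w z * exp (L * Dm powr \<alpha> * (\<Sum>k<length w. (s powr \<alpha>) ^ k))"
  using assms
proof (induction w)
  case (Cons e w)
  have w: "adm w" "x \<in> wdom w" "z \<in> wdom w" "e \<in> A" using Cons.prems wdom_Cons by (auto simp: adm_Cons)
  have in_K: "wm w x \<in> K e" "wm w z \<in> K e" using Cons.prems by (auto intro: wm_in)
  have "dist (wm w x) (wm w z) \<le> s ^ length w * Dm"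
  proof (cases "w = []")
    case True
    then show ?thesis using in_K Dm(1)[OF w(4)] by simp
  next
    case False
    then show ?thesis using wm_dist_Dm w by blast
  qed
  then have "dist (wm w x) (wm w z) powr \<alpha> \<le> (s ^ length w * Dm) powr \<alpha>"
    using alpha_pos by (intro powr_mono2) auto
  also have "\<dots> = (s powr \<alpha>) ^ length w * Dm powr \<alpha>"
    using s_bounds Dm(2) by (simp add: powr_mult powr_powr powr_realpow[symmetric] mult.commute)
  finally have "exp (L * dist (wm w x) (wm w z) powr \<alpha>) \<le> exp (L * ((s powr \<alpha>) ^ length w * Dm powr \<alpha>))"
    using L_nonneg by (simp add: mult_left_mono)
  moreover have "g e (wm w x) \<le> g e (wm w z) * exp (L * dist (wm w x) (wm w z) powr \<alpha>)"
    using holder w in_K by blast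
  moreover have gz: "0 < g e (wm w z)" using gmin(1) gmin(3)[OF w(4) in_K(2)] by linarith
  ultimately have 1: "g e (wm w x) \<le> g e (wm w z) * exp (L * ((s powr \<alpha>) ^ length w * Dm powr \<alpha>))"
    by (meson less_imp_le mult_left_mono order_trans)
  have "g e (wm w x) * gp w x \<le> (g e (wm w z) * exp (L * ((s powr \<alpha>) ^ length w * Dm powr \<alpha>))) *
      (gp w z * exp (L * Dm powr \<alpha> * (\<Sum>k<length w. (s powr \<alpha>) ^ k)))"
    using 1 Cons.IH[OF w(1-3)] gp_pos[OF w(1,2)] gz by (intro mult_mono) auto
  also have "\<dots> = g e (wm w z) * gp w z * exp (L * Dm powr \<alpha> * (\<Sum>k<length (e # w). (s powr \<alpha>) ^ k))"
    by (simp add: exp_add[symmetric] distrib_left mult_ac)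
  finally show ?case by simp
qed simp

lemma gp_distortion:
  assumes "adm w" "x \<in> wdom w" "z \<in> wdom w"
  shows "gp w x \<le> \<kappa> * gp w z"
proof -
  have "(\<Sum>k<length w. (s powr \<alpha>) ^ k) = (1 - (s powr \<alpha>) ^ length w) / (1 - s powr \<alpha>)"
    using s_powr_bounds by (simp add: sum_gp_strict)
  also have "\<dots> \<le> 1 / (1 - s powr \<alpha>)" using s_powr_bounds by (intro divide_right_mono) auto
  finally have "exp (L * Dm powr \<alpha> * (\<Sum>k<length w. (s powr \<alpha>) ^ k)) \<le> \<kappa>"
    unfolding \<kappa>_def exp_le_cancel_iff using L_nonneg by (intro mult_left_mono) auto
  then have "gp w z * exp (L * Dm powr \<alpha> * (\<Sum>k<length w. (s powr \<alpha>) ^ k)) \<le> gp w z * \<kappa>"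
    using gp_pos[OF assms(1,3)] by (intro mult_left_mono) auto
  with gp_distortion_sum[OF assms] show ?thesis by (simp add: mult.commute)
qed

text \<open>The factorisation is exact if \<open>gp u\<close> is taken at the image of the reference
  point of \<open>v\<close>; moving that point to the reference point of \<open>u\<close> costs
  \<open>\<kappa>\<close>.\<close>

lemma r_append:
  assumes "adm (u @ v)" "u \<noteq> []" "v \<noteq> []"
  shows r_append_le: "r (u @ v) \<le> \<kappa> * (r u * r v)" and r_append_ge: "r u * r v \<le> \<kappa> * r (u @ v)"
proof -
  have u: "adm u" "adm v" using assms by (auto simp: adm_append)
  let ?g = "gp u (wm v (y (last v)))"
  have "wm v (y (last v)) \<in> wdom u"
    using wm_in_append[OF assms(1,2)] y_wdom[OF assms(1)] assms by (simp add: wdom_def)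
  then have "?g \<le> \<kappa> * r u" "r u \<le> \<kappa> * ?g"
    unfolding r_def using gp_distortion[OF u(1)] y_wdom[OF u(1) assms(2)] by blast+
  then have "?g * r v \<le> \<kappa> * r u * r v" "r u * r v \<le> \<kappa> * ?g * r v"
    using r_pos[OF u(2) assms(3)] by (auto intro!: mult_right_mono)
  then show "r (u @ v) \<le> \<kappa> * (r u * r v)" "r u * r v \<le> \<kappa> * r (u @ v)"
    using assms(3) by (simp_all add: r_def gp_append mult_ac)
qed

section \<open>Distances compared with the derivative product\<close>

lemma deriv_approx_exp:
  fixes \<epsilon> :: real
  assumes \<epsilon>: "0 < \<epsilon>"
  obtains \<delta> where "0 < \<delta>" "\<And>e x z. e \<in> A \<Longrightarrow> x \<in> K e \<Longrightarrow> z \<in> K e \<Longrightarrow> dist x z \<le> \<delta> \<Longrightarrow>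
      exp (- \<epsilon>) * (g e x * dist x z) \<le> dist (\<phi> e x) (\<phi> e z) \<and>
      dist (\<phi> e x) (\<phi> e z) \<le> exp \<epsilon> * (g e x * dist x z)"
proof -
  \<comment> \<open>Since \<open>g\<close> is at least \<open>gmin\<close>, this additive error is a
    relative error \<open>1 - exp (- \<epsilon>)\<close>. It gives the lower bound directly and the
    upper one because \<open>1 - exp (- \<epsilon>) \<le> exp \<epsilon> - 1\<close>.\<close>
  define \<eta> where "\<eta> = gmin * (1 - exp (- \<epsilon>))"
  have "0 < \<eta>" unfolding \<eta>_def using gmin \<epsilon> by (intro mult_pos_pos) auto
  from deriv_approx[OF this] obtain \<delta> where \<delta>: "0 < \<delta>"
    "\<forall>e\<in>A. \<forall>x\<in>K e. \<forall>z\<in>K e. dist x z \<le> \<delta> \<longrightarrow>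
        \<bar>dist (\<phi> e x) (\<phi> e z) - g e x * dist x z\<bar> \<le> \<eta> * dist x z" by auto
  show thesis
  proof (rule that[OF \<delta>(1)])
    fix e x z assume e: "e \<in> A" "x \<in> K e" "z \<in> K e" "dist x z \<le> \<delta>"
    have 1: "\<bar>dist (\<phi> e x) (\<phi> e z) - g e x * dist x z\<bar> \<le> \<eta> * dist x z" using \<delta>(2) e by blast
    have "\<eta> \<le> g e x * (1 - exp (- \<epsilon>))"
      unfolding \<eta>_def using gmin(3)[OF e(1,2)] \<epsilon> by (intro mult_right_mono) auto
    then have "\<eta> * dist x z \<le> g e x * (1 - exp (- \<epsilon>)) * dist x z" by (intro mult_right_mono) auto
    then have 2: "\<eta> * dist x z \<le> (1 - exp (- \<epsilon>)) * (g e x * dist x z)" by (simp add: mult_ac)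
    have "0 \<le> g e x * dist x z" using gmin(1) gmin(3)[OF e(1,2)] by simp
    moreover have "2 \<le> exp \<epsilon> + exp (- \<epsilon>)"
      using sum_squares_ge_zero[of "exp (\<epsilon>/2) - exp (-\<epsilon>/2)" 0]
      by (simp add: algebra_simps exp_add[symmetric])
    then have "1 - exp (- \<epsilon>) \<le> exp \<epsilon> - 1" by simp
    ultimately have 3: "(1 - exp (- \<epsilon>)) * (g e x * dist x z) \<le> (exp \<epsilon> - 1) * (g e x * dist x z)"
      by (intro mult_right_mono)
    show "exp (- \<epsilon>) * (g e x * dist x z) \<le> dist (\<phi> e x) (\<phi> e z) \<and>
      dist (\<phi> e x) (\<phi> e z) \<le> exp \<epsilon> * (g e x * dist x z)"
      using 1 2 3 unfolding left_diff_distrib abs_le_iff mult_1_left by linarith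
  qed
qed

text \<open>Once the inner word has contracted below the scale \<open>\<delta>\<close> of the
  first-order approximation, each further letter multiplies distances by \<open>g\<close> up to
  \<open>exp \<epsilon>\<close>. The boundedly many letters before that are absorbed into the
  constant.\<close>

lemma wm_dist_upper:
  fixes \<epsilon> :: real
  assumes \<epsilon>: "0 < \<epsilon>"
  obtains C where "0 < C" "\<And>w x z. adm w \<Longrightarrow> w \<noteq> [] \<Longrightarrow> x \<in> wdom w \<Longrightarrow> z \<in> wdom w \<Longrightarrow>
    dist (wm w x) (wm w z) \<le> C * (exp (\<epsilon> * length w) * gp w x)"
proof -
  obtain \<delta> where \<delta>: "0 < \<delta>" "\<And>e x z. e \<in> A \<Longrightarrow> x \<in> K e \<Longrightarrow> z \<in> K e \<Longrightarrow> dist x z \<le> \<delta> \<Longrightarrow>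
      dist (\<phi> e x) (\<phi> e z) \<le> exp \<epsilon> * (g e x * dist x z)"
    using deriv_approx_exp[OF \<epsilon>] by metis
  obtain N0 where N0: "s ^ N0 < \<delta> / Dm"
    using real_arch_pow_inv[of "\<delta> / Dm" s] \<delta>(1) Dm(2) s_bounds by auto
  \<comment> \<open>The successor ensures that a word of length at least \<open>N\<close> is
    nonempty, as the induction hypothesis requires.\<close>
  define N where "N = Suc N0"
  define C where "C = Dm / gmin ^ N"
  have C: "0 < C" unfolding C_def using Dm(2) gmin(1) by simp
  have small: "s ^ n * Dm \<le> \<delta>" if "N \<le> n" for n
  proof -
    have "s ^ n \<le> s ^ N0" using that s_bounds by (intro power_decreasing) (auto simp: N_def)
    then have "s ^ n \<le> \<delta> / Dm" using N0 by linarith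
    then show ?thesis using Dm(2) by (simp add: field_simps)
  qed
  show thesis
  proof (rule that[OF C])
    fix w x z
    show "adm w \<Longrightarrow> w \<noteq> [] \<Longrightarrow> x \<in> wdom w \<Longrightarrow> z \<in> wdom w \<Longrightarrow>
      dist (wm w x) (wm w z) \<le> C * (exp (\<epsilon> * length w) * gp w x)"
    proof (induction w)
      case (Cons e w)
      have w: "adm w" "x \<in> wdom w" "z \<in> wdom w" "e \<in> A" using Cons.prems wdom_Cons by (auto simp: adm_Cons)
      have in_K: "wm w x \<in> K e" "wm w z \<in> K e" using Cons.prems by (auto intro: wm_in)
      show ?case
      proof (cases "length w < N")
        case True
        have "dist (wm (e # w) x) (wm (e # w) z) \<le> s ^ length (e # w) * Dm"
          using Cons.prems by (intro wm_dist_Dm) auto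
        also have "\<dots> \<le> 1 * Dm" using s_bounds Dm(2) by (intro mult_right_mono power_le_one) auto
        also have "\<dots> = C * gmin ^ N" using gmin(1) by (simp add: C_def)
        also have "\<dots> \<le> C * gmin ^ length (e # w)"
          using True C gmin by (intro mult_left_mono power_decreasing) auto
        also have "\<dots> \<le> C * (1 * gp (e # w) x)"
          using C gp_ge[OF Cons.prems(1,3)] by (simp add: mult_left_mono del: gp.simps)
        also have "\<dots> \<le> C * (exp (\<epsilon> * length (e # w)) * gp (e # w) x)"
          using C \<epsilon> gp_pos[OF Cons.prems(1,3)] by (intro mult_left_mono mult_right_mono) auto
        finally show ?thesis .
      next
        case False
        then have ne: "w \<noteq> []" by (auto simp: N_def)
        have "dist (wm w x) (wm w z) \<le> s ^ length w * Dm" using w ne by (intro wm_dist_Dm)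
        also have "\<dots> \<le> \<delta>" using False by (intro small) simp
        finally have "dist (wm (e # w) x) (wm (e # w) z) \<le> exp \<epsilon> * (g e (wm w x) * dist (wm w x) (wm w z))"
          using \<delta>(2)[OF w(4) in_K] by simp
        also have "\<dots> \<le> exp \<epsilon> * (g e (wm w x) * (C * (exp (\<epsilon> * length w) * gp w x)))"
          using Cons.IH[OF w(1) ne w(2,3)] gmin(1) gmin(3)[OF w(4) in_K(1)] by (intro mult_left_mono) auto
        also have "\<dots> = C * (exp (\<epsilon> * length (e # w)) * gp (e # w) x)"
          by (simp add: algebra_simps exp_add)
        finally show ?thesis .
      qed
    qed simp
  qed
qed

text \<open>A pair of points that starts within \<open>\<delta>\<close> stays within
  \<open>\<delta>\<close>, because all maps contract. The approximation is thus valid at every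
  letter, and the lower bound needs no constant.\<close>

lemma wm_dist_lower:
  fixes \<epsilon> :: real
  assumes \<epsilon>: "0 < \<epsilon>"
  obtains \<delta> where "0 < \<delta>" "\<And>w x z. adm w \<Longrightarrow> x \<in> wdom w \<Longrightarrow> z \<in> wdom w \<Longrightarrow> dist x z \<le> \<delta> \<Longrightarrow>
    exp (- \<epsilon> * length w) * gp w x * dist x z \<le> dist (wm w x) (wm w z)"
proof -
  obtain \<delta> where \<delta>: "0 < \<delta>" "\<And>e x z. e \<in> A \<Longrightarrow> x \<in> K e \<Longrightarrow> z \<in> K e \<Longrightarrow> dist x z \<le> \<delta> \<Longrightarrow>
      exp (- \<epsilon>) * (g e x * dist x z) \<le> dist (\<phi> e x) (\<phi> e z)"
    using deriv_approx_exp[OF \<epsilon>] by metis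
  show thesis
  proof (rule that[OF \<delta>(1)])
    fix w x z
    show "adm w \<Longrightarrow> x \<in> wdom w \<Longrightarrow> z \<in> wdom w \<Longrightarrow> dist x z \<le> \<delta> \<Longrightarrow>
      exp (- \<epsilon> * length w) * gp w x * dist x z \<le> dist (wm w x) (wm w z)"
    proof (induction w)
      case (Cons e w)
      have w: "adm w" "x \<in> wdom w" "z \<in> wdom w" "e \<in> A" using Cons.prems wdom_Cons by (auto simp: adm_Cons)
      have in_K: "wm w x \<in> K e" "wm w z \<in> K e" using Cons.prems by (auto intro: wm_in)
      have "dist (wm w x) (wm w z) \<le> s ^ length w * dist x z" using w by (intro wm_dist)
      also have "\<dots> \<le> 1 * dist x z" using s_bounds by (intro mult_right_mono power_le_one) auto
      finally have d: "dist (wm w x) (wm w z) \<le> \<delta>" using Cons.prems by simp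
      have "exp (- \<epsilon> * length (e # w)) * gp (e # w) x * dist x z =
          exp (- \<epsilon>) * (g e (wm w x) * (exp (- \<epsilon> * length w) * gp w x * dist x z))"
        by (simp add: algebra_simps exp_diff exp_minus field_simps exp_add)
      also have "\<dots> \<le> exp (- \<epsilon>) * (g e (wm w x) * dist (wm w x) (wm w z))"
        using Cons.IH[OF w(1-3) Cons.prems(4)] gmin(1) gmin(3)[OF w(4) in_K(1)]
        by (intro mult_left_mono) auto
      also have "\<dots> \<le> dist (wm (e # w) x) (wm (e # w) z)" using \<delta>(2)[OF w(4) in_K d] by simp
      finally show ?case .
    qed simp
  qed
qed

section \<open>Openness and disjointness of images\<close>

lemma wm_inj: "adm w \<Longrightarrow> inj_on (wm w) (wdom w)"
proof (induction w)
  case (Cons e w)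
  then have "inj_on (wm w) (wdom w)" "e \<in> A" by (auto simp: adm_Cons)
  then have "inj_on (wm w) (wdom (e # w))" using wdom_Cons by (meson inj_on_subset subsetI)
  moreover have "wm w ` wdom (e # w) \<subseteq> K e" using Cons.prems wm_in by blast
  then have "inj_on (\<phi> e) (wm w ` wdom (e # w))" using injective[OF \<open>e \<in> A\<close>] inj_on_subset by blast
  ultimately show ?case by (simp add: comp_inj_on[unfolded comp_def] comp_def)
qed simp

lemma wm_continuous: "adm w \<Longrightarrow> continuous_on (wdom w) (wm w)"
proof (rule lipschitz_on_continuous_on)
  assume "adm w"
  then show "(s ^ length w)-lipschitz_on (wdom w) (wm w)"
    using s_bounds by (auto simp: lipschitz_on_def intro: wm_dist)
qed

text \<open>Invariance of domain yields openness from continuity and injectivity alone; no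
  derivative enters.\<close>

lemma wm_interior_open:
  assumes "adm w" "w \<noteq> []"
  shows "open (wm w ` interior (K (last w)))"
proof (rule invariance_of_domain)
  have "interior (K (last w)) \<subseteq> wdom w" using assms interior_subset by (auto simp: wdom_def)
  then show "continuous_on (interior (K (last w))) (wm w)" "inj_on (wm w) (interior (K (last w)))"
    using wm_continuous wm_inj assms by (auto intro: continuous_on_subset inj_on_subset)
qed simp

lemma wm_interior_in:
  assumes "adm (u @ v)" "u \<noteq> []" "v \<noteq> []"
  shows "wm v ` interior (K (last v)) \<subseteq> interior (K (last u))"
proof (rule interior_maximal)
  show "wm v ` interior (K (last v)) \<subseteq> K (last u)"
    using wm_in_append[OF assms(1,2)] assms interior_subset by (fastforce simp: wdom_def)
  show "open (wm v ` interior (K (last v)))"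
    using assms by (intro wm_interior_open) (auto simp: adm_append)
qed

text \<open>At the first differing letter the open set condition separates the images. Later letters
  only shrink them inside the interiors, and the injective map of the common prefix \<open>z\<close>
  preserves disjointness.\<close>

lemma wm_disjoint:
  assumes "adm (z @ e # u)" "adm (z @ f # v)" "e \<noteq> f"
  shows "wm (z @ e # u) ` interior (K (last (e # u))) \<inter> wm (z @ f # v) ` interior (K (last (f # v))) = {}"
proof -
  have *: "wm (e # u) ` interior (K (last (e # u))) \<subseteq> \<phi> e ` interior (K e)" if "adm (e # u)" for e u
  proof (cases "u = []")
    case False
    then have "wm u ` interior (K (last u)) \<subseteq> interior (K e)"
      using wm_interior_in[of "[e]" u] that by simp
    then show ?thesis using False by auto
  qed simp
  have a: "adm (e # u)" "adm (f # v)" using assms by (auto simp: adm_append)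
  then have "e \<in> A" "f \<in> A" by (auto simp: adm_Cons)
  then have disj: "wm (e # u) ` interior (K (last (e # u))) \<inter> wm (f # v) ` interior (K (last (f # v))) = {}"
    using *[OF a(1)] *[OF a(2)] osc[OF _ _ assms(3)] by blast
  have sub: "wm (e # u) ` interior (K (last (e # u))) \<subseteq> wdom z" if "adm (z @ e # u)" for e u
  proof (cases "z = []")
    case False
    then show ?thesis
      using order_trans[OF wm_interior_in[OF that False] interior_subset] by (simp add: wdom_def)
  qed (simp add: wdom_def)
  have "inj_on (wm z) (wdom z)" using assms by (intro wm_inj) (auto simp: adm_append)
  then have "wm z ` (wm (e # u) ` interior (K (last (e # u)))) \<inter> wm z ` (wm (f # v) ` interior (K (last (f # v))))
      = wm z ` (wm (e # u) ` interior (K (last (e # u))) \<inter> wm (f # v) ` interior (K (last (f # v))))"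
    using sub[OF assms(1)] sub[OF assms(2)] by (rule inj_on_image_Int[symmetric])
  then show ?thesis using disj by (simp add: image_comp comp_def)
qed

text \<open>
  The image of a small ball is open, and its frontier lies in the image of the sphere, which
  \<open>wm_dist_lower\<close> keeps away from the image of the centre.
\<close>

lemma wm_ball:
  fixes \<epsilon> :: real
  assumes \<epsilon>: "0 < \<epsilon>"
  obtains c where "0 < c" "\<And>w. adm w \<Longrightarrow> w \<noteq> [] \<Longrightarrow>
    ball (wm w (y (last w))) (c * (exp (- \<epsilon> * length w) * r w)) \<subseteq> wm w ` interior (K (last w))"
proof -
  obtain \<delta> where \<delta>: "0 < \<delta>" "\<And>w x z. adm w \<Longrightarrow> x \<in> wdom w \<Longrightarrow> z \<in> wdom w \<Longrightarrow> dist x z \<le> \<delta> \<Longrightarrow>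
    exp (- \<epsilon> * length w) * gp w x * dist x z \<le> dist (wm w x) (wm w z)"
    using wm_dist_lower[OF \<epsilon>] by metis
  \<comment> \<open>The radius \<open>\<rho>\<close> keeps the ball inside the interior,
    \<open>\<delta>\<close> keeps it in the range of the lower distance bound.\<close>
  define c where "c = min \<rho> \<delta>"
  have c: "0 < c" using rho_pos \<delta> by (simp add: c_def)
  show thesis
  proof (rule that[OF c])
    fix w assume w: "adm w" "w \<noteq> []"
    define p where "p = y (last w)"
    define R where "R = c * (exp (- \<epsilon> * length w) * r w)"
    have R: "0 < R" unfolding R_def using c r_pos[OF w] by simp
    have cb: "cball p c \<subseteq> interior (K (last w))"
      using centre[OF adm_last[OF w]] by (auto simp: p_def c_def)
    have cbd: "cball p c \<subseteq> wdom w" using cb interior_subset w by (auto simp: wdom_def)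
    have contc: "continuous_on (cball p c) (wm w)" using wm_continuous[OF w(1)] cbd continuous_on_subset by blast
    have opn: "open (wm w ` ball p c)"
    proof (rule invariance_of_domain)
      have "ball p c \<subseteq> wdom w" using cbd ball_subset_cball by blast
      then show "continuous_on (ball p c) (wm w)" "inj_on (wm w) (ball p c)"
        using wm_continuous wm_inj w by (auto intro: continuous_on_subset inj_on_subset)
    qed simp
    have "ball (wm w p) R \<subseteq> wm w ` ball p c"
    proof (rule ccontr)
      assume "\<not> ?thesis"
      then have "ball (wm w p) R - wm w ` ball p c \<noteq> {}" by blast
      moreover have "wm w p \<in> ball (wm w p) R \<inter> wm w ` ball p c" using R c by simp
      then have "ball (wm w p) R \<inter> wm w ` ball p c \<noteq> {}" by blast
      ultimately have "ball (wm w p) R \<inter> frontier (wm w ` ball p c) \<noteq> {}"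
        by (intro connected_Int_frontier) auto
      then obtain q where q: "q \<in> ball (wm w p) R" "q \<in> closure (wm w ` ball p c)" "q \<notin> wm w ` ball p c"
        using opn by (auto simp: frontier_def interior_open)
      have "closed (wm w ` cball p c)"
        using compact_continuous_image[OF contc compact_cball] by (rule compact_imp_closed)
      then have "closure (wm w ` ball p c) \<subseteq> wm w ` cball p c"
        by (intro closure_minimal image_mono ball_subset_cball)
      with q obtain z where z: "z \<in> cball p c" "q = wm w z" by blast
      with q have "z \<notin> ball p c" by blast
      with z have dz: "dist p z = c" by simp
      have "exp (- \<epsilon> * length w) * gp w p * dist p z \<le> dist (wm w p) (wm w z)"
      proof (rule \<delta>(2)[OF w(1)])
        show "p \<in> wdom w" "z \<in> wdom w" using cbd z c by auto
        show "dist p z \<le> \<delta>" using dz by (simp add: c_def)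
      qed
      then have "R \<le> dist (wm w p) q" unfolding dz by (simp add: R_def z r_def p_def mult_ac)
      with q(1) show False by simp
    qed
    also have "\<dots> \<subseteq> wm w ` interior (K (last w))" using cb ball_subset_cball by blast
    finally show "ball (wm w (y (last w))) (c * (exp (- \<epsilon> * length w) * r w)) \<subseteq> wm w ` interior (K (last w))"
      by (simp add: p_def R_def)
  qed
qed


section \<open>Exponential decay and powers of the derivative product\<close>

definition \<theta> :: real where "\<theta> = sqrt s"

lemma theta: "0 < \<theta>" "\<theta> < 1" "\<theta> * \<theta> = s"
  using s_bounds by (auto simp: \<theta>_def)

lemma ln_theta: "0 < ln (1 / \<theta>)" "exp (- ln (1 / \<theta>)) = \<theta>"
  using theta by (auto simp: ln_div)

lemma exp_ln_theta: "exp (a * ln (1 / \<theta>) * real n) = (\<theta> ^ n) powr (- a)"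
  using theta by (simp add: powr_def ln_realpow ln_div)

text \<open>Images shrink like \<open>s ^ n\<close>, and the lower distance bound with loss
  \<open>\<theta> ^ n\<close> transfers this to \<open>r\<close>. With \<open>\<theta>\<close> the
  square root of \<open>s\<close>, half of the decay pays for the loss and the other half
  remains.\<close>

lemma r_decay: obtains C where "1 \<le> C" "\<And>w. adm w \<Longrightarrow> w \<noteq> [] \<Longrightarrow> r w \<le> C * \<theta> ^ length w"
proof -
  obtain \<delta> where \<delta>: "0 < \<delta>" "\<And>w x z. adm w \<Longrightarrow> x \<in> wdom w \<Longrightarrow> z \<in> wdom w \<Longrightarrow> dist x z \<le> \<delta> \<Longrightarrow>
    exp (- ln (1 / \<theta>) * length w) * gp w x * dist x z \<le> dist (wm w x) (wm w z)"
    using wm_dist_lower[OF ln_theta(1)] by metis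
  define c where "c = min \<rho> \<delta>"
  have c: "0 < c" using rho_pos \<delta> by (simp add: c_def)
  show thesis
  proof (rule that[of "max 1 (Dm / c)"])
    fix w assume w: "adm w" "w \<noteq> []"
    obtain u :: 'v where u: "norm u = c" using c vector_choose_size[of c] by auto
    define p where "p = y (last w)"
    have "p + u \<in> cball p \<rho>" using u by (simp add: dist_norm c_def)
    then have pu: "p + u \<in> wdom w"
      using subsetD[OF order_trans[OF centre[OF adm_last[OF w]] interior_subset]] w
      by (simp add: p_def wdom_def)
    have pd: "p \<in> wdom w" using y_wdom[OF w] by (simp add: p_def)
    have "exp (- ln (1 / \<theta>) * length w) * gp w p * dist p (p + u) \<le> dist (wm w p) (wm w (p + u))"
      by (rule \<delta>(2)[OF w(1) pd pu]) (use u in \<open>simp add: c_def dist_norm\<close>)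
    also have "\<dots> \<le> s ^ length w * Dm" by (rule wm_dist_Dm[OF w pd pu])
    also have "s ^ length w = \<theta> ^ length w * \<theta> ^ length w"
      by (simp add: power_mult_distrib[symmetric] theta)
    also have "exp (- ln (1 / \<theta>) * length w) = \<theta> ^ length w"
      using exp_ln_theta[of "-1" "length w"] theta by simp
    finally have "\<theta> ^ length w * (r w * c) \<le> \<theta> ^ length w * (\<theta> ^ length w * Dm)"
      using u by (simp add: r_def p_def dist_norm mult_ac)
    then have "r w * c \<le> \<theta> ^ length w * Dm" using theta by simp
    then have "r w \<le> Dm / c * \<theta> ^ length w" using c by (simp add: field_simps)
    also have "\<dots> \<le> max 1 (Dm / c) * \<theta> ^ length w" using theta by (intro mult_right_mono) auto
    finally show "r w \<le> max 1 (Dm / c) * \<theta> ^ length w" .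
  qed simp
qed

text \<open>The constant of the decay is fixed once, so that estimates in different lemmas share
  it.\<close>

definition C0 :: real where
  "C0 = (SOME C. 1 \<le> C \<and> (\<forall>w. adm w \<longrightarrow> w \<noteq> [] \<longrightarrow> r w \<le> C * \<theta> ^ length w))"

lemma C0: "1 \<le> C0" "adm w \<Longrightarrow> w \<noteq> [] \<Longrightarrow> r w \<le> C0 * \<theta> ^ length w"
proof -
  have "\<exists>C. 1 \<le> C \<and> (\<forall>w. adm w \<longrightarrow> w \<noteq> [] \<longrightarrow> r w \<le> C * \<theta> ^ length w)"
    using r_decay by metis
  from someI_ex[OF this, folded C0_def]
  show "1 \<le> C0" "adm w \<Longrightarrow> w \<noteq> [] \<Longrightarrow> r w \<le> C0 * \<theta> ^ length w" by auto
qed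

text \<open>Here losses exponential in the length become powers of \<open>r\<close>: the decay of
  \<open>r\<close> bounds the length by a multiple of \<open>- ln (r w)\<close>, up to a
  constant.\<close>

lemma exp_length_le:
  assumes "adm w" "w \<noteq> []" "0 \<le> \<epsilon>"
  shows "exp (\<epsilon> * ln (1 / \<theta>) * length w) \<le> C0 powr \<epsilon> * r w powr (- \<epsilon>)"
proof -
  have "r w powr \<epsilon> \<le> (C0 * \<theta> ^ length w) powr \<epsilon>"
    using C0(2)[OF assms(1,2)] r_pos[OF assms(1,2)] assms(3) by (intro powr_mono2) auto
  also have "\<dots> = C0 powr \<epsilon> * (\<theta> ^ length w) powr \<epsilon>"
    using C0(1) theta by (simp add: powr_mult)
  finally have "r w powr \<epsilon> \<le> C0 powr \<epsilon> * (\<theta> ^ length w) powr \<epsilon>" .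
  then show ?thesis
    unfolding exp_ln_theta using theta r_pos[OF assms(1,2)] by (simp add: powr_minus field_simps)
qed

text \<open>The per-letter rate is \<open>\<epsilon> * ln (1 / \<theta>)\<close>, chosen so that the
  accumulated loss is at most a multiple of \<open>r w powr (- \<epsilon>)\<close>; the factor
  \<open>\<kappa>\<close> moves the base point to the reference point.\<close>

lemma diameter_wm_le:
  fixes \<epsilon> :: real
  assumes \<epsilon>: "0 < \<epsilon>"
  obtains C where "0 < C" "\<And>w. adm w \<Longrightarrow> w \<noteq> [] \<Longrightarrow> diameter (wm w ` K (last w)) \<le> C * r w powr (1 - \<epsilon>)"
proof -
  have "0 < \<epsilon> * ln (1 / \<theta>)" using \<epsilon> ln_theta by simp
  then obtain C where C: "0 < C" "\<And>w x z. adm w \<Longrightarrow> w \<noteq> [] \<Longrightarrow> x \<in> wdom w \<Longrightarrow> z \<in> wdom w \<Longrightarrow>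
    dist (wm w x) (wm w z) \<le> C * (exp (\<epsilon> * ln (1 / \<theta>) * length w) * gp w x)"
    using wm_dist_upper[of "\<epsilon> * ln (1 / \<theta>)"] by metis
  show thesis
  proof (rule that[of "C * C0 powr \<epsilon> * \<kappa>"])
    show "0 < C * C0 powr \<epsilon> * \<kappa>" using C(1) C0(1) kappa_ge by (intro mult_pos_pos) auto
    fix w assume w: "adm w" "w \<noteq> []"
    show "diameter (wm w ` K (last w)) \<le> C * C0 powr \<epsilon> * \<kappa> * r w powr (1 - \<epsilon>)"
    proof (rule diameter_le)
      show "wm w ` K (last w) \<noteq> {} \<or> 0 \<le> C * C0 powr \<epsilon> * \<kappa> * r w powr (1 - \<epsilon>)"
        using y_in_K[OF adm_last[OF w]] by blast
      fix p q assume "p \<in> wm w ` K (last w)" "q \<in> wm w ` K (last w)"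
      then obtain x z where x: "x \<in> wdom w" "z \<in> wdom w" "p = wm w x" "q = wm w z"
        using w by (auto simp: wdom_def)
      have "dist p q \<le> C * (exp (\<epsilon> * ln (1 / \<theta>) * length w) * gp w x)"
        unfolding x(3,4) by (rule C(2)[OF w x(1,2)])
      also have "\<dots> \<le> C * ((C0 powr \<epsilon> * r w powr (- \<epsilon>)) * (\<kappa> * r w))"
        unfolding r_def[of w]
        using C(1) exp_length_le[OF w, of \<epsilon>] \<epsilon> gp_distortion[OF w(1) x(1) y_wdom[OF w]] gp_pos[OF w(1) x(1)]
        by (intro mult_left_mono mult_mono) (auto simp: r_def)
      also have "\<dots> = C * C0 powr \<epsilon> * \<kappa> * (r w powr (- \<epsilon>) * r w powr 1)"
        using r_pos[OF w] by simp
      also have "r w powr (- \<epsilon>) * r w powr 1 = r w powr (1 - \<epsilon>)"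
        by (simp only: powr_add[symmetric]) (simp add: algebra_simps)
      finally show "norm (p - q) \<le> C * C0 powr \<epsilon> * \<kappa> * r w powr (1 - \<epsilon>)" by (simp add: dist_norm)
    qed
  qed
qed

lemma ball_in_wm:
  fixes \<epsilon> :: real
  assumes \<epsilon>: "0 < \<epsilon>"
  obtains c where "0 < c" "\<And>w. adm w \<Longrightarrow> w \<noteq> [] \<Longrightarrow>
    ball (wm w (y (last w))) (c * r w powr (1 + \<epsilon>)) \<subseteq> wm w ` interior (K (last w))"
proof -
  have "0 < \<epsilon> * ln (1 / \<theta>)" using \<epsilon> ln_theta by simp
  then obtain c where c: "0 < c" "\<And>w. adm w \<Longrightarrow> w \<noteq> [] \<Longrightarrow>
    ball (wm w (y (last w))) (c * (exp (- (\<epsilon> * ln (1 / \<theta>)) * length w) * r w)) \<subseteq> wm w ` interior (K (last w))"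
    using wm_ball[of "\<epsilon> * ln (1 / \<theta>)"] by metis
  show thesis
  proof (rule that[of "c / C0 powr \<epsilon>"])
    show "0 < c / C0 powr \<epsilon>" using c(1) C0(1) by simp
    fix w assume w: "adm w" "w \<noteq> []"
    have "exp (- (\<epsilon> * ln (1 / \<theta>)) * length w) * exp (\<epsilon> * ln (1 / \<theta>) * length w) = 1"
      by (simp add: exp_add[symmetric])
    moreover have "exp (- (\<epsilon> * ln (1 / \<theta>)) * length w) * exp (\<epsilon> * ln (1 / \<theta>) * length w) \<le>
        exp (- (\<epsilon> * ln (1 / \<theta>)) * length w) * (C0 powr \<epsilon> * r w powr (- \<epsilon>))"
      using exp_length_le[OF w, of \<epsilon>] \<epsilon> by (intro mult_left_mono) auto
    ultimately have "r w powr \<epsilon> \<le> exp (- (\<epsilon> * ln (1 / \<theta>)) * length w) * C0 powr \<epsilon>"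
      using r_pos[OF w] by (simp add: powr_minus field_simps)
    then have "r w powr \<epsilon> / C0 powr \<epsilon> \<le> exp (- (\<epsilon> * ln (1 / \<theta>)) * length w)"
      using C0(1) by (simp add: field_simps)
    then have "c * (r w powr \<epsilon> / C0 powr \<epsilon> * r w) \<le> c * (exp (- (\<epsilon> * ln (1 / \<theta>)) * length w) * r w)"
      using c(1) r_pos[OF w] by (intro mult_left_mono mult_right_mono) auto
    moreover have "c / C0 powr \<epsilon> * r w powr (1 + \<epsilon>) = c * (r w powr \<epsilon> / C0 powr \<epsilon> * r w)"
      using r_pos[OF w] by (simp add: powr_add)
    ultimately have "ball (wm w (y (last w))) (c / C0 powr \<epsilon> * r w powr (1 + \<epsilon>)) \<subseteq>
        ball (wm w (y (last w))) (c * (exp (- (\<epsilon> * ln (1 / \<theta>)) * length w) * r w))"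
      by (intro subset_ball) linarith
    with c(2)[OF w] show "ball (wm w (y (last w))) (c / C0 powr \<epsilon> * r w powr (1 + \<epsilon>)) \<subseteq> wm w ` interior (K (last w))"
      by blast
  qed
qed

section \<open>Covers by images of words\<close>

lemma compact_wm: "adm w \<Longrightarrow> w \<noteq> [] \<Longrightarrow> compact (wm w ` K (last w))"
  using wm_continuous[of w] K_compact[OF adm_last[of w]]
  by (intro compact_continuous_image) (auto simp: wdom_def)

text \<open>The family may be infinite, so its total weight is bounded through finite subfamilies.
  The minimal length \<open>k\<close> is what later turns a bounded weight at \<open>t\<close> into
  a small one at a larger exponent.\<close>

definition word_cover :: "'v set \<Rightarrow> real \<Rightarrow> nat \<Rightarrow> real \<Rightarrow> 'a list set \<Rightarrow> bool" where
  "word_cover E t k b W \<longleftrightarrow> countable W \<and> (\<forall>w\<in>W. adm w \<and> w \<noteq> [] \<and> k \<le> length w) \<and>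
     E \<subseteq> (\<Union>w\<in>W. wm w ` K (last w)) \<and> (\<forall>J\<subseteq>W. finite J \<longrightarrow> (\<Sum>w\<in>J. r w powr t) \<le> b)"

text \<open>
  The diameters of the sets of the cover are at most a power of \<open>r\<close> close to \<open>1\<close>, and \<open>r\<close> decays
  exponentially in the length; this absorbs the subexponential growth of the sums.
\<close>

lemma hausdorff_measure_zero_word_cover:
  assumes t: "0 < t" "t < \<tau>"
    and cov: "\<And>\<epsilon>::real. 0 < \<epsilon> \<Longrightarrow> \<exists>C>0. \<forall>k. \<exists>W. word_cover E t k (C * exp (\<epsilon> * k)) W"
  shows "hausdorff_measure \<tau> E = 0"
proof (rule hausdorff_measure_zeroI)
  show "0 < \<tau>" using t by simp
  fix \<eta> :: real assume \<eta>: "0 < \<eta>"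
  \<comment> \<open>The gap between \<open>t\<close> and \<open>\<tau>\<close> is halved: the upper
    half absorbs the exponent lost in the diameter bound, since
    \<open>(1 - \<epsilon>0) * \<tau> = \<tau>2\<close>, and the lower half is spent through
    \<open>b\<close>.\<close>
  define \<tau>2 where "\<tau>2 = (t + \<tau>) / 2"
  define \<epsilon>0 where "\<epsilon>0 = (\<tau> - \<tau>2) / \<tau>"
  have \<tau>2: "t < \<tau>2" "\<tau>2 < \<tau>" "0 < \<epsilon>0" "(1 - \<epsilon>0) * \<tau> = \<tau>2"
    using t by (auto simp: \<tau>2_def \<epsilon>0_def field_simps)
  obtain D where D: "0 < D" "\<And>w. adm w \<Longrightarrow> w \<noteq> [] \<Longrightarrow> diameter (wm w ` K (last w)) \<le> D * r w powr (1 - \<epsilon>0)"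
    using diameter_wm_le[OF \<tau>2(3)] by metis
  \<comment> \<open>Raising the exponent from \<open>t\<close> to \<open>\<tau>2\<close> gains
    \<open>(\<theta> powr b) ^ (2 * k)\<close>; one factor \<open>(\<theta> powr b) ^ k\<close>
    cancels the growth \<open>exp (\<epsilon> * k)\<close>, the other tends to
    \<open>0\<close>.\<close>
  define b where "b = (\<tau>2 - t) / 2"
  have b: "0 < b" using \<tau>2 by (simp add: b_def)
  define \<epsilon> where "\<epsilon> = b * ln (1 / \<theta>)"
  have "0 < \<epsilon>" using b ln_theta by (simp add: \<epsilon>_def)
  from cov[OF this] obtain C where C: "0 < C"
    and covk: "\<And>k. \<exists>W. word_cover E t k (C * exp (\<epsilon> * k)) W" by blast
  define M where "M = D powr \<tau> * C0 powr (\<tau>2 - t) * C"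
  have M: "0 < M" unfolding M_def using D(1) C C0(1) by (intro mult_pos_pos) auto
  have pw: "\<theta> powr b < 1" using theta b powr_less_mono2[of b \<theta> 1] by simp
  obtain k where k: "(\<theta> powr b) ^ k < \<eta> / M"
    using real_arch_pow_inv[of "\<eta> / M" "\<theta> powr b"] \<eta> M pw by auto
  obtain W where W: "countable W" "\<And>w. w \<in> W \<Longrightarrow> adm w \<and> w \<noteq> [] \<and> k \<le> length w"
    "E \<subseteq> (\<Union>w\<in>W. wm w ` K (last w))"
    and sm: "\<And>J. J \<subseteq> W \<Longrightarrow> finite J \<Longrightarrow> (\<Sum>w\<in>J. r w powr t) \<le> C * exp (\<epsilon> * k)"
    using covk[of k] by (auto simp: word_cover_def)
  have "(\<Sum>w\<in>J. diameter (wm w ` K (last w)) powr \<tau>) \<le> \<eta>" if J: "J \<subseteq> W" "finite J" for J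
  proof -
    have "diameter (wm w ` K (last w)) powr \<tau> \<le> D powr \<tau> * (C0 powr (\<tau>2 - t) * (\<theta> powr b) ^ (2 * k)) * r w powr t"
      if "w \<in> J" for w
    proof -
      have w: "adm w" "w \<noteq> []" "k \<le> length w" using W(2) J that by auto
      have "diameter (wm w ` K (last w)) powr \<tau> \<le> (D * r w powr (1 - \<epsilon>0)) powr \<tau>"
        using D(2)[OF w(1,2)] t compact_wm[OF w(1,2)]
        by (intro powr_mono2 diameter_ge_0 compact_imp_bounded) auto
      also have "\<dots> = D powr \<tau> * (r w powr (\<tau>2 - t) * r w powr t)"
        using D(1) r_pos[OF w(1,2)] \<tau>2(4) by (simp add: powr_mult powr_powr powr_add[symmetric])
      also have "r w powr (\<tau>2 - t) \<le> (C0 * \<theta> ^ k) powr (\<tau>2 - t)"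
      proof (rule powr_mono2)
        have "C0 * \<theta> ^ length w \<le> C0 * \<theta> ^ k"
          using C0(1) theta w(3) by (intro mult_left_mono power_decreasing) auto
        then show "r w \<le> C0 * \<theta> ^ k" using C0(2)[OF w(1,2)] by linarith
      qed (use \<tau>2 r_pos[OF w(1,2)] in auto)
      also have "\<dots> = C0 powr (\<tau>2 - t) * (\<theta> powr b) ^ (2 * k)"
      proof -
        have "b * real (2 * k) = real k * (\<tau>2 - t)" by (simp add: b_def)
        then have "(\<theta> powr b) ^ (2 * k) = (\<theta> ^ k) powr (\<tau>2 - t)"
          using theta by (simp only: powr_realpow[symmetric] powr_powr powr_gt_zero)
        then show ?thesis using C0(1) theta by (simp add: powr_mult)
      qed
      finally show ?thesis using D(1) by (simp add: mult_left_mono mult_right_mono mult_ac)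
    qed
    then have "(\<Sum>w\<in>J. diameter (wm w ` K (last w)) powr \<tau>) \<le>
        (\<Sum>w\<in>J. D powr \<tau> * (C0 powr (\<tau>2 - t) * (\<theta> powr b) ^ (2 * k)) * r w powr t)"
      by (rule sum_mono)
    also have "\<dots> = D powr \<tau> * (C0 powr (\<tau>2 - t) * (\<theta> powr b) ^ (2 * k)) * (\<Sum>w\<in>J. r w powr t)"
      by (simp add: sum_distrib_left)
    also have "\<dots> \<le> D powr \<tau> * (C0 powr (\<tau>2 - t) * (\<theta> powr b) ^ (2 * k)) * (C * exp (\<epsilon> * k))"
      using sm[OF J] by (intro mult_left_mono) auto
    also have "exp (\<epsilon> * k) = inverse ((\<theta> powr b) ^ k)"
    proof -
      have "(\<theta> powr b) ^ k = (\<theta> ^ k) powr b"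
        using theta by (simp add: powr_realpow[symmetric] powr_powr mult_ac)
      then show ?thesis unfolding \<epsilon>_def exp_ln_theta by (simp add: powr_minus)
    qed
    also have "D powr \<tau> * (C0 powr (\<tau>2 - t) * (\<theta> powr b) ^ (2 * k)) * (C * inverse ((\<theta> powr b) ^ k)) =
        M * (\<theta> powr b) ^ k"
      using theta unfolding mult_2 power_add by (simp add: M_def field_simps)
    also have "\<dots> \<le> \<eta>" using k M by (simp add: field_simps)
    finally show ?thesis .
  qed
  with W show "\<exists>(I::'a list set) U. countable I \<and> E \<subseteq> (\<Union>i\<in>I. U i) \<and>
      (\<forall>i\<in>I. bounded (U i)) \<and> (\<forall>J\<subseteq>I. finite J \<longrightarrow> (\<Sum>i\<in>J. diameter (U i) powr \<tau>) \<le> \<eta>)"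
    by (intro exI[of _ W] exI[of _ "\<lambda>w. wm w ` K (last w)"]) (auto intro: compact_imp_bounded compact_wm)
qed

section \<open>Coding by infinite sequences\<close>

definition adm_seq :: "(nat \<Rightarrow> 'a) \<Rightarrow> bool" where
  "adm_seq \<omega> \<longleftrightarrow> (\<forall>n. (\<omega> n, \<omega> (Suc n)) \<in> T)"

abbreviation pre :: "(nat \<Rightarrow> 'b) \<Rightarrow> nat \<Rightarrow> 'b list" where
  "pre \<omega> n \<equiv> map \<omega> [0..<n]"

lemma adm_seq_in_A: "adm_seq \<omega> \<Longrightarrow> \<omega> n \<in> A"
  using T_subset by (auto simp: adm_seq_def)

lemma adm_pre: "adm_seq \<omega> \<Longrightarrow> adm (pre \<omega> n)"
proof (induction n)
  case (Suc n)
  then show ?case using adm_seq_in_A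
    by (cases n) (auto simp: adm_append adm_Cons adm_seq_def)
qed simp

lemma word_map_eq: "word_map \<phi> \<omega> n = wm (pre \<omega> n)"
  by (induction n) (auto simp: fun_eq_iff)

text \<open>The images are nonempty, compact and nested, and their diameters are at most
  \<open>s ^ Suc n * Dm\<close>. Hence exactly one point lies in all of them, and \<open>THE\<close>
  denotes it.\<close>

lemma coding_map_in:
  assumes "adm_seq \<omega>"
  shows "coding_map K \<phi> \<omega> \<in> wm (pre \<omega> (Suc n)) ` K (\<omega> n)"
proof -
  define S where "S n = wm (pre \<omega> (Suc n)) ` K (\<omega> n)" for n
  have adm: "adm (pre \<omega> (Suc n))" "pre \<omega> (Suc n) \<noteq> []" "last (pre \<omega> (Suc n)) = \<omega> n" for n
    by (rule adm_pre[OF assms]) simp_all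
  have comp: "compact (S n)" for n
    using compact_wm[OF adm(1,2)[of n]] unfolding S_def adm(3) .
  have ne: "S n \<noteq> {}" for n
    using y_in_K[OF adm_seq_in_A[OF assms]] unfolding S_def by blast
  have "S (Suc n) \<subseteq> S n" for n
  proof -
    have "\<phi> (\<omega> (Suc n)) ` K (\<omega> (Suc n)) \<subseteq> K (\<omega> n)"
      using composable assms by (auto simp: adm_seq_def)
    then have "wm (pre \<omega> (Suc n)) ` (\<phi> (\<omega> (Suc n)) ` K (\<omega> (Suc n))) \<subseteq> S n"
      unfolding S_def by (rule image_mono)
    then show ?thesis unfolding S_def by (simp add: image_comp comp_def)
  qed
  then have anti: "S m \<subseteq> S n" if "n \<le> m" for m n
    using that by (rule lift_Suc_antimono_le)
  have "\<Inter> (range S) \<noteq> {}"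
    by (rule compact_nest[OF comp ne anti])
  then obtain p where p: "p \<in> (\<Inter>n. S n)" by blast
  have "q = p" if q: "q \<in> (\<Inter>n. S n)" for q
  proof (rule ccontr)
    assume "q \<noteq> p"
    then have "0 < dist p q / Dm" using Dm(2) by simp
    then obtain n where n: "s ^ n < dist p q / Dm"
      using real_arch_pow_inv s_bounds(2) by blast
    obtain x z where "x \<in> K (\<omega> n)" "p = wm (pre \<omega> (Suc n)) x" "z \<in> K (\<omega> n)" "q = wm (pre \<omega> (Suc n)) z"
      using p q unfolding S_def by blast
    then have "dist p q \<le> s ^ Suc n * Dm"
      using wm_dist_Dm[OF adm(1,2)[of n], of x z] by (simp add: wdom_def)
    also have "\<dots> \<le> s ^ n * Dm"
      using s_bounds Dm(2) by (intro mult_right_mono power_decreasing) auto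
    finally show False using n Dm(2) by (simp add: field_simps)
  qed
  then have "{p} = (\<Inter>n. S n)" using p by blast
  then have "coding_map K \<phi> \<omega> = p"
    unfolding coding_map_def word_map_eq S_def[symmetric] by (intro the_equality) auto
  then show ?thesis using p unfolding S_def by blast
qed

end

section \<open>Patterns of free positions\<close>

text \<open>Outside \<open>E\<close> the letter is forced to be \<open>f0\<close>; a word of the pattern is read from position \<open>m\<close> on.\<close>

definition pattern_words :: "'b set \<Rightarrow> 'b \<Rightarrow> nat set \<Rightarrow> nat \<Rightarrow> nat \<Rightarrow> 'b list set" where
  "pattern_words F f0 E m n =
     {ws. set ws \<subseteq> F \<and> length ws = n \<and> (\<forall>i<n. ws ! i = f0 \<or> m + i \<in> E)}"

definition periodic :: "nat set \<Rightarrow> nat \<Rightarrow> bool" where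
  "periodic E l \<longleftrightarrow> (\<forall>i. i + l \<in> E \<longleftrightarrow> i \<in> E)"

lemma periodic_mult: "periodic E l \<Longrightarrow> i + N * l \<in> E \<longleftrightarrow> i \<in> E"
proof (induction N)
  case (Suc N)
  have "i + N * l + l \<in> E \<longleftrightarrow> i + N * l \<in> E" using Suc.prems by (simp add: periodic_def)
  then show ?case using Suc by (simp add: algebra_simps)
qed simp

lemma periodic_double: "periodic E l \<Longrightarrow> periodic E (2 * l)"
  using periodic_mult[of E l _ 2] by (simp add: periodic_def)

lemma periodic_mod: "periodic {i. i mod l = h} l"
  by (simp add: periodic_def)

lemma periodic_Un: "periodic E l \<Longrightarrow> periodic E' l \<Longrightarrow> periodic (E \<union> E') l"
  by (simp add: periodic_def)

lemma finite_pattern_words: "finite F \<Longrightarrow> finite (pattern_words F f0 E m n)"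
  by (rule finite_subset[OF _ finite_lists_length_eq[of F n]]) (auto simp: pattern_words_def)

lemma pattern_words_add:
  "pattern_words F f0 E m (n + k) = (\<lambda>(u, v). u @ v) ` (pattern_words F f0 E m n \<times> pattern_words F f0 E (m + n) k)"
proof (intro equalityI subsetI)
  fix ws assume ws: "ws \<in> pattern_words F f0 E m (n + k)"
  have "take n ws \<in> pattern_words F f0 E m n" "drop n ws \<in> pattern_words F f0 E (m + n) k"
    using ws set_take_subset[of n ws] set_drop_subset[of n ws]
    by (auto simp: pattern_words_def add.assoc)
  then show "ws \<in> (\<lambda>(u, v). u @ v) ` (pattern_words F f0 E m n \<times> pattern_words F f0 E (m + n) k)"
    by (intro image_eqI[of _ _ "(take n ws, drop n ws)"]) auto
next
  fix ws assume "ws \<in> (\<lambda>(u, v). u @ v) ` (pattern_words F f0 E m n \<times> pattern_words F f0 E (m + n) k)"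
  then obtain u v where u: "ws = u @ v" "u \<in> pattern_words F f0 E m n" "v \<in> pattern_words F f0 E (m + n) k"
    by auto
  have "ws ! i = f0 \<or> m + i \<in> E" if "i < n + k" for i
  proof (cases "i < n")
    case True
    then show ?thesis using u by (auto simp: pattern_words_def nth_append)
  next
    case False
    have ik: "m + n + (i - n) = m + i" "i - n < k" using False that by auto
    have "\<forall>j<k. v ! j = f0 \<or> m + n + j \<in> E" using u(3) by (auto simp: pattern_words_def)
    from this[rule_format, OF ik(2)] have "v ! (i - n) = f0 \<or> m + i \<in> E" unfolding ik(1) .
    then show ?thesis using u False by (auto simp: pattern_words_def nth_append)
  qed
  then show "ws \<in> pattern_words F f0 E m (n + k)" using u by (auto simp: pattern_words_def)
qed

lemma pattern_words_mono:
  assumes "\<And>i. i < n \<Longrightarrow> m + i \<in> E \<Longrightarrow> m' + i \<in> E'"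
  shows "pattern_words F f0 E m n \<subseteq> pattern_words F f0 E' m' n"
  using assms by (auto simp: pattern_words_def)

lemma pattern_words_periodic:
  assumes "periodic E l"
  shows "pattern_words F f0 E (m + N * l) n = pattern_words F f0 E m n"
proof -
  have "m + N * l + i \<in> E \<longleftrightarrow> m + i \<in> E" for i
    using periodic_mult[OF assms, of "m + i" N] by (simp add: algebra_simps)
  then show ?thesis by (simp add: pattern_words_def)
qed

text \<open>The letters stand for return words and \<open>Q\<close> for a power of the weight of
  their concatenation. The setting is instantiated at two exponents: the target \<open>t\<close>, to
  build the pattern, and a smaller one, for the lower bound.\<close>

locale quasi_multiplicative =
  fixes F :: "'b set" and f0 :: 'b and Q :: "'b list \<Rightarrow> real" and \<kappa> :: real
  assumes finite_F: "finite F" and f0_in: "f0 \<in> F" and kappa_ge: "1 \<le> \<kappa>"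
    and Q_Nil: "Q [] = 1"
    and Q_pos: "set ws \<subseteq> F \<Longrightarrow> 0 < Q ws"
    and Q_append_le: "set us \<subseteq> F \<Longrightarrow> set vs \<subseteq> F \<Longrightarrow> Q (us @ vs) \<le> \<kappa> * (Q us * Q vs)"
    and Q_append_ge: "set us \<subseteq> F \<Longrightarrow> set vs \<subseteq> F \<Longrightarrow> Q us * Q vs \<le> \<kappa> * Q (us @ vs)"
begin

abbreviation "Pw \<equiv> pattern_words F f0"

text \<open>The partition function of the window of length \<open>n\<close> starting at position
  \<open>m\<close>; its exponential growth rate plays the role of the pressure.\<close>

definition Zs :: "nat set \<Rightarrow> nat \<Rightarrow> nat \<Rightarrow> real" where
  "Zs E m n = (\<Sum>ws\<in>Pw E m n. Q ws)"

lemma Pw_Q_pos: "ws \<in> Pw E m n \<Longrightarrow> 0 < Q ws"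
  by (rule Q_pos) (simp add: pattern_words_def)

lemma Zs_add: "Zs E m (n + k) = (\<Sum>u\<in>Pw E m n. \<Sum>v\<in>Pw E (m + n) k. Q (u @ v))"
proof -
  have "inj_on (\<lambda>(u, v). u @ v) (Pw E m n \<times> Pw E (m + n) k)"
    by (auto simp: inj_on_def pattern_words_def)
  then show ?thesis
    unfolding Zs_def pattern_words_add by (simp add: sum.reindex sum.cartesian_product case_prod_unfold)
qed

lemma Zs_add_le: "Zs E m (n + k) \<le> \<kappa> * (Zs E m n * Zs E (m + n) k)"
proof -
  have "Zs E m (n + k) \<le> (\<Sum>u\<in>Pw E m n. \<Sum>v\<in>Pw E (m + n) k. \<kappa> * (Q u * Q v))"
    unfolding Zs_add by (intro sum_mono Q_append_le) (auto simp: pattern_words_def)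
  also have "\<dots> = \<kappa> * (\<Sum>u\<in>Pw E m n. \<Sum>v\<in>Pw E (m + n) k. Q u * Q v)"
    by (simp only: sum_distrib_left)
  finally show ?thesis by (simp add: Zs_def sum_product)
qed

lemma Zs_add_ge: "Zs E m n * Zs E (m + n) k \<le> \<kappa> * Zs E m (n + k)"
proof -
  have "Zs E m n * Zs E (m + n) k = (\<Sum>u\<in>Pw E m n. \<Sum>v\<in>Pw E (m + n) k. Q u * Q v)"
    by (simp add: Zs_def sum_product)
  also have "\<dots> \<le> (\<Sum>u\<in>Pw E m n. \<Sum>v\<in>Pw E (m + n) k. \<kappa> * Q (u @ v))"
    by (intro sum_mono Q_append_ge) (auto simp: pattern_words_def)
  also have "\<dots> = \<kappa> * Zs E m (n + k)" by (simp add: Zs_add sum_distrib_left)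
  finally show ?thesis .
qed

lemma Zs_mono:
  assumes "\<And>i. i < n \<Longrightarrow> m + i \<in> E \<Longrightarrow> m' + i \<in> E'"
  shows "Zs E m n \<le> Zs E' m' n"
  unfolding Zs_def
proof (rule sum_mono2)
  show "finite (Pw E' m' n)" by (rule finite_pattern_words[OF finite_F])
  show "Pw E m n \<subseteq> Pw E' m' n" using assms by (rule pattern_words_mono)
  show "0 \<le> Q ws" if "ws \<in> Pw E' m' n - Pw E m n" for ws
    using that Pw_Q_pos[of ws E' m' n] by simp
qed

lemma Zs_ge: "Q (replicate n f0) \<le> Zs E m n"
  unfolding Zs_def
proof (rule member_le_sum)
  show "replicate n f0 \<in> Pw E m n" using f0_in by (auto simp: pattern_words_def)
  show "finite (Pw E m n)" by (rule finite_pattern_words[OF finite_F])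
  show "0 \<le> Q ws" if "ws \<in> Pw E m n - {replicate n f0}" for ws
    using that Pw_Q_pos[of ws E m n] by simp
qed

lemma Q_replicate_pos: "0 < Q (replicate n f0)"
  using f0_in by (intro Q_pos) auto

lemma Zs_pos: "0 < Zs E m n"
proof -
  have "0 < Q (replicate n f0)" by (rule Q_replicate_pos)
  then show ?thesis using Zs_ge[of n E m] by linarith
qed

lemma Zs_periodic: "periodic E l \<Longrightarrow> Zs E (m + N * l) n = Zs E m n"
  by (simp add: Zs_def pattern_words_periodic)

lemma Zs_0: "Zs E m 0 = 1"
proof -
  have "Pw E m 0 = {[]}" by (auto simp: pattern_words_def)
  then show ?thesis by (simp add: Zs_def Q_Nil)
qed

text \<open>The cost of freeing one position: the sum over all letters against the single forced
  letter.\<close>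

definition B :: real where "B = Zs UNIV 0 1 / Q [f0]"

lemma B_ge: "1 \<le> B"
  using Zs_ge[of 1 UNIV 0] Q_pos[of "[f0]"] f0_in by (simp add: B_def)

lemma Zs_single: "Zs E m 1 \<le> B * Zs E' m 1"
proof -
  have "Zs E m 1 \<le> Zs UNIV 0 1" by (rule Zs_mono) simp
  also have "\<dots> = B * Q [f0]" using Q_pos[of "[f0]"] f0_in by (simp add: B_def)
  also have "\<dots> \<le> B * Zs E' m 1" using Zs_ge[of 1 E' m] B_ge by (intro mult_left_mono) auto
  finally show ?thesis .
qed

text \<open>
  Freeing one position costs only a bounded factor, so patterns that differ with small density have
  close exponential growth rates.
\<close>

lemma Zs_change_one:
  assumes "h < l" "\<And>i. i < l \<Longrightarrow> i \<noteq> h \<Longrightarrow> i \<in> E \<Longrightarrow> i \<in> E'"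
  shows "Zs E 0 l \<le> \<kappa> ^ 4 * B * Zs E' 0 l"
proof -
  \<comment> \<open>The window is cut into the parts before, at and after \<open>h\<close>. Two cuts
    for \<open>E\<close> and two gluings for \<open>E'\<close> give \<open>\<kappa> ^ 4\<close>, the
    middle part gives \<open>B\<close>.\<close>
  define k where "k = l - h - 1"
  have l: "l = h + 1 + k" using assms(1) by (simp add: k_def)
  have 1: "Zs E 0 h \<le> Zs E' 0 h" by (rule Zs_mono) (use assms in auto)
  have 2: "Zs E (h + 1) k \<le> Zs E' (h + 1) k" by (rule Zs_mono) (use assms l in auto)
  have "Zs E 0 (h + 1 + k) \<le> \<kappa> * (Zs E 0 (h + 1) * Zs E (h + 1) k)" using Zs_add_le[of E 0 "h + 1" k] by simp
  also have "\<dots> \<le> \<kappa> * (\<kappa> * (Zs E 0 h * Zs E h 1) * Zs E (h + 1) k)"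
    using Zs_add_le[of E 0 h 1] kappa_ge Zs_pos[of E "h + 1" k] by (intro mult_left_mono mult_right_mono) auto
  also have "\<dots> \<le> \<kappa> * (\<kappa> * (Zs E' 0 h * (B * Zs E' h 1)) * Zs E' (h + 1) k)"
    using 1 2 Zs_single[of E h E'] kappa_ge B_ge Zs_pos
    by (intro mult_left_mono mult_mono) (auto intro!: mult_nonneg_nonneg less_imp_le[OF Zs_pos])
  also have "\<dots> = \<kappa> ^ 2 * B * (Zs E' 0 h * Zs E' h 1 * Zs E' (h + 1) k)"
    by (simp add: power2_eq_square mult_ac)
  also have "\<dots> \<le> \<kappa> ^ 2 * B * (\<kappa> * Zs E' 0 (h + 1) * Zs E' (h + 1) k)"
    using Zs_add_ge[of E' 0 h 1] kappa_ge B_ge Zs_pos[of E' "h + 1" k]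
    by (intro mult_left_mono mult_right_mono) auto
  also have "\<dots> = \<kappa> ^ 3 * B * (Zs E' 0 (h + 1) * Zs E' (h + 1) k)"
    by (simp add: power2_eq_square power3_eq_cube mult_ac)
  also have "\<dots> \<le> \<kappa> ^ 3 * B * (\<kappa> * Zs E' 0 (h + 1 + k))"
    using Zs_add_ge[of E' 0 "h + 1" k] kappa_ge B_ge by (intro mult_left_mono) auto
  also have "\<dots> = \<kappa> ^ 4 * B * Zs E' 0 l" by (simp add: l eval_nat_numeral mult_ac)
  finally show ?thesis by (simp add: l)
qed

text \<open>The price of one period: \<open>\<kappa> ^ 4 * B\<close> for the change inside it, and
  one \<open>\<kappa>\<close> on either side for joining it to the previous periods.\<close>

definition cc :: real where "cc = \<kappa> ^ 6 * B"

lemma cc_ge: "1 \<le> cc"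
proof -
  have "1 * 1 \<le> \<kappa> ^ 6 * B" using kappa_ge B_ge by (intro mult_mono one_le_power) auto
  then show ?thesis by (simp add: cc_def)
qed

lemma Zs_blocks:
  assumes E: "periodic E l" and E': "periodic E' l" and h: "h < l"
    and sub: "\<And>i. i < l \<Longrightarrow> i \<noteq> h \<Longrightarrow> i \<in> E \<Longrightarrow> i \<in> E'"
  shows "Zs E 0 (N * l) \<le> cc ^ N * Zs E' 0 (N * l)"
proof (induction N)
  case (Suc N)
  have "Zs E 0 (Suc N * l) \<le> \<kappa> * (Zs E 0 (N * l) * Zs E 0 l)"
    using Zs_add_le[of E 0 "N * l" l] Zs_periodic[OF E, of 0 N l] by (simp add: add.commute)
  also have "\<dots> \<le> \<kappa> * ((cc ^ N * Zs E' 0 (N * l)) * (\<kappa> ^ 4 * B * Zs E' 0 l))"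
    using Suc Zs_change_one[OF h sub] kappa_ge cc_ge Zs_pos
    by (intro mult_left_mono mult_mono) (auto intro!: mult_nonneg_nonneg less_imp_le[OF Zs_pos])
  also have "\<dots> = cc ^ N * \<kappa> ^ 5 * B * (Zs E' 0 (N * l) * Zs E' 0 l)"
    by (simp add: eval_nat_numeral mult_ac)
  also have "\<dots> \<le> cc ^ N * \<kappa> ^ 5 * B * (\<kappa> * Zs E' 0 (Suc N * l))"
    using Zs_add_ge[of E' 0 "N * l" l] Zs_periodic[OF E', of 0 N l] cc_ge B_ge kappa_ge
    by (intro mult_left_mono) (auto simp: add.commute)
  also have "\<dots> = cc ^ Suc N * Zs E' 0 (Suc N * l)"
    by (simp add: cc_def eval_nat_numeral mult_ac)
  finally show ?case .
qed (simp add: Zs_0)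

text \<open>\<open>Hi\<close> and \<open>Lo\<close> express a nonnegative and a nonpositive growth
  rate without limits. Along multiples of a period, \<open>\<kappa> * Zs\<close> is
  submultiplicative and \<open>Zs / \<kappa>\<close> supermultiplicative, as in Fekete's lemma, and
  \<open>1\<close> is the threshold for both.\<close>

definition Hi :: "nat set \<Rightarrow> nat \<Rightarrow> bool" where
  "Hi E l \<longleftrightarrow> (\<forall>N. 1 \<le> \<kappa> * Zs E 0 (N * l))"

definition Lo :: "nat set \<Rightarrow> nat \<Rightarrow> bool" where
  "Lo E l \<longleftrightarrow> (\<forall>N. Zs E 0 (N * l) \<le> \<kappa>)"

lemma Hi_double: "Hi E l \<Longrightarrow> Hi E (2 * l)"
  unfolding Hi_def by (metis mult.assoc)

lemma Lo_double: "Lo E l \<Longrightarrow> Lo E (2 * l)"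
  unfolding Lo_def by (metis mult.assoc)

text \<open>
  By quasi-multiplicativity, one value above \<open>\<kappa>\<close> or below \<open>1 / \<kappa>\<close> persists along multiples, so both
  cannot occur for the same period.
\<close>

lemma Hi_or_Lo:
  assumes "periodic E l"
  shows "Hi E l \<or> Lo E l"
proof (rule ccontr)
  assume "\<not> ?thesis"
  then obtain N M where N: "\<kappa> < Zs E 0 (N * l)" and M: "\<kappa> * Zs E 0 (M * l) < 1"
    by (auto simp: Hi_def Lo_def not_le)
  define b where "b n = Zs E 0 (n * l)" for n
  have bpos: "0 < b n" for n by (simp add: b_def Zs_pos)
  have le: "b (n + m) \<le> \<kappa> * (b n * b m)" and ge: "b n * b m \<le> \<kappa> * b (n + m)" for n m
    using Zs_add_le[of E 0 "n * l" "m * l"] Zs_add_ge[of E 0 "n * l" "m * l"]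
      Zs_periodic[OF assms, of 0 n "m * l"] by (simp_all add: b_def distrib_right)
  have up: "\<kappa> \<le> b (Suc n * N)" for n
  proof (induction n)
    case 0
    then show ?case using N by (simp add: b_def)
  next
    case (Suc n)
    have "\<kappa> * \<kappa> \<le> b (Suc n * N) * b N"
      using Suc N kappa_ge by (intro mult_mono) (auto simp: b_def)
    also have "\<dots> \<le> \<kappa> * b (Suc n * N + N)" by (rule ge)
    finally show ?case using kappa_ge by (simp add: add.commute)
  qed
  have dn: "\<kappa> * b (Suc n * M) < 1" for n
  proof (induction n)
    case 0
    then show ?case using M by (simp add: b_def)
  next
    case (Suc n)
    have "\<kappa> * b (Suc n * M + M) \<le> \<kappa> * (\<kappa> * (b (Suc n * M) * b M))"
      using le[of "Suc n * M" M] kappa_ge by (intro mult_left_mono) auto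
    also have "\<dots> = (\<kappa> * b (Suc n * M)) * (\<kappa> * b M)" by (simp add: mult_ac)
    also have "\<dots> < 1 * 1"
      using Suc M kappa_ge less_imp_le[OF bpos] by (intro mult_strict_mono) (auto simp: b_def)
    finally show ?case by (simp add: add.commute)
  qed
  have "N \<noteq> 0" using N kappa_ge by (cases N) (auto simp: Zs_0)
  then obtain N' where N': "N = Suc N'" by (cases N) auto
  have "M \<noteq> 0" using M kappa_ge by (cases M) (auto simp: Zs_0)
  then obtain M' where M': "M = Suc M'" by (cases M) auto
  \<comment> \<open>Both persistence statements are evaluated at the common multiple
    \<open>N * M\<close>, where they contradict each other.\<close>
  have "\<kappa> \<le> b (N * M)" using up[of M'] by (simp add: M' mult.commute)
  moreover have "\<kappa> * b (N * M) < 1" using dn[of N'] by (simp add: N')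
  moreover have "\<kappa> * \<kappa> \<le> \<kappa> * b (N * M)" using kappa_ge calculation(1) by (intro mult_left_mono) auto
  ultimately have "\<kappa> * \<kappa> < 1" by linarith
  moreover have "1 * 1 \<le> \<kappa> * \<kappa>" using kappa_ge by (intro mult_mono) auto
  ultimately show False by simp
qed

text \<open>
  Binary bisection.  At stage \<open>j\<close> the set \<open>L\<close> and its enlargement by a single undecided residue class
  modulo \<open>2 ^ j\<close> bracket growth rate zero.  The class splits into two classes modulo \<open>2 ^ Suc j\<close>, the
  first of which is freed or forced depending on the growth rate that this produces.
\<close>

definition upper :: "nat set \<Rightarrow> nat \<Rightarrow> nat \<Rightarrow> nat set" where
  "upper L h j = L \<union> {i. i mod 2 ^ j = h}"

definition stage :: "nat \<Rightarrow> nat set \<times> nat \<Rightarrow> bool" where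
  "stage j = (\<lambda>(L, h). periodic L (2 ^ j) \<and> h < 2 ^ j \<and> Lo L (2 ^ j) \<and> Hi (upper L h j) (2 ^ j))"

lemma periodic_upper: "periodic L (2 ^ j) \<Longrightarrow> periodic (upper L h j) (2 ^ j)"
  unfolding upper_def by (intro periodic_Un periodic_mod)

lemma mod_pow_Suc: "(i::nat) mod 2 ^ Suc j = i mod 2 ^ j \<or> i mod 2 ^ Suc j = i mod 2 ^ j + 2 ^ j"
proof -
  have "i mod (2 ^ j * 2) = 2 ^ j * (i div 2 ^ j mod 2) + i mod 2 ^ j" by (rule mod_mult2_eq)
  moreover have "i div 2 ^ j mod 2 = 0 \<or> i div 2 ^ j mod 2 = 1" by linarith
  ultimately show ?thesis by (auto simp: mult.commute)
qed

lemma mod_pow_mod: "(i::nat) mod 2 ^ Suc j mod 2 ^ j = i mod 2 ^ j"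
  by (rule mod_mod_cancel) simp

text \<open>If \<open>E\<close>, which is \<open>L\<close> with the first half-class added, is low,
  it becomes the new lower set, the second half-class becomes undecided and the upper set is
  unchanged. Otherwise \<open>E\<close> is high and becomes the new upper set, while
  \<open>L\<close> stays. The inherited bound survives the doubling of the period.\<close>

lemma stage_step:
  assumes "stage j (L, h)"
  shows "\<exists>L' h'. stage (Suc j) (L', h') \<and> L \<subseteq> L' \<and> upper L' h' (Suc j) \<subseteq> upper L h j"
proof -
  have s: "periodic L (2 ^ j)" "h < 2 ^ j" "Lo L (2 ^ j)" "Hi (upper L h j) (2 ^ j)"
    using assms by (auto simp: stage_def)
  have perL: "periodic L (2 ^ Suc j)" using periodic_double[OF s(1)] by simp
  define E where "E = upper L h (Suc j)"
  have perE: "periodic E (2 ^ Suc j)" unfolding E_def by (rule periodic_upper[OF perL])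
  have hj: "h mod 2 ^ j = h" using s(2) by simp
  have sub: "E \<subseteq> upper L h j"
  proof
    fix i assume "i \<in> E"
    then show "i \<in> upper L h j" using mod_pow_mod[of i j] hj by (auto simp: E_def upper_def)
  qed
  show ?thesis
  proof (cases "Lo E (2 ^ Suc j)")
    case True
    have "upper E (h + 2 ^ j) (Suc j) = upper L h j"
    proof (intro equalityI subsetI)
      fix i assume "i \<in> upper E (h + 2 ^ j) (Suc j)"
      then have "i \<in> E \<or> i mod 2 ^ Suc j = h + 2 ^ j" by (auto simp: upper_def)
      then show "i \<in> upper L h j"
      proof
        assume "i mod 2 ^ Suc j = h + 2 ^ j"
        then have "i mod 2 ^ j = h" using mod_pow_mod[of i j] hj by simp
        then show ?thesis by (simp add: upper_def)
      qed (use sub in blast)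
    next
      fix i assume "i \<in> upper L h j"
      then show "i \<in> upper E (h + 2 ^ j) (Suc j)"
        using mod_pow_Suc[of i j] by (auto simp: upper_def E_def)
    qed
    then have "stage (Suc j) (E, h + 2 ^ j)" "upper E (h + 2 ^ j) (Suc j) \<subseteq> upper L h j"
      using perE s(2) True Hi_double[OF s(4)] by (simp_all add: stage_def)
    moreover have "L \<subseteq> E" by (auto simp: E_def upper_def)
    ultimately show ?thesis by blast
  next
    case False
    then have "Hi E (2 ^ Suc j)" using Hi_or_Lo[OF perE] by blast
    then have "stage (Suc j) (L, h)"
      using perL s(2) Lo_double[OF s(3)] by (simp add: stage_def E_def)
    then show ?thesis using sub by (auto simp: E_def)
  qed
qed

text \<open>These constants pay for incomplete periods when a window in arbitrary position is
  rounded to whole periods. They are uniform in the pattern because the forced word and the free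
  pattern are the extreme cases.\<close>

lemma Zs_short_bounds:
  obtains \<beta> \<Gamma> where "0 < \<beta>" "0 < \<Gamma>" "\<And>E m n. n \<le> l \<Longrightarrow> \<beta> \<le> Zs E m n" "\<And>E m n. n \<le> l \<Longrightarrow> Zs E m n \<le> \<Gamma>"
proof -
  define \<beta> where "\<beta> = Min ((\<lambda>n. Q (replicate n f0)) ` {..l})"
  define \<Gamma> where "\<Gamma> = Max ((\<lambda>n. Zs UNIV 0 n) ` {..l})"
  have "\<beta> \<in> (\<lambda>n. Q (replicate n f0)) ` {..l}" unfolding \<beta>_def by (rule Min_in) auto
  then have 1: "0 < \<beta>" using Q_replicate_pos by auto
  have 2: "\<beta> \<le> Zs E m n" if "n \<le> l" for E m n
  proof -
    have "\<beta> \<le> Q (replicate n f0)" unfolding \<beta>_def by (rule Min_le) (use that in auto)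
    then show ?thesis using Zs_ge[of n E m] by linarith
  qed
  have 3: "Zs E m n \<le> \<Gamma>" if "n \<le> l" for E m n
  proof -
    have "Zs E m n \<le> Zs UNIV 0 n" by (rule Zs_mono) simp
    also have "\<dots> \<le> \<Gamma>" unfolding \<Gamma>_def by (rule Max_ge) (use that in auto)
    finally show ?thesis .
  qed
  have "0 < \<Gamma>" using 3[of 0 UNIV 0] by (simp add: Zs_0)
  then show thesis using that 1 2 3 by blast
qed

text \<open>The two patterns differ in one residue class, hence by a factor \<open>cc\<close> per
  period \<open>2 ^ j\<close>, which is at most \<open>exp (\<epsilon> * 2 ^ j)\<close>. So
  \<open>Lo\<close> of the lower pattern bounds the upper one from above, and \<open>Hi\<close> of
  the upper pattern bounds the lower one from below.\<close>

lemma stage_bounds: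
  assumes st: "stage j (L, h)" and \<epsilon>: "0 < \<epsilon>" "ln cc \<le> \<epsilon> * 2 ^ j"
  shows "\<exists>C>0. (\<forall>m n. Zs (upper L h j) m n \<le> C * exp (\<epsilon> * real n)) \<and> (\<forall>n. 1 \<le> C * exp (\<epsilon> * real n) * Zs L 0 n)"
proof -
  define l :: nat where "l = 2 ^ j"
  define U where "U = upper L h j"
  have s: "periodic L l" "h < l" "Lo L l" "Hi U l"
    using st by (auto simp: stage_def l_def U_def)
  have perU: "periodic U l" using s(1) unfolding l_def U_def by (rule periodic_upper)
  have l: "0 < l" by (simp add: l_def)
  obtain \<beta> \<Gamma> where bd: "0 < \<beta>" "0 < \<Gamma>" "\<And>E m n. n \<le> l \<Longrightarrow> \<beta> \<le> Zs E m n" "\<And>E m n. n \<le> l \<Longrightarrow> Zs E m n \<le> \<Gamma>"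
    using Zs_short_bounds[of l] by metis
  have blk: "Zs U 0 (N * l) \<le> cc ^ N * Zs L 0 (N * l)" for N
  proof (rule Zs_blocks[OF perU s(1,2)])
    fix i assume "i < l" "i \<noteq> h" "i \<in> U"
    then show "i \<in> L" by (simp add: U_def upper_def l_def)
  qed
  have ccN: "cc ^ N \<le> cc ^ 2 * exp (\<epsilon> * n)" if "N * l \<le> n + 2 * l" for N n
  proof -
    have "real (N * l) \<le> real (n + 2 * l)" using that by (simp only: of_nat_le_iff)
    then have "real N \<le> real n / real l + 2" using l by (simp add: field_simps)
    then have "real N * ln cc \<le> (real n / real l + 2) * ln cc" using cc_ge by (intro mult_right_mono) auto
    also have "\<dots> = real n * (ln cc / real l) + 2 * ln cc" by (simp add: algebra_simps)
    also have "\<dots> \<le> real n * \<epsilon> + 2 * ln cc"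
      using \<epsilon> l by (intro add_right_mono mult_left_mono) (auto simp: field_simps l_def)
    finally have "exp (real N * ln cc) \<le> exp (2 * ln cc + \<epsilon> * n)" by (simp add: algebra_simps)
    moreover have "exp (real N * ln cc) = cc ^ N" "exp (2 * ln cc) = cc ^ 2"
      using cc_ge exp_of_nat_mult[of N "ln cc"] exp_of_nat_mult[of 2 "ln cc"] by auto
    ultimately show ?thesis by (simp add: exp_add)
  qed
  \<comment> \<open>The window from \<open>a\<close> to \<open>a + n\<close> is extended left to
    \<open>0\<close> and right to a multiple of \<open>l\<close>, which adds at most two periods;
    hence the factor \<open>cc ^ 2\<close> below.\<close>
  have round: "\<exists>N q. a + n + q = N * l \<and> q \<le> l \<and> N * l \<le> n + 2 * l" if "a < l" for a n
  proof (intro exI conjI)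
    let ?N = "(a + n) div l + 1"
    have eq: "?N * l = (a + n) div l * l + l" by simp
    have dm: "(a + n) div l * l + (a + n) mod l = a + n" by (rule div_mult_mod_eq)
    have md: "(a + n) mod l < l" using l by simp
    show "a + n + (l - (a + n) mod l) = ?N * l" using eq dm md by linarith
    show "l - (a + n) mod l \<le> l" by simp
    show "?N * l \<le> n + 2 * l" using eq dm that by linarith
  qed
  \<comment> \<open>In \<open>C1\<close>, two factors \<open>\<kappa>\<close> come from gluing on
    the two short pieces, each of sum at least \<open>\<beta>\<close>, and the third from
    \<open>Lo\<close>. In \<open>C2\<close>, one factor comes from \<open>Hi\<close> and one from
    cutting off the tail, whose sum is at most \<open>\<Gamma>\<close>.\<close>
  define C1 where "C1 = \<kappa> ^ 3 / \<beta> ^ 2 * cc ^ 2"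
  define C2 where "C2 = \<kappa> ^ 2 * \<Gamma> * cc ^ 2"
  have C: "0 < C1" "0 < C2" using kappa_ge bd cc_ge by (auto simp: C1_def C2_def intro!: mult_pos_pos divide_pos_pos)
  have up: "Zs U m n \<le> C1 * exp (\<epsilon> * n)" for m n
  proof -
    define a where "a = m mod l"
    have a: "a < l" using l by (simp add: a_def)
    obtain N q where N: "a + n + q = N * l" "q \<le> l" "N * l \<le> n + 2 * l" using round[OF a] by blast
    have "Zs U m n = Zs U a n" using Zs_periodic[OF perU, of a "m div l" n] by (simp add: a_def)
    have "\<beta> * Zs U a n * \<beta> \<le> Zs U 0 a * Zs U a n * Zs U (a + n) q"
      using bd a N(2) less_imp_le[OF Zs_pos] by (intro mult_mono mult_nonneg_nonneg) auto
    also have "\<dots> \<le> \<kappa> * Zs U 0 (a + n) * Zs U (a + n) q"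
      using Zs_add_ge[of U 0 a n] less_imp_le[OF Zs_pos] by (intro mult_right_mono) auto
    also have "\<dots> = \<kappa> * (Zs U 0 (a + n) * Zs U (a + n) q)" by simp
    also have "\<dots> \<le> \<kappa> * (\<kappa> * Zs U 0 (N * l))"
      using Zs_add_ge[of U 0 "a + n" q] kappa_ge N(1) by (intro mult_left_mono) auto
    also have "\<dots> \<le> \<kappa> * (\<kappa> * (cc ^ N * \<kappa>))"
    proof -
      have "cc ^ N * Zs L 0 (N * l) \<le> cc ^ N * \<kappa>"
        using s(3) cc_ge by (intro mult_left_mono) (auto simp: Lo_def)
      then have "Zs U 0 (N * l) \<le> cc ^ N * \<kappa>" using blk[of N] by linarith
      then show ?thesis using kappa_ge by (intro mult_left_mono) auto
    qed
    also have "\<dots> \<le> \<kappa> * (\<kappa> * ((cc ^ 2 * exp (\<epsilon> * n)) * \<kappa>))"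
      using ccN[OF N(3)] kappa_ge by (intro mult_left_mono mult_right_mono) auto
    finally have "Zs U a n * \<beta> ^ 2 \<le> \<kappa> ^ 3 * cc ^ 2 * exp (\<epsilon> * n)"
      by (simp add: power2_eq_square power3_eq_cube mult_ac)
    then have "Zs U a n \<le> C1 * exp (\<epsilon> * n)" using bd(1) by (simp add: C1_def field_simps)
    then show ?thesis using \<open>Zs U m n = Zs U a n\<close> by simp
  qed
  have lo: "1 \<le> C2 * exp (\<epsilon> * n) * Zs L 0 n" for n
  proof -
    obtain N q where N: "0 + n + q = N * l" "q \<le> l" "N * l \<le> n + 2 * l" using round[OF l] by blast
    have "1 \<le> \<kappa> * Zs U 0 (N * l)" using s(4) by (simp add: Hi_def)
    also have "\<dots> \<le> \<kappa> * (cc ^ N * Zs L 0 (N * l))" using blk kappa_ge by (intro mult_left_mono) auto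
    also have "\<dots> \<le> \<kappa> * ((cc ^ 2 * exp (\<epsilon> * n)) * (\<kappa> * (Zs L 0 n * \<Gamma>)))"
    proof -
      have "Zs L 0 (N * l) \<le> \<kappa> * (Zs L 0 n * Zs L n q)" using Zs_add_le[of L 0 n q] N(1) by simp
      also have "\<dots> \<le> \<kappa> * (Zs L 0 n * \<Gamma>)"
        using bd(4)[OF N(2)] kappa_ge less_imp_le[OF Zs_pos] by (intro mult_left_mono) auto
      finally show ?thesis
        using ccN[OF N(3)] kappa_ge cc_ge less_imp_le[OF Zs_pos] bd(2)
        by (intro mult_left_mono mult_mono) auto
    qed
    also have "\<dots> = C2 * exp (\<epsilon> * n) * Zs L 0 n" by (simp add: C2_def power2_eq_square mult_ac)
    finally show ?thesis .
  qed
  show ?thesis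
  proof (intro exI[of _ "max C1 C2"] conjI allI)
    show "0 < max C1 C2" using C by simp
    fix m n
    have "C1 * exp (\<epsilon> * real n) \<le> max C1 C2 * exp (\<epsilon> * real n)" by (intro mult_right_mono) auto
    then show "Zs (upper L h j) m n \<le> max C1 C2 * exp (\<epsilon> * real n)" using up[of m n] unfolding U_def by linarith
    have "C2 * exp (\<epsilon> * real n) * Zs L 0 n \<le> max C1 C2 * exp (\<epsilon> * real n) * Zs L 0 n"
      using less_imp_le[OF Zs_pos] by (intro mult_right_mono) auto
    then show "1 \<le> max C1 C2 * exp (\<epsilon> * real n) * Zs L 0 n" using lo[of n] by linarith
  qed
qed

text \<open>The bisection starts from the empty and the full pattern. The hypothesis
  \<open>small\<close> violates \<open>Hi\<close> for the empty one, which is therefore low;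
  \<open>big\<close> makes every free position multiply the sum enough to beat
  \<open>\<kappa>\<close>.\<close>

lemma balanced_pattern:
  assumes big: "\<kappa> \<le> (\<Sum>f\<in>F. Q [f])" and small: "\<kappa> * Q (replicate n0 f0) < 1"
  shows "\<exists>P. \<forall>\<epsilon>::real. 0 < \<epsilon> \<longrightarrow> (\<exists>C>0. \<exists>U l. 0 < l \<and> P \<subseteq> U \<and> periodic U l \<and>
    (\<forall>m n. Zs U m n \<le> C * exp (\<epsilon> * real n)) \<and> (\<forall>n. 1 \<le> C * exp (\<epsilon> * real n) * Zs P 0 n))"
proof -
  have "Lo {} 1"
  proof -
    have "Pw {} 0 n0 = {replicate n0 f0}"
      using f0_in by (auto simp: pattern_words_def intro!: nth_equalityI)
    then have "\<kappa> * Zs {} 0 (n0 * 1) < 1" using small by (simp add: Zs_def)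
    then have "\<not> Hi {} 1" unfolding Hi_def by (meson not_le)
    moreover have "periodic {} 1" by (simp add: periodic_def)
    ultimately show ?thesis using Hi_or_Lo by blast
  qed
  moreover have "Hi UNIV 1"
  proof -
    have "Pw UNIV m 1 = (\<lambda>f. [f]) ` F" for m
      by (auto simp: pattern_words_def length_Suc_conv)
    then have Z1: "\<kappa> \<le> Zs UNIV m 1" for m
      using big by (simp add: Zs_def sum.reindex inj_on_def)
    have "1 \<le> Zs UNIV 0 N" for N
    proof (induction N)
      case (Suc N)
      have "\<kappa> * 1 \<le> Zs UNIV N 1 * Zs UNIV 0 N"
        using Suc Z1[of N] kappa_ge by (intro mult_mono) auto
      also have "\<dots> \<le> \<kappa> * Zs UNIV 0 (Suc N)" using Zs_add_ge[of UNIV 0 N 1] by (simp add: mult.commute)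
      finally show ?case using kappa_ge by simp
    qed (simp add: Zs_0)
    then have "1 * 1 \<le> \<kappa> * Zs UNIV 0 N" for N using kappa_ge by (intro mult_mono) auto
    then show ?thesis by (simp add: Hi_def)
  qed
  moreover have "upper {} 0 0 = UNIV" by (simp add: upper_def)
  ultimately have st0: "stage 0 ({}, 0)" by (simp add: stage_def periodic_def)
  have "\<exists>f. \<forall>j. stage j (f j) \<and> (fst (f j) \<subseteq> fst (f (Suc j)) \<and>
      upper (fst (f (Suc j))) (snd (f (Suc j))) (Suc j) \<subseteq> upper (fst (f j)) (snd (f j)) j)"
  proof (rule dependent_nat_choice)
    show "\<exists>x. stage 0 x" using st0 by blast
    fix x j assume "stage j x"
    then show "\<exists>y. stage (Suc j) y \<and> (fst x \<subseteq> fst y \<and> upper (fst y) (snd y) (Suc j) \<subseteq> upper (fst x) (snd x) j)"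
      using stage_step[of j "fst x" "snd x"] by (metis fst_conv snd_conv prod.collapse)
  qed
  then obtain f where f: "\<And>j. stage j (f j)" "\<And>j. fst (f j) \<subseteq> fst (f (Suc j))"
    "\<And>j. upper (fst (f (Suc j))) (snd (f (Suc j))) (Suc j) \<subseteq> upper (fst (f j)) (snd (f j)) j" by blast
  define L where "L j = fst (f j)" for j
  define U where "U j = upper (fst (f j)) (snd (f j)) j" for j
  \<comment> \<open>Any set between all lower and all upper sets would serve; the intersection of
    the upper ones is such a set, since every \<open>L j\<close> lies below every
    \<open>U k\<close>.\<close>
  define P where "P = (\<Inter>j. U j)"
  have L_mono: "L j \<subseteq> L k" if "j \<le> k" for j k
    using f(2) that unfolding L_def by (rule lift_Suc_mono_le)
  have U_anti: "U k \<subseteq> U j" if "j \<le> k" for j k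
    using f(3) that unfolding U_def by (rule lift_Suc_antimono_le[where f = "\<lambda>j. upper (fst (f j)) (snd (f j)) j"])
  have LU: "L j \<subseteq> U j" for j by (auto simp: L_def U_def upper_def)
  have LP: "L j \<subseteq> P" for j
  proof -
    have "L j \<subseteq> U k" for k
      using L_mono[of j "max j k"] LU[of "max j k"] U_anti[of k "max j k"] by simp
    then show ?thesis by (auto simp: P_def)
  qed
  show ?thesis
  proof (intro exI[of _ P] allI impI)
    fix \<epsilon> :: real assume \<epsilon>: "0 < \<epsilon>"
    obtain j where "ln cc / \<epsilon> < 2 ^ j" using real_arch_pow[of 2 "ln cc / \<epsilon>"] by auto
    then have j: "ln cc \<le> \<epsilon> * 2 ^ j" using \<epsilon> by (simp add: field_simps)
    have st: "stage j (L j, snd (f j))" using f(1)[of j] by (simp add: L_def)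
    obtain C where C: "0 < C" "\<forall>m n. Zs (U j) m n \<le> C * exp (\<epsilon> * real n)"
      "\<forall>n. 1 \<le> C * exp (\<epsilon> * real n) * Zs (L j) 0 n"
      using stage_bounds[OF st \<epsilon> j] by (auto simp: U_def L_def)
    have "1 \<le> C * exp (\<epsilon> * real n) * Zs P 0 n" for n
    proof -
      have "Zs (L j) 0 n \<le> Zs P 0 n" by (rule Zs_mono) (use LP in auto)
      then have "C * exp (\<epsilon> * real n) * Zs (L j) 0 n \<le> C * exp (\<epsilon> * real n) * Zs P 0 n"
        using C(1) by (intro mult_left_mono) auto
      then show ?thesis using C(3)[rule_format, of n] by linarith
    qed
    moreover have "periodic (U j) (2 ^ j)"
      using st periodic_upper unfolding U_def L_def[symmetric] by (auto simp: stage_def)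
    moreover have "P \<subseteq> U j" by (auto simp: P_def)
    ultimately show "\<exists>C>0. \<exists>U l. 0 < l \<and> P \<subseteq> U \<and> periodic U l \<and>
      (\<forall>m n. Zs U m n \<le> C * exp (\<epsilon> * real n)) \<and> (\<forall>n. 1 \<le> C * exp (\<epsilon> * real n) * Zs P 0 n)"
      using C(1,2) by (intro exI[of _ C] conjI exI[of _ "U j"] exI[of _ "2 ^ j"]) auto
  qed
qed

end

section \<open>Covers of trees of words\<close>

lemma sum_le_sum_UN:
  fixes f :: "'c \<Rightarrow> real"
  assumes "finite I" "\<And>i. i \<in> I \<Longrightarrow> finite (S i)" "G \<subseteq> (\<Union>i\<in>I. S i)"
    and nonneg: "\<And>i x. i \<in> I \<Longrightarrow> x \<in> S i \<Longrightarrow> 0 \<le> f x"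
  shows "sum f G \<le> (\<Sum>i\<in>I. sum f (S i))"
proof -
  have fin: "finite (Sigma I S)" using assms(1,2) by (rule finite_SigmaI)
  have "sum f G \<le> sum f (snd ` Sigma I S)"
  proof (rule sum_mono2)
    show "G \<subseteq> snd ` Sigma I S" using assms(3) by force
    show "0 \<le> f x" if "x \<in> snd ` Sigma I S - G" for x using that nonneg by auto
  qed (use fin in simp)
  also have "\<dots> \<le> sum (f \<circ> snd) (Sigma I S)"
    by (rule sum_image_le[OF fin]) (use nonneg in auto)
  also have "\<dots> = (\<Sum>i\<in>I. sum f (S i))"
    using sum.Sigma[OF assms(1), of S "\<lambda>i x. f x"] assms(2) by (simp add: case_prod_unfold comp_def)
  finally show ?thesis .
qed

lemma list_compare:
  obtains w where "v = u @ w" | w where "u = v @ w"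
  | p e f u' v' where "u = p @ e # u'" "v = p @ f # v'" "e \<noteq> f"
proof -
  have "(\<exists>w. v = u @ w) \<or> (\<exists>w. u = v @ w) \<or> (\<exists>p e f u' v'. u = p @ e # u' \<and> v = p @ f # v' \<and> e \<noteq> f)"
  proof (induction u arbitrary: v)
    case (Cons e u)
    show ?case
    proof (cases v)
      case (Cons f v')
      show ?thesis
      proof (cases "e = f")
        case True
        from Cons.IH[of v'] show ?thesis unfolding \<open>v = f # v'\<close> True by (metis append_Cons)
      next
        case False
        then show ?thesis unfolding \<open>v = f # v'\<close> by (metis append_Nil)
      qed
    qed simp
  qed simp
  then show thesis using that by blast
qed

text \<open>A factor of a concatenation may begin inside a block; \<open>u2\<close> is the part of
  that block that it sees.\<close>

lemma concat_factor:
  assumes "concat ws = p @ l" "l \<noteq> []"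
  shows "\<exists>ws1 u1 u2 ws2. ws = ws1 @ (u1 @ u2) # ws2 \<and> l = u2 @ concat ws2"
  using assms
proof (induction ws arbitrary: p)
  case (Cons u ws)
  from Cons.prems(1) have "u @ concat ws = p @ l" by simp
  then consider p' where "p = u @ p'" "concat ws = p' @ l" | u2 where "u = p @ u2" "l = u2 @ concat ws"
    by (auto simp: append_eq_append_conv2)
  then show ?case
  proof cases
    case 1
    from Cons.IH[OF 1(2) Cons.prems(2)] obtain ws1 u1 u2 ws2 where
      "ws = ws1 @ (u1 @ u2) # ws2" "l = u2 @ concat ws2" by blast
    then have "u # ws = (u # ws1) @ (u1 @ u2) # ws2 \<and> l = u2 @ concat ws2" by simp
    then show ?thesis by blast
  next
    case 2
    then have "u # ws = [] @ (p @ u2) # ws \<and> l = u2 @ concat ws" by simp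
    then show ?thesis by blast
  qed
qed simp

lemma take_pattern_words:
  "ws \<in> pattern_words F f0 E m N \<Longrightarrow> n \<le> N \<Longrightarrow> take n ws \<in> pattern_words F f0 E m n"
  using set_take_subset[of n ws] by (auto simp: pattern_words_def)

text \<open>Koenig's lemma, in place of compactness of the sequence space: if arbitrarily long words
  avoided \<open>G\<close>, then, \<open>F\<close> being finite, words with arbitrarily long
  avoiding extensions could be prolonged forever, and the limit would be a sequence without a prefix
  in \<open>G\<close>.\<close>

lemma pattern_words_bar:
  assumes fin: "finite F"
    and bar: "\<And>x. (\<And>i. x i \<in> F) \<Longrightarrow> (\<And>i. x i = f0 \<or> i \<in> E) \<Longrightarrow> \<exists>n. map x [0..<n] \<in> G"
  shows "\<exists>N. \<forall>ws\<in>pattern_words F f0 E 0 N. \<exists>n\<le>N. take n ws \<in> G"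
proof (rule ccontr)
  assume contra: "\<not> ?thesis"
  define ok where "ok N ws \<longleftrightarrow> ws \<in> pattern_words F f0 E 0 N \<and> (\<forall>n\<le>N. take n ws \<notin> G)" for N ws
  have ex_ok: "\<exists>ws. ok N ws" for N using contra by (auto simp: ok_def)
  have ok_take: "ok n (take n ws)" if "ok N ws" "n \<le> N" for n N ws
    using that by (auto simp: ok_def take_pattern_words min_def)
  define bad where "bad u \<longleftrightarrow> (\<forall>N\<ge>length u. \<exists>ws. ok N ws \<and> take (length u) ws = u)" for u
  have bad_Nil: "bad []" using ex_ok by (simp add: bad_def)
  have step: "\<exists>f. bad (u @ [f])" if u: "bad u" for u
  proof -
    define W where "W N = (SOME ws. ok N ws \<and> take (length u) ws = u)" for N
    have W: "ok N (W N)" "take (length u) (W N) = u" if "length u \<le> N" for N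
      using someI_ex[of "\<lambda>ws. ok N ws \<and> take (length u) ws = u"] u that
      unfolding W_def[symmetric] bad_def by simp_all
    define I where "I = {Suc (length u)..}"
    have "(\<lambda>N. W N ! length u) ` I \<subseteq> F"
    proof
      fix f assume "f \<in> (\<lambda>N. W N ! length u) ` I"
      then obtain N where N: "Suc (length u) \<le> N" "f = W N ! length u" by (auto simp: I_def)
      have "ok N (W N)" using W(1)[of N] N by simp
      then have "set (W N) \<subseteq> F" "length (W N) = N" by (auto simp: ok_def pattern_words_def)
      then show "f \<in> F" using N nth_mem[of "length u" "W N"] by auto
    qed
    then have "finite ((\<lambda>N. W N ! length u) ` I)" using fin finite_subset by blast
    moreover have "infinite I" unfolding I_def by (rule infinite_Ici)
    ultimately obtain N0 where "N0 \<in> I" and inf: "infinite {N \<in> I. W N ! length u = W N0 ! length u}"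
      using pigeonhole_infinite[of I "\<lambda>N. W N ! length u"] by auto
    define f where "f = W N0 ! length u"
    have "bad (u @ [f])"
      unfolding bad_def
    proof (intro allI impI)
      fix N assume N: "length (u @ [f]) \<le> N"
      obtain N' where N': "N \<le> N'" "N' \<in> I" "W N' ! length u = f"
        using inf unfolding infinite_nat_iff_unbounded_le f_def by auto
      have len: "length u \<le> N'" "length u < N'" using N' by (auto simp: I_def)
      have okN: "ok N' (W N')" and tk: "take (length u) (W N') = u" using W[OF len(1)] by auto
      have "length (W N') = N'" using okN by (simp add: ok_def pattern_words_def)
      then have "take (length (u @ [f])) (W N') = u @ [f]"
        using tk N'(3) len(2) by (simp add: take_Suc_conv_app_nth)
      moreover have "take (length (u @ [f])) (take N (W N')) = take (length (u @ [f])) (W N')"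
        using N by (simp add: min_def)
      ultimately show "\<exists>ws. ok N ws \<and> take (length (u @ [f])) ws = u @ [f]"
        using ok_take[OF okN N'(1)] by metis
    qed
    then show ?thesis by blast
  qed
  have "\<exists>f. \<forall>n. (bad (f n) \<and> length (f n) = n) \<and> (\<exists>z. f (Suc n) = f n @ [z])"
  proof (rule dependent_nat_choice)
    show "\<exists>u. bad u \<and> length u = 0" using bad_Nil by simp
    show "\<exists>v. (bad v \<and> length v = Suc n) \<and> (\<exists>z. v = u @ [z])" if "bad u \<and> length u = n" for u n
      using step[of u] that by auto
  qed
  then obtain U where U: "\<And>n. bad (U n)" "\<And>n. length (U n) = n" "\<And>n. \<exists>z. U (Suc n) = U n @ [z]" by blast
  define x where "x n = last (U (Suc n))" for n
  have UX: "U n = map x [0..<n]" for n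
  proof (induction n)
    case 0
    then show ?case using U(2)[of 0] by simp
  next
    case (Suc n)
    then show ?case using U(3)[of n] by (auto simp: x_def)
  qed
  have okU: "ok n (U n)" for n
  proof -
    obtain ws where ws: "ok n ws" "take n ws = U n" using U(1)[of n] U(2)[of n] by (auto simp: bad_def)
    then show ?thesis by (auto simp: ok_def pattern_words_def)
  qed
  have "x i \<in> F \<and> (x i = f0 \<or> i \<in> E)" for i
  proof -
    have "U (Suc i) \<in> pattern_words F f0 E 0 (Suc i)" using okU by (simp add: ok_def)
    moreover have "U (Suc i) ! i = x i" unfolding UX by (simp del: upt_Suc)
    moreover have "x i \<in> set (U (Suc i))" unfolding UX by simp
    ultimately show ?thesis unfolding pattern_words_def by auto
  qed
  then obtain n where "U n \<in> G" using bar[of x] unfolding UX by blast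
  moreover have "take n (U n) = U n" using U(2)[of n] by simp
  ultimately show False using okU[of n] by (auto simp: ok_def)
qed

context quasi_multiplicative
begin

text \<open>A finite form of the mass distribution principle. The words of length \<open>N\<close>
  extending \<open>u\<close> have total weight at most \<open>\<kappa> * Q u\<close> times the sum
  of the remaining window, and that sum is at most \<open>\<kappa> * Zs E 0 N / c\<close>. Summing
  over \<open>G\<close> must recover all of \<open>Zs E 0 N\<close>.\<close>

lemma pattern_words_cover_bound:
  assumes G: "finite G" "\<And>u. u \<in> G \<Longrightarrow> length u \<le> N \<and> u \<in> Pw E 0 (length u)"
    and cov: "\<And>ws. ws \<in> Pw E 0 N \<Longrightarrow> \<exists>n\<le>N. take n ws \<in> G"
    and c: "0 < c" "\<And>n. c \<le> Zs E 0 n"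
  shows "c \<le> \<kappa> ^ 2 * (\<Sum>u\<in>G. Q u)"
proof -
  define S where "S u = (\<lambda>v. u @ v) ` Pw E (length u) (N - length u)" for u
  have "Pw E 0 N \<subseteq> (\<Union>u\<in>G. S u)"
  proof
    fix ws assume ws: "ws \<in> Pw E 0 N"
    then obtain n where n: "n \<le> N" "take n ws \<in> G" using cov by blast
    have "length (take n ws) = n" using n ws by (auto simp: pattern_words_def)
    moreover have "ws \<in> Pw E 0 (n + (N - n))" using ws n by simp
    then obtain u v where "ws = u @ v" "u \<in> Pw E 0 n" "v \<in> Pw E n (N - n)"
      unfolding pattern_words_add by auto
    then have "take n ws = u" "drop n ws \<in> Pw E n (N - n)" by (auto simp: pattern_words_def)
    ultimately have "ws \<in> S (take n ws)"
      unfolding S_def using append_take_drop_id[of n ws]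
      by (intro image_eqI[of _ _ "drop n ws"]) (simp_all del: append_take_drop_id)
    then show "ws \<in> (\<Union>u\<in>G. S u)" using n by blast
  qed
  then have "Zs E 0 N \<le> (\<Sum>u\<in>G. sum Q (S u))"
    unfolding Zs_def
  proof (intro sum_le_sum_UN[OF G(1)])
    show "finite (S u)" for u unfolding S_def by (intro finite_imageI finite_pattern_words finite_F)
    show "0 \<le> Q x" if "u \<in> G" "x \<in> S u" for u x
    proof -
      have "set x \<subseteq> F" using that G(2)[OF that(1)] by (auto simp: S_def pattern_words_def)
      then show ?thesis using Q_pos by (simp add: less_imp_le)
    qed
  qed
  also have "\<dots> \<le> (\<Sum>u\<in>G. \<kappa> ^ 2 * Zs E 0 N / c * Q u)"
  proof (rule sum_mono)
    fix u assume u: "u \<in> G"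
    let ?n = "length u"
    have uF: "set u \<subseteq> F" using G(2)[OF u] by (auto simp: pattern_words_def)
    have Qu: "0 < Q u" by (rule Q_pos[OF uF])
    have "sum Q (S u) = (\<Sum>v\<in>Pw E ?n (N - ?n). Q (u @ v))"
      unfolding S_def by (simp add: sum.reindex inj_on_def)
    also have "\<dots> \<le> (\<Sum>v\<in>Pw E ?n (N - ?n). \<kappa> * (Q u * Q v))"
      by (intro sum_mono Q_append_le uF) (auto simp: pattern_words_def)
    also have "\<dots> = \<kappa> * Q u * Zs E ?n (N - ?n)" by (simp add: Zs_def sum_distrib_left mult_ac)
    also have "\<dots> \<le> \<kappa> * Q u * (\<kappa> * Zs E 0 N / c)"
    proof (rule mult_left_mono)
      have "c * Zs E ?n (N - ?n) \<le> Zs E 0 ?n * Zs E ?n (N - ?n)"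
        using c(2) less_imp_le[OF Zs_pos] by (intro mult_right_mono) auto
      also have "\<dots> \<le> \<kappa> * Zs E 0 N" using Zs_add_ge[of E 0 ?n "N - ?n"] G(2)[OF u] by simp
      finally show "Zs E ?n (N - ?n) \<le> \<kappa> * Zs E 0 N / c" using c(1) by (simp add: field_simps)
    qed (use kappa_ge Qu in auto)
    also have "\<dots> = \<kappa> ^ 2 * Zs E 0 N / c * Q u" by (simp add: power2_eq_square mult_ac)
    finally show "sum Q (S u) \<le> \<kappa> ^ 2 * Zs E 0 N / c * Q u" .
  qed
  also have "\<dots> = \<kappa> ^ 2 * Zs E 0 N / c * (\<Sum>u\<in>G. Q u)" by (simp add: sum_distrib_left)
  finally have "Zs E 0 N * c \<le> Zs E 0 N * (\<kappa> ^ 2 * (\<Sum>u\<in>G. Q u))"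
    using c(1) by (simp add: field_simps)
  then show ?thesis using Zs_pos[of E 0 N] by simp
qed

end

section \<open>Return words\<close>

context metric_gdms
begin

text \<open>The letter \<open>a\<close> in front is not part of the word: a return word follows an
  \<open>a\<close> and ends in \<open>a\<close>, so concatenations stay admissible. The number of
  visits is prescribed, not the length.\<close>

definition returns :: "'a \<Rightarrow> nat \<Rightarrow> 'a list set" where
  "returns a m = {u. adm u \<and> u \<noteq> [] \<and> last u = a \<and> (a, hd u) \<in> T \<and> count_list u a = m}"

lemma return_prefix:
  assumes "adm_seq \<omega>" "pre \<omega> p = v" "v \<noteq> []" "last v = a" and io: "\<And>n. \<exists>i\<ge>n. \<omega> i = a"
  obtains n u where "pre \<omega> (Suc n) = v @ u" "u \<in> returns a (Suc k)" "\<omega> n = a"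
proof -
  define cnt where "cnt n = count_list (map \<omega> [p..<n]) a" for n
  have cnt_mono: "cnt n \<le> cnt i" if "n \<le> i" "p \<le> n" for n i
  proof -
    have "[p..<i] = [p..<n] @ [n..<i]" using that by (metis le_Suc_ex upt_add_eq_append)
    then show ?thesis by (simp add: cnt_def)
  qed
  have cnt_Suc: "cnt (Suc n) = cnt n + (if \<omega> n = a then 1 else 0)" if "p \<le> n" for n
    using that by (simp add: cnt_def)
  have big: "\<exists>n\<ge>p. j \<le> cnt n" for j
  proof (induction j)
    case (Suc j)
    then obtain n where n: "p \<le> n" "j \<le> cnt n" by blast
    obtain i where i: "n \<le> i" "\<omega> i = a" using io by blast
    have "Suc j \<le> cnt (Suc i)" using cnt_Suc[of i] cnt_mono[of n i] n i by simp
    then show ?case using n i by (intro exI[of _ "Suc i"]) auto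
  qed auto
  \<comment> \<open>The cut is made at the first moment when \<open>a\<close> has been visited
    \<open>Suc k\<close> times after \<open>v\<close>; the last letter before the cut is then
    \<open>a\<close>.\<close>
  define n where "n = (LEAST n. p \<le> n \<and> Suc k \<le> cnt n)"
  have n: "p \<le> n" "Suc k \<le> cnt n"
    using LeastI_ex[OF big[unfolded Bex_def, of "Suc k", simplified]] unfolding n_def by auto
  have "n \<noteq> p" using n by (auto simp: cnt_def)
  then obtain n' where n': "n = Suc n'" "p \<le> n'" using n by (cases n) auto
  have "\<not> Suc k \<le> cnt n'"
    using not_less_Least[of n' "\<lambda>n. p \<le> n \<and> Suc k \<le> cnt n"] n' by (simp add: n_def[symmetric])
  then have a: "\<omega> n' = a" "cnt n = Suc k"
    using n n' cnt_Suc[of n'] by (auto split: if_splits)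
  define u where "u = map \<omega> [p..<n]"
  have vu: "pre \<omega> n = v @ u"
  proof -
    have "[0..<n] = [0..<p] @ [p..<n]" using n(1) by (metis le_Suc_ex upt_add_eq_append zero_le add_0)
    then show ?thesis using assms(2) by (simp add: u_def)
  qed
  have u: "u \<noteq> []" "last u = a" "count_list u a = Suc k"
    using n' a by (auto simp: u_def cnt_def)
  have "adm (v @ u)" using adm_pre[OF assms(1), of n] vu by simp
  then have "u \<in> returns a (Suc k)" using u assms(3,4) by (auto simp: returns_def adm_append)
  then show thesis using that[of n' u] vu a n' by simp
qed

lemma countable_adm: "countable {w. adm w}"
  by (rule countable_subset[OF _ countable_lists[OF countable_finite[OF finite_A]]]) (auto simp: adm_def)

text \<open>
  If all these sums were at most \<open>M\<close>, the points that visit their last prefix letter infinitely often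
  would be covered by words with arbitrarily many returns, of total weight tending to \<open>0\<close> at exponent \<open>\<tau>\<close>.
\<close>

lemma exists_large_returns:
  assumes t: "0 < t" "t < \<tau>" and nz: "hausdorff_measure \<tau> (coding_map K \<phi> ` {\<omega>. adm_seq \<omega>}) \<noteq> 0"
  shows "\<exists>a\<in>A. \<exists>k. \<exists>F\<subseteq>returns a (Suc k). finite F \<and> M < (\<Sum>u\<in>F. r u powr t)"
proof (rule ccontr)
  assume "\<not> ?thesis"
  then have small: "(\<Sum>u\<in>F. r u powr t) \<le> M" if "a \<in> A" "F \<subseteq> returns a (Suc k)" "finite F" for a k F
    using that by (meson not_le)
  \<comment> \<open>Some letter recurs infinitely often because the alphabet is finite. Ending the
    prefix \<open>v\<close> at such a letter places every sequence in one of these countably many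
    sets.\<close>
  define S where "S v = {\<omega>. adm_seq \<omega> \<and> v \<noteq> [] \<and> pre \<omega> (length v) = v \<and> (\<forall>n. \<exists>i\<ge>n. \<omega> i = last v)}" for v
  have zero: "hausdorff_measure \<tau> (coding_map K \<phi> ` S v) = 0" for v
  proof (cases "S v = {}")
    case True
    then show ?thesis by (simp add: hausdorff_measure_empty)
  next
    case False
    then obtain \<omega>0 where \<omega>0: "adm_seq \<omega>0" "v \<noteq> []" "pre \<omega>0 (length v) = v" by (auto simp: S_def)
    have v: "adm v" "v \<noteq> []" using adm_pre[OF \<omega>0(1), of "length v"] \<omega>0 by simp_all
    have rv: "0 < r v" by (rule r_pos[OF v])
    have lA: "last v \<in> A" by (rule adm_last[OF v])
    show ?thesis
    proof (rule hausdorff_measure_zero_word_cover[OF t])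
      fix \<epsilon> :: real assume \<epsilon>: "0 < \<epsilon>"
      \<comment> \<open>Prepending \<open>v\<close> multiplies each weight by at most
        \<open>(\<kappa> * r v) powr t\<close>. The absolute value allows any \<open>M\<close>, and
        \<open>+ 1\<close> makes the constant positive.\<close>
      define C where "C = (\<kappa> * r v) powr t * \<bar>M\<bar> + 1"
      have C: "0 < C" by (simp add: C_def add_nonneg_pos)
      have "\<exists>W. word_cover (coding_map K \<phi> ` S v) t k (C * exp (\<epsilon> * k)) W" for k
      proof -
        define R where "R = returns (last v) (Suc k)"
        define W where "W = (\<lambda>u. v @ u) ` R"
        have adm: "adm (v @ u) \<and> u \<noteq> [] \<and> k \<le> length u" if "u \<in> R" for u
          using that v count_le_length[of u "last v"] by (auto simp: R_def returns_def adm_append)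
        have W1: "countable W"
          unfolding W_def R_def by (intro countable_image countable_subset[OF _ countable_adm]) (auto simp: returns_def)
        have W2: "adm w \<and> w \<noteq> [] \<and> k \<le> length w" if "w \<in> W" for w
          using that adm by (fastforce simp: W_def)
        have W3: "coding_map K \<phi> ` S v \<subseteq> (\<Union>w\<in>W. wm w ` K (last w))"
        proof
          fix x assume "x \<in> coding_map K \<phi> ` S v"
          then obtain \<omega> where \<omega>: "\<omega> \<in> S v" "x = coding_map K \<phi> \<omega>" by blast
          then have \<omega>': "adm_seq \<omega>" "pre \<omega> (length v) = v" "\<And>n. \<exists>i\<ge>n. \<omega> i = last v" by (auto simp: S_def)
          obtain n u where u: "pre \<omega> (Suc n) = v @ u" "u \<in> R" "\<omega> n = last v"
            using return_prefix[OF \<omega>'(1,2) v(2) refl \<omega>'(3)] unfolding R_def by metis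
          have "last (v @ u) = \<omega> n" unfolding u(1)[symmetric] by simp
          then have "x \<in> wm (v @ u) ` K (last (v @ u))"
            using coding_map_in[OF \<omega>'(1), of n] unfolding u(1) \<omega>(2) by simp
          moreover have "v @ u \<in> W" using u by (simp add: W_def)
          ultimately show "x \<in> (\<Union>w\<in>W. wm w ` K (last w))" by blast
        qed
        have W4: "(\<Sum>w\<in>J. r w powr t) \<le> C * exp (\<epsilon> * k)" if J: "J \<subseteq> W" "finite J" for J
        proof -
          obtain F where F: "F \<subseteq> R" "finite F" "J = (\<lambda>u. v @ u) ` F"
            using finite_subset_image[OF J(2) J(1)[unfolded W_def]] by blast
          have "(\<Sum>w\<in>J. r w powr t) = (\<Sum>u\<in>F. r (v @ u) powr t)"
            unfolding F(3) by (simp add: sum.reindex inj_on_def)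
          also have "\<dots> \<le> (\<Sum>u\<in>F. (\<kappa> * r v) powr t * r u powr t)"
          proof (rule sum_mono)
            fix u assume "u \<in> F"
            then have u: "adm (v @ u)" "u \<noteq> []" using adm F by auto
            have ru: "0 < r u" using u by (intro r_pos) (auto simp: adm_append)
            have "r (v @ u) powr t \<le> (\<kappa> * (r v * r u)) powr t"
              using r_append_le[OF u(1) v(2) u(2)] t r_pos[OF u(1)] u(2) by (intro powr_mono2) auto
            also have "\<dots> = (\<kappa> * r v) powr t * r u powr t"
              using ru rv kappa_ge by (simp add: powr_mult mult_ac)
            finally show "r (v @ u) powr t \<le> (\<kappa> * r v) powr t * r u powr t" .
          qed
          also have "\<dots> = (\<kappa> * r v) powr t * (\<Sum>u\<in>F. r u powr t)" by (simp add: sum_distrib_left)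
          also have "\<dots> \<le> (\<kappa> * r v) powr t * \<bar>M\<bar>"
            using small[OF lA F(1)[unfolded R_def] F(2)] by (intro mult_left_mono) auto
          also have "\<dots> \<le> C * 1" by (simp add: C_def)
          also have "\<dots> \<le> C * exp (\<epsilon> * k)" using C \<epsilon> by (intro mult_left_mono) auto
          finally show ?thesis .
        qed
        show ?thesis using W1 W2 W3 W4 unfolding word_cover_def by (intro exI[of _ W]) simp
      qed
      then show "\<exists>C>0. \<forall>k. \<exists>W. word_cover (coding_map K \<phi> ` S v) t k (C * exp (\<epsilon> * k)) W"
        using C by (intro exI[of _ C] conjI allI)
    qed
  qed
  define e where "e = from_nat_into {w. adm w}"
  have "hausdorff_measure \<tau> (\<Union>n. coding_map K \<phi> ` S (e n)) = 0"
    by (rule hausdorff_measure_zero_Union) (use t zero in auto)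
  moreover have "coding_map K \<phi> ` {\<omega>. adm_seq \<omega>} \<subseteq> (\<Union>n. coding_map K \<phi> ` S (e n))"
  proof
    fix x assume "x \<in> coding_map K \<phi> ` {\<omega>. adm_seq \<omega>}"
    then obtain \<omega> where \<omega>: "adm_seq \<omega>" "x = coding_map K \<phi> \<omega>" by blast
    have "range \<omega> \<subseteq> A" using adm_seq_in_A[OF \<omega>(1)] by blast
    then have "finite (range \<omega>)" using finite_A finite_subset by blast
    then obtain i where i: "infinite {j. \<omega> j = \<omega> i}"
      using pigeonhole_infinite[of UNIV \<omega>] by auto
    define v where "v = pre \<omega> (Suc i)"
    have "last v = \<omega> i" "pre \<omega> (length v) = v" "v \<noteq> []" by (simp_all add: v_def)
    then have "\<omega> \<in> S v"
      using \<omega>(1) i unfolding S_def infinite_nat_iff_unbounded_le by simp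
    moreover have "v \<in> {w. adm w}" using adm_pre[OF \<omega>(1)] unfolding v_def by blast
    then obtain n where "v = e n" unfolding e_def using countable_adm by (metis from_nat_into_surj)
    ultimately show "x \<in> (\<Union>n. coding_map K \<phi> ` S (e n))" using \<omega>(2) by blast
  qed
  ultimately have "hausdorff_measure \<tau> (coding_map K \<phi> ` {\<omega>. adm_seq \<omega>}) = 0"
    using hausdorff_measure_mono by (metis le_zero_eq)
  with nz show False by contradiction
qed

end

section \<open>Systems generated by return words\<close>

text \<open>That all words of \<open>F\<close> return to the same \<open>a\<close> makes them freely
  concatenable; that they do so equally often makes \<open>F\<close> prefix-free. The word
  \<open>f0\<close> fills the forced positions.\<close>

locale return_system = metric_gdms A T K \<phi> g y s L \<alpha> \<rho> Dm gmin gmax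
  for A :: "'a set" and T :: "('a \<times> 'a) set"
    and K :: "'a \<Rightarrow> 'v::euclidean_space set" and \<phi> :: "'a \<Rightarrow> 'v \<Rightarrow> 'v"
    and g :: "'a \<Rightarrow> 'v \<Rightarrow> real" and y :: "'a \<Rightarrow> 'v"
    and s L \<alpha> \<rho> Dm gmin gmax :: real +
  fixes a :: 'a and k0 :: nat and F :: "'a list set" and f0 :: "'a list"
  assumes F_returns: "F \<subseteq> returns a (Suc k0)" and finF: "finite F" and f0_in: "f0 \<in> F"
    and a_in: "a \<in> A"
begin

abbreviation "Pw \<equiv> pattern_words F f0"

definition q :: "'a list list \<Rightarrow> real" where
  "q ws = (if ws = [] then 1 else r (concat ws))"

lemma F_D:
  assumes "u \<in> F"
  shows "adm u" "u \<noteq> []" "last u = a" "(a, hd u) \<in> T" "count_list u a = Suc k0"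
  using assms F_returns by (auto simp: returns_def)

lemma concat_F:
  assumes "set ws \<subseteq> F"
  shows "adm (concat ws) \<and> (ws \<noteq> [] \<longrightarrow> concat ws \<noteq> [] \<and> last (concat ws) = a \<and> (a, hd (concat ws)) \<in> T)"
  using assms
proof (induction ws)
  case (Cons u ws)
  then have u: "u \<in> F" "set ws \<subseteq> F" by auto
  show ?case
  proof (cases "ws = []")
    case True
    then show ?thesis using F_D[OF u(1)] by simp
  next
    case False
    then show ?thesis using F_D[OF u(1)] Cons.IH[OF u(2)] by (simp add: adm_append)
  qed
qed simp

lemma length_concat_F: "set ws \<subseteq> F \<Longrightarrow> length ws \<le> length (concat ws)"
proof (induction ws)
  case (Cons u ws)
  then have "u \<noteq> []" using F_D by simp
  then have "1 \<le> length u" by (simp add: Suc_leI)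
  then show ?case using Cons by simp
qed simp

lemma q_pos: "set ws \<subseteq> F \<Longrightarrow> 0 < q ws"
  using concat_F[of ws] r_pos by (auto simp: q_def)

lemma q_append:
  assumes "set us \<subseteq> F" "set vs \<subseteq> F"
  shows q_append_le: "q (us @ vs) \<le> \<kappa> * (q us * q vs)"
    and q_append_ge: "q us * q vs \<le> \<kappa> * q (us @ vs)"
proof -
  have "q (us @ vs) \<le> \<kappa> * (q us * q vs) \<and> q us * q vs \<le> \<kappa> * q (us @ vs)"
  proof (cases "us = [] \<or> vs = []")
    case True
    have "q ws \<le> \<kappa> * q ws" if "set ws \<subseteq> F" for ws
      using mult_right_mono[OF kappa_ge less_imp_le[OF q_pos[OF that]]] by simp
    moreover have "q [] = 1" by (simp add: q_def)
    ultimately show ?thesis using True assms by auto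
  next
    case False
    then have "adm (concat us @ concat vs)" "concat us \<noteq> []" "concat vs \<noteq> []"
      using concat_F[of us] concat_F[of vs] assms by (auto simp: adm_append)
    from r_append[OF this] show ?thesis using False by (simp add: q_def)
  qed
  then show "q (us @ vs) \<le> \<kappa> * (q us * q vs)" "q us * q vs \<le> \<kappa> * q (us @ vs)" by auto
qed

lemma quasi_multiplicative_powr:
  assumes "0 < t"
  shows "quasi_multiplicative F f0 (\<lambda>ws. q ws powr t) (\<kappa> powr t)"
proof
  show "1 \<le> \<kappa> powr t" using kappa_ge assms by (simp add: ge_one_powr_ge_zero)
  show "q [] powr t = 1" by (simp add: q_def)
  show "0 < q ws powr t" if "set ws \<subseteq> F" for ws using q_pos[OF that] by simp
  fix us vs assume u: "set us \<subseteq> F" "set vs \<subseteq> F"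
  then have p: "0 < q us" "0 < q vs" "0 < q (us @ vs)" by (simp_all add: q_pos)
  have k: "0 < \<kappa>" using kappa_ge by linarith
  have "q (us @ vs) powr t \<le> (\<kappa> * (q us * q vs)) powr t"
    using q_append_le[OF u] p assms by (intro powr_mono2) auto
  then show "q (us @ vs) powr t \<le> \<kappa> powr t * (q us powr t * q vs powr t)"
    using p k by (simp add: powr_mult)
  have "(q us * q vs) powr t \<le> (\<kappa> * q (us @ vs)) powr t"
    using q_append_ge[OF u] p assms by (intro powr_mono2) auto
  then show "q us powr t * q vs powr t \<le> \<kappa> powr t * q (us @ vs) powr t"
    using p k by (simp add: powr_mult)
qed (use finF f0_in in auto)

lemma q_decay:
  assumes "set ws \<subseteq> F"
  shows "q ws \<le> C0 * \<theta> ^ length ws"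
proof (cases "ws = []")
  case True
  then show ?thesis using C0(1) by (simp add: q_def)
next
  case False
  then have "q ws \<le> C0 * \<theta> ^ length (concat ws)"
    using C0(2) concat_F[OF assms] by (simp add: q_def)
  also have "\<dots> \<le> C0 * \<theta> ^ length ws"
    using C0(1) theta length_concat_F[OF assms] by (intro mult_left_mono power_decreasing) auto
  finally show ?thesis .
qed

text \<open>
  Defining the shift by its language of factors makes it closed and shift invariant, although the
  return words have different lengths.
\<close>

definition allowed :: "nat set \<Rightarrow> 'a list list set" where
  "allowed P = (\<Union>m n. Pw P m n)"

definition pattern_shift :: "nat set \<Rightarrow> (nat \<Rightarrow> 'a) set" where
  "pattern_shift P = {\<omega>. \<forall>n. \<exists>ws\<in>allowed P. \<exists>u v. concat ws = u @ pre \<omega> n @ v}"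

abbreviation "JP P \<equiv> coding_map K \<phi> ` pattern_shift P"

lemma allowed_F: "ws \<in> allowed P \<Longrightarrow> set ws \<subseteq> F"
  by (auto simp: allowed_def pattern_words_def)

lemma pattern_shift_adm:
  assumes "\<omega> \<in> pattern_shift P"
  shows "adm_seq \<omega>"
  unfolding adm_seq_def
proof
  fix n
  obtain ws u v where ws: "ws \<in> allowed P" "concat ws = u @ pre \<omega> (Suc (Suc n)) @ v"
    using assms unfolding pattern_shift_def by blast
  have "adm (concat ws)" using concat_F[OF allowed_F[OF ws(1)]] by blast
  then have "adm (pre \<omega> (Suc (Suc n)))" unfolding ws(2) by (simp only: adm_append)
  then show "(\<omega> n, \<omega> (Suc n)) \<in> T" by (simp add: adm_append adm_Cons)
qed

lemma pattern_shift_shift: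
  assumes "\<omega> \<in> pattern_shift P"
  shows "left_shift \<omega> \<in> pattern_shift P"
  unfolding pattern_shift_def mem_Collect_eq
proof
  fix n
  obtain ws u v where ws: "ws \<in> allowed P" "concat ws = u @ pre \<omega> (Suc n) @ v"
    using assms unfolding pattern_shift_def by blast
  have "pre \<omega> (Suc n) = \<omega> 0 # pre (left_shift \<omega>) n"
    unfolding left_shift_def by (simp only: map_upt_Suc)
  then have "concat ws = (u @ [\<omega> 0]) @ pre (left_shift \<omega>) n @ v" using ws(2) by simp
  then show "\<exists>ws\<in>allowed P. \<exists>u v. concat ws = u @ pre (left_shift \<omega>) n @ v" using ws(1) by blast
qed

text \<open>If \<open>R\<close> fails for a prefix of length \<open>n\<close>, it fails on the whole
  cylinder fixing the first \<open>n\<close> letters, which is open.\<close>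

lemma closedin_prefix_property:
  "closedin (full_shift A) {\<omega> \<in> topspace (full_shift A). \<forall>n. R (pre \<omega> n)}"
  unfolding closedin_def
proof (intro conjI)
  let ?C = "{\<omega> \<in> topspace (full_shift A). \<forall>n. R (pre \<omega> n)}"
  show "?C \<subseteq> topspace (full_shift A)" by blast
  have "\<exists>U. openin (full_shift A) U \<and> \<omega> \<in> U \<and> U \<subseteq> topspace (full_shift A) - ?C"
    if "\<omega> \<in> topspace (full_shift A) - ?C" for \<omega>
  proof -
    have top: "\<omega> \<in> topspace (full_shift A)" using that by blast
    then have "\<not> (\<forall>n. R (pre \<omega> n))" using that by blast
    then obtain n where n: "\<not> R (pre \<omega> n)" by blast
    define S where "S i = (if i < n then {\<omega> i} else A)" for i
    have \<omega>A: "\<omega> i \<in> A" for i using top by (auto simp: full_shift_def)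
    have "openin (full_shift A) (PiE UNIV S)"
      unfolding full_shift_def
    proof (subst openin_PiE_gen, intro disjI2 conjI ballI)
      show "finite {i \<in> UNIV. S i \<noteq> topspace (discrete_topology A)}"
        by (rule finite_subset[of _ "{..<n}"]) (auto simp: S_def)
      show "openin (discrete_topology A) (S i)" for i using \<omega>A by (simp add: S_def)
    qed
    moreover have "\<omega> \<in> PiE UNIV S" using \<omega>A by (auto simp: S_def)
    moreover have "\<not> R (pre x n)" if "x \<in> PiE UNIV S" for x
    proof -
      have "x i = \<omega> i" if "i < n" for i using PiE_mem[OF \<open>x \<in> PiE UNIV S\<close>, of i] that by (simp add: S_def)
      then have eq: "pre x n = pre \<omega> n" by simp
      show ?thesis unfolding eq by (rule n)
    qed
    moreover have "PiE UNIV S \<subseteq> topspace (full_shift A)"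
      using \<omega>A unfolding full_shift_def topspace_product_topology by (intro PiE_mono) (auto simp: S_def)
    ultimately show ?thesis by (intro exI[of _ "PiE UNIV S"]) blast
  qed
  then show "openin (full_shift A) (topspace (full_shift A) - ?C)"
    by (subst openin_subopen) blast
qed

lemma subshift_pattern_shift: "subshift A (pattern_shift P)"
  unfolding subshift_def
proof (intro conjI ballI)
  have "pattern_shift P = {\<omega> \<in> topspace (full_shift A). \<forall>n. \<exists>ws\<in>allowed P. \<exists>u v. concat ws = u @ pre \<omega> n @ v}"
    using adm_seq_in_A[OF pattern_shift_adm]
    by (auto simp: pattern_shift_def full_shift_def)
  then show "closedin (full_shift A) (pattern_shift P)"
    using closedin_prefix_property[of "\<lambda>l. \<exists>ws\<in>allowed P. \<exists>u v. concat ws = u @ l @ v"] by simp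
qed (rule pattern_shift_shift)

section \<open>Upper bound for the dimension\<close>

definition Lmax :: nat where "Lmax = Max (length ` F)"

lemma Lmax: "u \<in> F \<Longrightarrow> length u \<le> Lmax" "1 \<le> Lmax"
proof -
  show *: "length u \<le> Lmax" if "u \<in> F" for u unfolding Lmax_def by (rule Max_ge) (use finF that in auto)
  have "1 \<le> length f0" using F_D(2)[OF f0_in] by (simp add: Suc_leI)
  then show "1 \<le> Lmax" using *[OF f0_in] by linarith
qed

lemma length_concat_le: "set ws \<subseteq> F \<Longrightarrow> length (concat ws) \<le> length ws * Lmax"
proof (induction ws)
  case (Cons u ws)
  then show ?case using Lmax(1)[of u] by simp
qed simp

text \<open>A point of the shift may start in the middle of a return word. Its remainder
  \<open>v\<close> is followed by complete words read in the pattern from some unknown position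
  \<open>m\<close>.\<close>

lemma pattern_shift_decompose:
  assumes "\<omega> \<in> pattern_shift P"
  obtains n v m ws u where "pre \<omega> (Suc n) = v @ concat ws" "ws \<in> Pw P m (Suc k)"
    "u \<in> F" "\<exists>u1. u = u1 @ v"
proof -
  \<comment> \<open>No block is longer than \<open>Lmax\<close>, so a prefix of this length has room
    for the partial block and \<open>Suc k\<close> complete ones.\<close>
  define n where "n = (k + 3) * Lmax"
  have n0: "n \<noteq> 0" using Lmax(2) by (simp add: n_def)
  obtain ws0 p s where ws0: "ws0 \<in> allowed P" "concat ws0 = p @ (pre \<omega> n @ s)"
    using assms unfolding pattern_shift_def by blast
  obtain m0 n1 where m0: "ws0 \<in> Pw P m0 n1" using ws0(1) by (auto simp: allowed_def)
  have "pre \<omega> n @ s \<noteq> []" using n0 by simp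
  from concat_factor[OF ws0(2) this] obtain ws1 u1 u2 ws2 where
    d: "ws0 = ws1 @ (u1 @ u2) # ws2" "pre \<omega> n @ s = u2 @ concat ws2" by blast
  have FF: "set ws0 \<subseteq> F" by (rule allowed_F[OF ws0(1)])
  have uF: "u1 @ u2 \<in> F" "set ws2 \<subseteq> F" using FF by (auto simp: d(1))
  have l2: "length u2 \<le> Lmax" using Lmax(1)[OF uF(1)] by simp
  have "n \<le> length (u2 @ concat ws2)" unfolding d(2)[symmetric] by simp
  also have "\<dots> \<le> Lmax + length ws2 * Lmax" using l2 length_concat_le[OF uF(2)] by simp
  finally have "(k + 3) * Lmax \<le> (1 + length ws2) * Lmax" by (simp add: n_def)
  then have "k + 3 \<le> 1 + length ws2" using Lmax(2) unfolding mult_le_cancel2 by linarith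
  then have lw: "Suc k \<le> length ws2" by simp
  define ws where "ws = take (Suc k) ws2"
  have wsF: "set ws \<subseteq> F" using uF(2) set_take_subset[of "Suc k" ws2] by (auto simp: ws_def)
  have lws: "length ws = Suc k" using lw by (simp add: ws_def)
  have "ws \<in> Pw P (m0 + (length ws1 + 1)) (Suc k)"
    unfolding pattern_words_def
  proof (intro CollectI conjI allI impI)
    fix i assume i: "i < Suc k"
    have "length ws0 = n1" using m0 by (simp add: pattern_words_def)
    then have il: "length ws1 + 1 + i < n1" using lw i by (simp add: d(1))
    have "ws0 ! (length ws1 + 1 + i) = ws2 ! i" by (simp add: d(1) nth_append)
    moreover have "ws0 ! (length ws1 + 1 + i) = f0 \<or> m0 + (length ws1 + 1 + i) \<in> P"
      using m0 il unfolding pattern_words_def by blast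
    moreover have "ws ! i = ws2 ! i" using i by (simp add: ws_def)
    ultimately show "ws ! i = f0 \<or> m0 + (length ws1 + 1) + i \<in> P" by (simp add: add.assoc)
  qed (use wsF lws in auto)
  moreover have "\<exists>n. pre \<omega> (Suc n) = u2 @ concat ws"
  proof -
    define N where "N = length (u2 @ concat ws)"
    have "N \<le> Lmax + Suc k * Lmax" using l2 length_concat_le[OF wsF] lws by (simp add: N_def)
    also have "\<dots> \<le> n" by (simp add: n_def algebra_simps)
    finally have Nn: "N \<le> n" .
    have "concat ws2 = concat ws @ concat (drop (Suc k) ws2)"
      unfolding ws_def concat_append[symmetric] by simp
    then have eq: "pre \<omega> n @ s = (u2 @ concat ws) @ concat (drop (Suc k) ws2)" using d(2) by simp
    have "take N (pre \<omega> n @ s) = u2 @ concat ws" unfolding eq N_def by simp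
    then have "pre \<omega> N = u2 @ concat ws" using Nn by (simp add: take_map min_def)
    moreover have "N \<noteq> 0" using length_concat_F[OF wsF] lws unfolding N_def length_append by linarith
    ultimately show ?thesis by (metis not0_implies_Suc)
  qed
  ultimately show thesis using that uF(1) by blast
qed

text \<open>The partial block \<open>v\<close> may be empty, so the crude bound \<open>gmax\<close>
  per letter is used instead of \<open>r_append\<close>.\<close>

lemma r_prefix_le:
  assumes "adm (v @ concat ws)" "set ws \<subseteq> F" "ws \<noteq> []" "length v \<le> Lmax"
  shows "r (v @ concat ws) \<le> gmax ^ Lmax * q ws"
proof -
  have c: "adm (concat ws)" "concat ws \<noteq> []" using concat_F[OF assms(2)] assms(3) by auto
  have y: "y (last (v @ concat ws)) \<in> wdom (v @ concat ws)" using y_wdom[OF assms(1)] c by simp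
  have dm: "wm (concat ws) (y (last (concat ws))) \<in> wdom v"
    using wm_in_append[OF assms(1) _ y] c(2) by (auto simp: wdom_def)
  have "gp v (wm (concat ws) (y (last (concat ws)))) \<le> gmax ^ length v"
    using assms(1) dm by (intro gp_le) (auto simp: adm_append)
  also have "\<dots> \<le> gmax ^ Lmax" using assms(4) gmax(1) by (intro power_increasing)
  finally have "gp v (wm (concat ws) (y (last (concat ws)))) * r (concat ws) \<le> gmax ^ Lmax * r (concat ws)"
    using r_pos[OF c] by (intro mult_right_mono) auto
  then show ?thesis using c assms(3) by (simp add: r_def q_def gp_append)
qed

text \<open>Replacing \<open>P\<close> by a periodic \<open>U\<close> leaves only \<open>l\<close>
  starting positions. Together with the finitely many partial blocks, the number of choices does not
  depend on \<open>k\<close>, so the bound for the sums from every position \<open>m\<close> yields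
  covers of subexponential weight.\<close>

lemma pattern_shift_dim_le:
  assumes t: "0 < t" "t < \<tau>"
    and bal: "\<And>\<epsilon>::real. 0 < \<epsilon> \<Longrightarrow> \<exists>C>0. \<exists>U l. 0 < l \<and> P \<subseteq> U \<and> periodic U l \<and>
      (\<forall>m n. (\<Sum>ws\<in>Pw U m n. q ws powr t) \<le> C * exp (\<epsilon> * real n))"
  shows "hausdorff_measure \<tau> (JP P) = 0"
proof (rule hausdorff_measure_zero_word_cover[OF t])
  fix \<epsilon> :: real assume \<epsilon>: "0 < \<epsilon>"
  obtain C U l where C: "0 < C" "0 < l" "P \<subseteq> U" "periodic U l"
    and Cb: "\<And>m n. (\<Sum>ws\<in>Pw U m n. q ws powr t) \<le> C * exp (\<epsilon> * real n)"
    using bal[OF \<epsilon>] by blast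
  define V where "V = (\<lambda>(u, i). drop i u) ` (F \<times> {..Lmax})"
  have finV: "finite V" using finF by (simp add: V_def)
  have lenV: "length v \<le> Lmax" if "v \<in> V" for v
  proof -
    obtain u i where "u \<in> F" "v = drop i u" using \<open>v \<in> V\<close> by (auto simp: V_def)
    then show ?thesis using Lmax(1)[of u] by simp
  qed
  define D where "D = (gmax ^ Lmax) powr t"
  have D: "0 \<le> D" by (simp add: D_def)
  \<comment> \<open>One factor for each choice of partial block and starting position,
    \<open>D\<close> for the weight of the partial block, and \<open>exp \<epsilon>\<close> because
    \<open>Suc k\<close> complete words are used.\<close>
  define M where "M = real (card V) * real l * D * C * exp \<epsilon> + 1"
  have M: "0 < M" using C(1) D by (simp add: M_def add_nonneg_pos)
  have "\<exists>W. word_cover (JP P) t k (M * exp (\<epsilon> * k)) W" for k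
  proof -
    define Idx where "Idx = {(v, m). v \<in> V \<and> m < l}"
    have finIdx: "finite Idx" and cardIdx: "card Idx = card V * l"
    proof -
      have "Idx = V \<times> {..<l}" by (auto simp: Idx_def)
      then show "finite Idx" "card Idx = card V * l" using finV by (simp_all add: card_cartesian_product)
    qed
    define S where "S = (\<lambda>(v, m). {w. adm w \<and> w \<in> (\<lambda>ws. v @ concat ws) ` Pw U m (Suc k)})"
    define W where "W = (\<Union>i\<in>Idx. S i)"
    have finS: "finite (S i)" for i
      unfolding S_def by (simp add: case_prod_unfold finite_pattern_words[OF finF])
    have W_D: "adm w \<and> w \<noteq> [] \<and> k \<le> length w" if w: "w \<in> W" for w
    proof -
      obtain v m ws where w: "adm w" "w = v @ concat ws" "ws \<in> Pw U m (Suc k)"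
        using w by (auto simp: W_def S_def)
      have ws: "set ws \<subseteq> F" "length ws = Suc k" using w(3) by (auto simp: pattern_words_def)
      have "Suc k \<le> length (concat ws)" using length_concat_F[OF ws(1)] ws(2) by simp
      then have "Suc k \<le> length w" unfolding w(2) length_append by linarith
      then show ?thesis using w(1) by auto
    qed
    have cov: "JP P \<subseteq> (\<Union>w\<in>W. wm w ` K (last w))"
    proof
      fix x assume "x \<in> JP P"
      then obtain \<omega> where \<omega>: "\<omega> \<in> pattern_shift P" "x = coding_map K \<phi> \<omega>" by blast
      obtain n v m ws u where n: "pre \<omega> (Suc n) = v @ concat ws" "ws \<in> Pw P m (Suc k)"
        "u \<in> F" "\<exists>u1. u = u1 @ v" using pattern_shift_decompose[OF \<omega>(1)] .
      have ad: "adm_seq \<omega>" by (rule pattern_shift_adm[OF \<omega>(1)])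
      obtain u1 where u1: "u = u1 @ v" using n(4) by blast
      have "v = drop (length u1) u" "length u1 \<le> Lmax" using Lmax(1)[OF n(3)] by (simp_all add: u1)
      then have "v \<in> V" using n(3) by (auto simp: V_def)
      have "Pw P m (Suc k) \<subseteq> Pw U m (Suc k)"
        by (rule pattern_words_mono) (use C(3) in blast)
      also have "\<dots> = Pw U (m mod l) (Suc k)"
        using pattern_words_periodic[OF C(4), of F f0 "m mod l" "m div l"] by simp
      finally have "ws \<in> Pw U (m mod l) (Suc k)" using n(2) by blast
      moreover have "adm (v @ concat ws)" using adm_pre[OF ad, of "Suc n"] unfolding n(1) .
      ultimately have "v @ concat ws \<in> S (v, m mod l)" by (auto simp: S_def)
      moreover have "(v, m mod l) \<in> Idx" using \<open>v \<in> V\<close> C(2) by (simp add: Idx_def)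
      ultimately have "v @ concat ws \<in> W" unfolding W_def by blast
      moreover have "last (v @ concat ws) = \<omega> n" unfolding n(1)[symmetric] by simp
      then have "x \<in> wm (v @ concat ws) ` K (last (v @ concat ws))"
        using coding_map_in[OF ad, of n] unfolding n(1) \<omega>(2) by simp
      ultimately show "x \<in> (\<Union>w\<in>W. wm w ` K (last w))" by blast
    qed
    have sm: "(\<Sum>w\<in>J. r w powr t) \<le> M * exp (\<epsilon> * k)" if J: "J \<subseteq> W" for J
    proof -
      have "(\<Sum>w\<in>J. r w powr t) \<le> (\<Sum>i\<in>Idx. \<Sum>w\<in>S i. r w powr t)"
        by (rule sum_le_sum_UN[OF finIdx finS]) (use J in \<open>auto simp: W_def\<close>)
      also have "\<dots> \<le> (\<Sum>i\<in>Idx. D * (C * exp (\<epsilon> * real (Suc k))))"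
      proof (rule sum_mono)
        fix i assume "i \<in> Idx"
        then obtain v m where i: "i = (v, m)" "v \<in> V" by (auto simp: Idx_def)
        define X where "X = {ws \<in> Pw U m (Suc k). adm (v @ concat ws)}"
        have finX: "finite X" by (simp add: X_def finite_pattern_words[OF finF])
        have "S i = (\<lambda>ws. v @ concat ws) ` X" by (auto simp: S_def X_def i)
        then have "(\<Sum>w\<in>S i. r w powr t) \<le> (\<Sum>ws\<in>X. r (v @ concat ws) powr t)"
          using sum_image_le[OF finX, of "\<lambda>w. r w powr t" "\<lambda>ws. v @ concat ws"] by (simp add: comp_def)
        also have "\<dots> \<le> (\<Sum>ws\<in>X. D * q ws powr t)"
        proof (rule sum_mono)
          fix ws assume "ws \<in> X"
          then have ws: "set ws \<subseteq> F" "ws \<noteq> []" "adm (v @ concat ws)"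
            by (auto simp: X_def pattern_words_def)
          have "concat ws \<noteq> []" using concat_F[OF ws(1)] ws(2) by blast
          then have "r (v @ concat ws) powr t \<le> (gmax ^ Lmax * q ws) powr t"
            using r_prefix_le[OF ws(3,1,2) lenV[OF i(2)]] t r_pos[OF ws(3)] by (intro powr_mono2) auto
          also have "\<dots> = D * q ws powr t" using gmax(1) q_pos[OF ws(1)] by (simp add: D_def powr_mult)
          finally show "r (v @ concat ws) powr t \<le> D * q ws powr t" .
        qed
        also have "\<dots> \<le> (\<Sum>ws\<in>Pw U m (Suc k). D * q ws powr t)"
          using D by (intro sum_mono2) (auto simp: X_def finite_pattern_words[OF finF])
        also have "\<dots> = D * (\<Sum>ws\<in>Pw U m (Suc k). q ws powr t)"
          by (simp add: sum_distrib_left)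
        also have "\<dots> \<le> D * (C * exp (\<epsilon> * real (Suc k)))" by (intro mult_left_mono Cb D)
        finally show "(\<Sum>w\<in>S i. r w powr t) \<le> D * (C * exp (\<epsilon> * real (Suc k)))" .
      qed
      also have "\<dots> = real (card V) * real l * D * C * exp \<epsilon> * exp (\<epsilon> * k)"
        using cardIdx by (simp add: algebra_simps exp_add)
      also have "\<dots> \<le> M * exp (\<epsilon> * k)" by (simp add: M_def)
      finally show ?thesis .
    qed
    have "finite W" using finIdx finS by (simp add: W_def)
    then show ?thesis
      using W_D cov sm unfolding word_cover_def by (intro exI[of _ W]) (simp add: countable_finite)
  qed
  then show "\<exists>C>0. \<forall>k. \<exists>W. word_cover (JP P) t k (C * exp (\<epsilon> * k)) W"
    using M by (intro exI[of _ M] conjI allI)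
qed

end

section \<open>Packing of cylinders and the lower bound for the dimension\<close>

lemma card_disjoint_balls_le:
  fixes z :: "'b \<Rightarrow> 'v::euclidean_space"
  assumes G: "finite G" and b: "0 < b" and R: "0 \<le> R"
    and disj: "\<And>u v. u \<in> G \<Longrightarrow> v \<in> G \<Longrightarrow> u \<noteq> v \<Longrightarrow> ball (z u) b \<inter> ball (z v) b = {}"
    and sub: "\<And>u. u \<in> G \<Longrightarrow> ball (z u) b \<subseteq> ball c R"
  shows "real (card G) \<le> (R / b) ^ DIM('v)"
proof -
  have V: "0 < unit_ball_vol (real DIM('v))" by (rule unit_ball_vol_pos) simp
  have "real (card G) * (unit_ball_vol (real DIM('v)) * b ^ DIM('v)) = (\<Sum>u\<in>G. measure lborel (ball (z u) b))"
    using b by (simp add: content_ball)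
  also have "\<dots> = measure lborel (\<Union>u\<in>G. ball (z u) b)"
  proof (rule measure_finite_Union[symmetric, OF G])
    show "disjoint_family_on (\<lambda>u. ball (z u) b) G"
      using disj by (auto simp: disjoint_family_on_def)
    show "emeasure lborel (ball (z u) b) \<noteq> \<infinity>" for u
      using emeasure_lborel_ball_finite[of "z u" b] by simp
  qed auto
  also have "\<dots> \<le> measure lborel (ball c R)"
  proof (rule measure_mono_fmeasurable)
    show "(\<Union>u\<in>G. ball (z u) b) \<subseteq> ball c R" using sub by (rule UN_least)
    show "(\<Union>u\<in>G. ball (z u) b) \<in> sets lborel" using G by (intro sets.finite_UN) auto
    show "ball c R \<in> fmeasurable lborel"
      by (rule fmeasurableI) (use emeasure_lborel_ball_finite[of c R] in auto)
  qed
  also have "\<dots> = unit_ball_vol (real DIM('v)) * R ^ DIM('v)" by (rule content_ball[OF R])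
  finally have "real (card G) * b ^ DIM('v) \<le> R ^ DIM('v)" using V by (simp add: mult_ac)
  then show ?thesis using b by (simp add: power_divide field_simps)
qed

context return_system
begin

text \<open>Words of \<open>F\<close> are nonempty, so the first \<open>Suc n\<close> of them
  already contain position \<open>n\<close>.\<close>

definition cat :: "(nat \<Rightarrow> 'a list) \<Rightarrow> nat \<Rightarrow> 'a" where
  "cat x n = concat (pre x (Suc n)) ! n"

lemma pre_set: "(\<And>i. x i \<in> F) \<Longrightarrow> set (pre x n) \<subseteq> F"
  by auto

lemma concat_pre_nth:
  assumes "k \<le> m" "i < length (concat (pre x k))"
  shows "concat (pre x m) ! i = concat (pre x k) ! i"
proof -
  have "[0..<m] = [0..<k] @ [k..<m]" using assms(1) by (metis le_Suc_ex upt_add_eq_append zero_le add_0)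
  then have "concat (pre x m) = concat (pre x k) @ concat (map x [k..<m])" by simp
  then show ?thesis using assms(2) by (simp only: nth_append) simp
qed

lemma pre_cat:
  assumes x: "\<And>i. x i \<in> F"
  shows "pre (cat x) (length (concat (pre x k))) = concat (pre x k)"
proof (rule nth_equalityI)
  fix i assume "i < length (pre (cat x) (length (concat (pre x k))))"
  then have i: "i < length (concat (pre x k))" by (simp only: length_map length_upt)
  have i': "i < length (concat (pre x (Suc i)))"
    using length_concat_F[OF pre_set[of x, OF x], of "Suc i"] by (simp only: length_map length_upt)
  have "concat (pre x (max k (Suc i))) ! i = concat (pre x k) ! i"
    by (rule concat_pre_nth[OF _ i]) simp
  moreover have "concat (pre x (max k (Suc i))) ! i = concat (pre x (Suc i)) ! i"
    by (rule concat_pre_nth[OF _ i']) simp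
  ultimately have "cat x i = concat (pre x k) ! i" unfolding cat_def by metis
  then show "pre (cat x) (length (concat (pre x k))) ! i = concat (pre x k) ! i" using i by simp
qed (simp only: length_map length_upt)

lemma pre_pattern_words:
  assumes "\<And>i. x i \<in> F" "\<And>i. x i = f0 \<or> i \<in> P"
  shows "pre x n \<in> Pw P 0 n"
  using assms by (auto simp: pattern_words_def)

lemma cat_in_pattern_shift:
  assumes x: "\<And>i. x i \<in> F" "\<And>i. x i = f0 \<or> i \<in> P"
  shows "cat x \<in> pattern_shift P"
  unfolding pattern_shift_def mem_Collect_eq
proof
  fix n
  let ?l = "length (concat (pre x n))"
  have "n \<le> ?l" using length_concat_F[OF pre_set[of x, OF x(1)], of n] by simp
  then have "[0..<?l] = [0..<n] @ [n..<?l]" by (metis le_Suc_ex upt_add_eq_append zero_le add_0)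
  then have "concat (pre x n) = [] @ pre (cat x) n @ map (cat x) [n..<?l]"
    using pre_cat[of x, OF x(1), of n] by (metis append_Nil map_append)
  moreover have "pre x n \<in> allowed P" using pre_pattern_words[of x, OF x] unfolding allowed_def by blast
  ultimately show "\<exists>ws\<in>allowed P. \<exists>u v. concat ws = u @ pre (cat x) n @ v" by blast
qed

lemma coding_cat:
  assumes x: "\<And>i. x i \<in> F" "\<And>i. x i = f0 \<or> i \<in> P" and "k \<noteq> 0"
  shows "coding_map K \<phi> (cat x) \<in> wm (concat (pre x k)) ` K a"
proof -
  have ad: "adm_seq (cat x)" by (rule pattern_shift_adm[OF cat_in_pattern_shift[of x, OF x]])
  have "pre x k \<noteq> []" using assms(3) by simp
  then have ne: "concat (pre x k) \<noteq> []" "last (concat (pre x k)) = a"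
    using concat_F[OF pre_set[of x, OF x(1)], of k] by auto
  obtain n where n: "length (concat (pre x k)) = Suc n" using ne(1) by (cases "concat (pre x k)") auto
  have eq: "pre (cat x) (Suc n) = concat (pre x k)" using pre_cat[of x, OF x(1), of k] unfolding n .
  have "cat x n = last (pre (cat x) (Suc n))" by simp
  then have "cat x n = a" unfolding eq ne(2) .
  then show ?thesis using coding_map_in[OF ad, of n] unfolding eq by simp
qed

text \<open>A nonempty remainder would end in \<open>a\<close> and raise the number of visits, which
  is the same for all words of \<open>F\<close>.\<close>

lemma F_not_prefix:
  assumes "e \<in> F" "e @ w \<in> F"
  shows "w = []"
proof (rule ccontr)
  assume w: "w \<noteq> []"
  then have "last w = a" using F_D(3)[OF assms(2)] by simp
  then have "a \<in> set w" using w by (metis last_in_set)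
  then have "count_list w a \<noteq> 0" by (simp add: count_list_0_iff)
  moreover have "count_list (e @ w) a = count_list e a" using F_D(5)[OF assms(1)] F_D(5)[OF assms(2)] by simp
  ultimately show False by simp
qed

text \<open>The comparison is made on two levels: the sequences differ first at some word of
  \<open>F\<close>, and since neither of these words is a prefix of the other, they differ first at
  some letter. There the open set condition applies.\<close>

lemma F_words_disjoint:
  assumes u: "set u \<subseteq> F" and v: "set v \<subseteq> F"
    and inc: "\<And>w. v \<noteq> u @ w" "\<And>w. u \<noteq> v @ w"
  shows "wm (concat u) ` interior (K a) \<inter> wm (concat v) ` interior (K a) = {}"
proof (cases rule: list_compare[of v u])
  case (3 p e f u' v')
  have ef: "e \<in> F" "f \<in> F" using 3 u v by auto
  show ?thesis
  proof (cases rule: list_compare[of f e])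
    case (1 w)
    then have "w = []" using F_not_prefix[of e w] ef by simp
    then show ?thesis using 1 3 by simp
  next
    case (2 w)
    then have "w = []" using F_not_prefix[of f w] ef by simp
    then show ?thesis using 2 3 by simp
  next
    case ef': (3 z c d e' f')
    let ?p = "concat p @ z" and ?u = "e' @ concat u'" and ?v = "f' @ concat v'"
    have cu: "concat u = ?p @ c # ?u" "concat v = ?p @ d # ?v"
      using 3 ef' by simp_all
    have ne: "u \<noteq> []" "v \<noteq> []" using 3 by auto
    have "adm (?p @ c # ?u)" "adm (?p @ d # ?v)"
      using concat_F[OF u] concat_F[OF v] unfolding cu by simp_all
    from wm_disjoint[OF this ef'(3)]
    have "wm (concat u) ` interior (K (last (c # ?u))) \<inter> wm (concat v) ` interior (K (last (d # ?v))) = {}"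
      unfolding cu .
    moreover have "last (c # ?u) = last (concat u)" "last (d # ?v) = last (concat v)"
      unfolding cu by simp_all
    moreover have "last (concat u) = a" "last (concat v) = a" using concat_F[OF u] concat_F[OF v] ne by auto
    ultimately show ?thesis by simp
  qed
qed (use inc in auto)

text \<open>Each image contains a ball of radius of order
  \<open>\<rho> powr (1 + \<epsilon>)\<close>, and all of them lie in one ball of radius of order
  \<open>\<rho> powr (1 - \<epsilon>)\<close>. The inner balls are disjoint, so comparing volumes
  gives the bound.\<close>

lemma card_words_near_ball:
  fixes \<epsilon> c1 :: real
  assumes \<epsilon>: "0 < \<epsilon>" "\<epsilon> \<le> 1" and c1: "0 < c1"
  obtains M where "0 < M" "\<And>c \<rho> G. 0 < \<rho> \<Longrightarrow> \<rho> \<le> 1 \<Longrightarrow> finite G \<Longrightarrow>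
    (\<And>u. u \<in> G \<Longrightarrow> set u \<subseteq> F \<and> u \<noteq> [] \<and> c1 * \<rho> \<le> q u \<and> q u \<le> \<rho> \<and> wm (concat u) ` K a \<inter> ball c \<rho> \<noteq> {}) \<Longrightarrow>
    (\<And>u v w. u \<in> G \<Longrightarrow> v \<in> G \<Longrightarrow> v = u @ w \<Longrightarrow> w = []) \<Longrightarrow>
    real (card G) \<le> M * \<rho> powr (- (2 * \<epsilon> * DIM('v)))"
proof -
  obtain D where D: "0 < D" "\<And>w. adm w \<Longrightarrow> w \<noteq> [] \<Longrightarrow> diameter (wm w ` K (last w)) \<le> D * r w powr (1 - \<epsilon>)"
    using diameter_wm_le[OF \<epsilon>(1)] by metis
  obtain c0 where c0: "0 < c0" "\<And>w. adm w \<Longrightarrow> w \<noteq> [] \<Longrightarrow>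
    ball (wm w (y (last w))) (c0 * r w powr (1 + \<epsilon>)) \<subseteq> wm w ` interior (K (last w))"
    using ball_in_wm[OF \<epsilon>(1)] by metis
  define C where "C = (1 + D) / (c0 * c1 powr (1 + \<epsilon>))"
  have C: "0 < C" using D(1) c0(1) c1 by (simp add: C_def add_pos_pos)
  show thesis
  proof (rule that[of "C ^ DIM('v)"])
    show "0 < C ^ DIM('v)" using C by simp
    fix c \<rho> G
    assume \<rho>: "0 < \<rho>" "\<rho> \<le> 1" and G: "finite G"
      and Gu: "\<And>u. u \<in> G \<Longrightarrow> set u \<subseteq> F \<and> u \<noteq> [] \<and> c1 * \<rho> \<le> q u \<and> q u \<le> \<rho> \<and> wm (concat u) ` K a \<inter> ball c \<rho> \<noteq> {}"
      and inc: "\<And>u v w. u \<in> G \<Longrightarrow> v \<in> G \<Longrightarrow> v = u @ w \<Longrightarrow> w = []"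
    define b where "b = c0 * (c1 * \<rho>) powr (1 + \<epsilon>)"
    define R where "R = (1 + D) * \<rho> powr (1 - \<epsilon>)"
    define z where "z u = wm (concat u) (y a)" for u
    have b: "0 < b" using c0 c1 \<rho> by (simp add: b_def)
    have R: "0 \<le> R" using D(1) by (simp add: R_def)
    have word: "adm (concat u)" "concat u \<noteq> []" "last (concat u) = a" "q u = r (concat u)" if "u \<in> G" for u
      using concat_F[of u] Gu[OF that] by (auto simp: q_def)
    have inner: "ball (z u) b \<subseteq> wm (concat u) ` interior (K a)" if u: "u \<in> G" for u
    proof -
      have "b \<le> c0 * r (concat u) powr (1 + \<epsilon>)"
        unfolding b_def using Gu[OF u] word(4)[OF u] c0(1) c1 \<rho> \<epsilon>
        by (intro mult_left_mono powr_mono2) auto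
      then have "ball (z u) b \<subseteq> ball (z u) (c0 * r (concat u) powr (1 + \<epsilon>))" by (rule subset_ball)
      then show ?thesis using c0(2)[OF word(1,2)[OF u]] unfolding word(3)[OF u] z_def by (rule order_trans)
    qed
    have outer: "wm (concat u) ` K a \<subseteq> ball c R" if u: "u \<in> G" for u
    proof
      fix p' assume p': "p' \<in> wm (concat u) ` K a"
      have "wm (concat u) ` K a \<inter> ball c \<rho> \<noteq> {}" using Gu[OF u] by (elim conjE)
      then obtain p where p: "p \<in> wm (concat u) ` K a" "p \<in> ball c \<rho>" by blast
      have bdd: "bounded (wm (concat u) ` K a)"
        using compact_wm[OF word(1,2)[OF u]] unfolding word(3)[OF u] by (rule compact_imp_bounded)
      have "dist p p' \<le> diameter (wm (concat u) ` K a)" by (rule diameter_bounded_bound[OF bdd p(1) p'])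
      also have "\<dots> \<le> D * r (concat u) powr (1 - \<epsilon>)" using D(2)[OF word(1,2)[OF u]] unfolding word(3)[OF u] .
      also have "\<dots> \<le> D * \<rho> powr (1 - \<epsilon>)"
        using Gu[OF u] word(4)[OF u] D(1) \<epsilon> r_pos[OF word(1,2)[OF u]]
        by (intro mult_left_mono powr_mono2) auto
      finally have "dist c p' < \<rho> + D * \<rho> powr (1 - \<epsilon>)"
        using p(2) dist_triangle[of c p' p] unfolding mem_ball by linarith
      moreover have "\<rho> \<le> \<rho> powr (1 - \<epsilon>)" using powr_mono'[of "1 - \<epsilon>" 1 \<rho>] \<rho> \<epsilon> by simp
      ultimately show "p' \<in> ball c R" unfolding R_def mem_ball distrib_right mult_1_left by linarith
    qed
    have "real (card G) \<le> (R / b) ^ DIM('v)"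
    proof (rule card_disjoint_balls_le[OF G b R])
      show "ball (z u) b \<subseteq> ball c R" if "u \<in> G" for u
        using inner[OF that] outer[OF that] interior_subset[of "K a"] by blast
      fix u v assume uv: "u \<in> G" "v \<in> G" "u \<noteq> v"
      have "wm (concat u) ` interior (K a) \<inter> wm (concat v) ` interior (K a) = {}"
      proof (rule F_words_disjoint)
        show "set u \<subseteq> F" "set v \<subseteq> F" using Gu uv by auto
        show "v \<noteq> u @ w" for w using inc[OF uv(1,2), of w] uv(3) by auto
        show "u \<noteq> v @ w" for w using inc[OF uv(2,1), of w] uv(3) by auto
      qed
      then show "ball (z u) b \<inter> ball (z v) b = {}" using inner[OF uv(1)] inner[OF uv(2)] by blast
    qed
    also have "R / b = C * \<rho> powr (- (2 * \<epsilon>))"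
    proof -
      have "\<rho> powr (1 - \<epsilon>) = \<rho> powr (- (2 * \<epsilon>)) * \<rho> powr (1 + \<epsilon>)"
        unfolding powr_add[symmetric] by (rule arg_cong[where f = "\<lambda>e. \<rho> powr e"]) simp
      then show ?thesis using c0 c1 \<rho> by (simp add: R_def b_def C_def powr_mult)
    qed
    also have "(C * \<rho> powr (- (2 * \<epsilon>))) ^ DIM('v) = C ^ DIM('v) * \<rho> powr (- (2 * \<epsilon> * DIM('v)))"
      using \<rho>(1) by (simp add: power_mult_distrib powr_realpow[symmetric] powr_powr)
    finally show "real (card G) \<le> C ^ DIM('v) * \<rho> powr (- (2 * \<epsilon> * DIM('v)))" .
  qed
qed

text \<open>A word stopped when its weight first drops to a given size overshoots by at most this
  factor.\<close>

lemma q_snoc: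
  obtains c1 where "0 < c1" "\<And>ws f. set ws \<subseteq> F \<Longrightarrow> f \<in> F \<Longrightarrow> c1 * q ws \<le> q (ws @ [f])"
proof -
  define m where "m = Min ((\<lambda>f. q [f]) ` F)"
  have "m \<in> (\<lambda>f. q [f]) ` F" unfolding m_def using finF f0_in by (intro Min_in) auto
  then have m: "0 < m" using q_pos by auto
  have m_le: "m \<le> q [f]" if "f \<in> F" for f unfolding m_def using finF that by (intro Min_le) auto
  have k: "0 < \<kappa>" using kappa_ge by linarith
  show thesis
  proof (rule that[of "m / \<kappa>"])
    show "0 < m / \<kappa>" using m k by simp
    fix ws f assume ws: "set ws \<subseteq> F" "f \<in> F"
    have "m * q ws \<le> q [f] * q ws" using m_le[OF ws(2)] q_pos[OF ws(1)] by (intro mult_right_mono) auto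
    also have "\<dots> \<le> \<kappa> * q (ws @ [f])" using q_append_ge[of ws "[f]"] ws by (simp add: mult.commute)
    finally show "m / \<kappa> * q ws \<le> q (ws @ [f])" using k by (simp add: field_simps)
  qed
qed

text \<open>A cover by balls of small total weight is turned into a finite bar of stopped words.
  Packing bounds the number of words per ball, so their total weight is small, against the lower
  bound for any bar.\<close>

lemma pattern_shift_dim_ge:
  assumes \<tau>: "0 < \<tau>" "\<tau> < t"
    and bal: "\<And>\<epsilon>::real. 0 < \<epsilon> \<Longrightarrow> \<exists>C>0. \<forall>n. 1 \<le> C * exp (\<epsilon> * real n) * (\<Sum>ws\<in>Pw P 0 n. q ws powr t)"
  shows "hausdorff_measure \<tau> (JP P) \<noteq> 0"
proof
  assume null: "hausdorff_measure \<tau> (JP P) = 0"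
  \<comment> \<open>The gap up to \<open>t\<close> absorbs the subexponential loss in the partition
    function; the gap down to \<open>\<tau>\<close> pays for the packing factor with exponent
    \<open>2 * \<epsilon> * d\<close>.\<close>
  define \<tau>' where "\<tau>' = (\<tau> + t) / 2"
  have \<tau>': "\<tau> < \<tau>'" "\<tau>' < t" "0 < \<tau>'" using \<tau> by (auto simp: \<tau>'_def)
  define d where "d = real DIM('v)"
  have d: "0 < d" by (simp add: d_def)
  define \<epsilon> where "\<epsilon> = min 1 ((\<tau>' - \<tau>) / (2 * d))"
  have \<epsilon>: "0 < \<epsilon>" "\<epsilon> \<le> 1" using \<tau>' d by (auto simp: \<epsilon>_def)
  have \<epsilon>d: "2 * \<epsilon> * d \<le> \<tau>' - \<tau>"
  proof -
    have "\<epsilon> \<le> (\<tau>' - \<tau>) / (2 * d)" by (simp add: \<epsilon>_def)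
    then show ?thesis using d by (simp add: field_simps)
  qed
  obtain c1 where c1: "0 < c1" "\<And>ws f. set ws \<subseteq> F \<Longrightarrow> f \<in> F \<Longrightarrow> c1 * q ws \<le> q (ws @ [f])"
    using q_snoc by metis
  interpret Q: quasi_multiplicative F f0 "\<lambda>ws. q ws powr \<tau>'" "\<kappa> powr \<tau>'"
    by (rule quasi_multiplicative_powr[OF \<tau>'(3)])
  \<comment> \<open>Lowering the exponent by \<open>b\<close> raises the weight of every word of
    length \<open>n\<close> by at least a constant times \<open>(\<theta> ^ n) powr (- b)\<close>,
    which exactly cancels the allowed loss.\<close>
  have "\<exists>c2>0. \<forall>n. c2 \<le> Q.Zs P 0 n"
  proof -
    define b where "b = t - \<tau>'"
    have b: "0 < b" using \<tau>' by (simp add: b_def)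
    then have "0 < b * ln (1 / \<theta>)" using ln_theta by simp
    from bal[OF this] obtain C where C: "0 < C"
      "\<And>n. 1 \<le> C * exp (b * ln (1 / \<theta>) * real n) * (\<Sum>ws\<in>Pw P 0 n. q ws powr t)" by blast
    have "1 / (C * C0 powr b) \<le> Q.Zs P 0 n" for n
    proof -
      have "(\<Sum>ws\<in>Pw P 0 n. q ws powr t) \<le>
          (\<Sum>ws\<in>Pw P 0 n. (C0 powr b * (\<theta> ^ n) powr b) * q ws powr \<tau>')"
      proof (rule sum_mono)
        fix ws assume "ws \<in> Pw P 0 n"
        then have ws: "set ws \<subseteq> F" "length ws = n" by (auto simp: pattern_words_def)
        have "q ws powr t = q ws powr b * q ws powr \<tau>'" by (simp add: b_def powr_add[symmetric])
        also have "q ws powr b \<le> (C0 * \<theta> ^ n) powr b"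
          using q_decay[OF ws(1)] q_pos[OF ws(1)] b ws(2) by (intro powr_mono2) auto
        also have "\<dots> = C0 powr b * (\<theta> ^ n) powr b" using C0(1) theta by (simp add: powr_mult)
        finally show "q ws powr t \<le> (C0 powr b * (\<theta> ^ n) powr b) * q ws powr \<tau>'"
          by (simp add: mult_right_mono)
      qed
      also have "\<dots> = (C0 powr b * (\<theta> ^ n) powr b) * Q.Zs P 0 n" by (simp add: Q.Zs_def sum_distrib_left)
      finally have "C * exp (b * ln (1 / \<theta>) * real n) * (\<Sum>ws\<in>Pw P 0 n. q ws powr t) \<le>
          C * exp (b * ln (1 / \<theta>) * real n) * ((C0 powr b * (\<theta> ^ n) powr b) * Q.Zs P 0 n)"
        using C(1) by (intro mult_left_mono) auto
      with C(2)[of n] have "1 \<le> C * exp (b * ln (1 / \<theta>) * real n) * ((C0 powr b * (\<theta> ^ n) powr b) * Q.Zs P 0 n)"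
        by (rule order_trans)
      also have "\<dots> = C * C0 powr b * Q.Zs P 0 n"
        unfolding exp_ln_theta using theta by (simp add: powr_minus)
      finally have "1 \<le> Q.Zs P 0 n * (C * C0 powr b)" by (simp add: mult_ac)
      then show ?thesis using C(1) C0(1) by (subst pos_divide_le_eq) auto
    qed
    moreover have "0 < 1 / (C * C0 powr b)" using C(1) C0(1) by simp
    ultimately show ?thesis by blast
  qed
  then obtain c2 where c2: "0 < c2" "\<And>n. c2 \<le> Q.Zs P 0 n" by blast
  obtain M where M: "0 < M" and cnt: "\<And>c \<rho> G. 0 < \<rho> \<Longrightarrow> \<rho> \<le> 1 \<Longrightarrow> finite G \<Longrightarrow>
    (\<And>u. u \<in> G \<Longrightarrow> set u \<subseteq> F \<and> u \<noteq> [] \<and> c1 * \<rho> \<le> q u \<and> q u \<le> \<rho> \<and> wm (concat u) ` K a \<inter> ball c \<rho> \<noteq> {}) \<Longrightarrow>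
    (\<And>u v w. u \<in> G \<Longrightarrow> v \<in> G \<Longrightarrow> v = u @ w \<Longrightarrow> w = []) \<Longrightarrow>
    real (card G) \<le> M * \<rho> powr (- (2 * \<epsilon> * DIM('v)))"
    using card_words_near_ball[OF \<epsilon> c1(1)] by metis
  define k2 where "k2 = (\<kappa> powr \<tau>') ^ 2"
  have k2: "0 < k2" using kappa_ge by (simp add: k2_def)
  \<comment> \<open>The entry \<open>1 / 2\<close> forces all radii below \<open>1\<close>, so that
    the empty word is never stopped; the other one contradicts the lower bound \<open>c2\<close> at
    the end.\<close>
  define \<eta> where "\<eta> = min (1 / 2) (c2 / (2 * k2 * M))"
  have \<eta>: "0 < \<eta>" "\<eta> < 1" using c2(1) k2 M by (auto simp: \<eta>_def)
  have \<eta>c: "k2 * (M * \<eta>) < c2"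
  proof -
    have "\<eta> \<le> c2 / (2 * k2 * M)" by (simp add: \<eta>_def)
    then have "2 * (k2 * (M * \<eta>)) \<le> c2" using k2 M by (simp add: field_simps)
    then show ?thesis using c2(1) by linarith
  qed
  from hausdorff_measure_zeroD[OF \<tau>(1) null \<eta>(1)] obtain c :: "nat \<Rightarrow> 'v" and \<delta> where
    \<delta>: "\<forall>i. 0 < \<delta> i" and cov: "JP P \<subseteq> (\<Union>i. ball (c i) (\<delta> i))"
    and sm: "\<forall>N. (\<Sum>i<N. \<delta> i powr \<tau>) \<le> \<eta>" by (elim exE conjE)
  have \<delta>1: "\<delta> i < 1" for i
  proof (rule ccontr)
    assume "\<not> ?thesis"
    then have "1 \<le> \<delta> i powr \<tau>" using \<tau> by (simp add: ge_one_powr_ge_zero)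
    also have "\<dots> \<le> (\<Sum>j<Suc i. \<delta> j powr \<tau>)" by (rule member_le_sum) auto
    also have "\<dots> \<le> \<eta>" using sm by blast
    finally show False using \<eta>(2) by simp
  qed
  \<comment> \<open>The words whose weight first drops to the radius of the \<open>i\<close>-th ball
    and whose image meets it. Minimality makes \<open>H i\<close> prefix-free, and the factor
    \<open>c1\<close> keeps all weights comparable to the radius.\<close>
  define H where "H i = {u. u \<noteq> [] \<and> u \<in> Pw P 0 (length u) \<and> q u \<le> \<delta> i \<and> c1 * \<delta> i \<le> q u \<and>
      (\<forall>j<length u. \<delta> i < q (take j u)) \<and> wm (concat u) ` K a \<inter> ball (c i) (\<delta> i) \<noteq> {}}" for i
  define G where "G = (\<Union>i. H i)"
  have bar: "\<exists>n. map x [0..<n] \<in> G" if x: "\<And>i. x i \<in> F" "\<And>i. x i = f0 \<or> i \<in> P" for x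
  proof -
    have "coding_map K \<phi> (cat x) \<in> JP P"
      using cat_in_pattern_shift[of x, OF x] by blast
    then obtain i where i: "coding_map K \<phi> (cat x) \<in> ball (c i) (\<delta> i)" using cov by blast
    define small where "small n \<longleftrightarrow> q (pre x n) \<le> \<delta> i" for n
    have "\<exists>n. small n"
    proof -
      have "0 < \<delta> i / C0" using \<delta> C0(1) by (intro divide_pos_pos) auto
      then obtain n where n: "\<theta> ^ n < \<delta> i / C0" using real_arch_pow_inv theta(2) by blast
      have "q (pre x n) \<le> C0 * \<theta> ^ n" using q_decay[OF pre_set[of x, OF x(1)], of n] by simp
      also have "\<dots> \<le> \<delta> i" using n C0(1) by (simp add: field_simps)
      finally show ?thesis unfolding small_def by blast
    qed
    define n where "n = (LEAST n. small n)"
    have n: "small n" using LeastI_ex[OF \<open>\<exists>n. small n\<close>] by (simp add: n_def)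
    have nj: "\<not> small j" if "j < n" for j using not_less_Least[of j small] that by (simp add: n_def)
    have "n \<noteq> 0" using n \<delta>1[of i] by (cases n) (auto simp: small_def q_def)
    then obtain n' where n': "n = Suc n'" by (cases n) auto
    have "pre x n \<in> H i"
      unfolding H_def mem_Collect_eq
    proof (intro conjI allI impI)
      show "pre x n \<noteq> []" using \<open>n \<noteq> 0\<close> by simp
      show "pre x n \<in> Pw P 0 (length (pre x n))" using pre_pattern_words[of x, OF x, of n] by simp
      show "q (pre x n) \<le> \<delta> i" using n by (simp add: small_def)
      have "\<delta> i \<le> q (pre x n')" using nj[of n'] by (simp add: n' small_def)
      then have "c1 * \<delta> i \<le> c1 * q (pre x n')" using c1(1) by (intro mult_left_mono) auto
      also have "\<dots> \<le> q (pre x n)" using c1(2)[OF pre_set[of x, OF x(1)] x(1)] by (simp add: n')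
      finally show "c1 * \<delta> i \<le> q (pre x n)" .
      show "\<delta> i < q (take j (pre x n))" if "j < length (pre x n)" for j
        using nj[of j] that by (simp add: small_def take_map min_def)
      show "wm (concat (pre x n)) ` K a \<inter> ball (c i) (\<delta> i) \<noteq> {}"
        using coding_cat[of x, OF x \<open>n \<noteq> 0\<close>] i by blast
    qed
    then show ?thesis unfolding G_def by blast
  qed
  obtain N where N: "\<forall>ws\<in>Pw P 0 N. \<exists>n\<le>N. take n ws \<in> G"
    using pattern_words_bar[OF finF bar] by blast
  define G' where "G' = {u \<in> G. length u \<le> N}"
  have GF: "u \<in> Pw P 0 (length u)" if "u \<in> G" for u
    using that by (auto simp: G_def H_def)
  have finG': "finite G'"
    by (rule finite_subset[OF _ finite_lists_length_le[OF finF, of N]])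
      (use GF in \<open>auto simp: G'_def pattern_words_def\<close>)
  have "c2 \<le> (\<kappa> powr \<tau>') ^ 2 * (\<Sum>u\<in>G'. q u powr \<tau>')"
  proof (rule Q.pattern_words_cover_bound[OF finG' _ _ c2])
    show "length u \<le> N \<and> u \<in> Pw P 0 (length u)" if "u \<in> G'" for u
      using that GF by (auto simp: G'_def)
    show "\<exists>n\<le>N. take n ws \<in> G'" if "ws \<in> Pw P 0 N" for ws
      using N that by (fastforce simp: G'_def)
  qed
  also have "(\<Sum>u\<in>G'. q u powr \<tau>') \<le> M * \<eta>"
  proof -
    have "\<forall>u\<in>G'. \<exists>i. u \<in> H i" by (auto simp: G'_def G_def)
    then obtain idx where idx: "\<And>u. u \<in> G' \<Longrightarrow> u \<in> H (idx u)" by metis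
    obtain n0 where n0: "idx ` G' \<subseteq> {..<n0}"
      using finite_imageI[OF finG', of idx] unfolding finite_nat_iff_bounded by (elim exE)
    define S where "S i = H i \<inter> G'" for i
    have "(\<Sum>u\<in>G'. q u powr \<tau>') \<le> (\<Sum>i<n0. \<Sum>u\<in>S i. q u powr \<tau>')"
    proof (rule sum_le_sum_UN)
      show "finite (S i)" for i using finG' by (simp add: S_def)
      show "G' \<subseteq> (\<Union>i\<in>{..<n0}. S i)" using idx n0 by (auto simp: S_def)
    qed auto
    also have "\<dots> \<le> (\<Sum>i<n0. M * \<delta> i powr \<tau>)"
    proof (rule sum_mono)
      fix i
      have "real (card (S i)) \<le> M * \<delta> i powr (- (2 * \<epsilon> * DIM('v)))"
      proof (rule cnt)
        show "0 < \<delta> i" "\<delta> i \<le> 1" using \<delta> \<delta>1[of i] by auto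
        show "finite (S i)" using finG' by (simp add: S_def)
        show "set u \<subseteq> F \<and> u \<noteq> [] \<and> c1 * \<delta> i \<le> q u \<and> q u \<le> \<delta> i \<and> wm (concat u) ` K a \<inter> ball (c i) (\<delta> i) \<noteq> {}"
          if "u \<in> S i" for u using that by (auto simp: S_def H_def pattern_words_def)
        fix u v w assume uv: "u \<in> S i" "v \<in> S i" "v = u @ w"
        show "w = []"
        proof (rule ccontr)
          assume "w \<noteq> []"
          then have "length u < length v" using uv(3) by simp
          moreover have "\<forall>j<length v. \<delta> i < q (take j v)" using uv(2) by (simp add: S_def H_def)
          ultimately have "\<delta> i < q (take (length u) v)" by blast
          then have "\<delta> i < q u" using uv(3) by simp
          moreover have "q u \<le> \<delta> i" using uv(1) by (simp add: S_def H_def)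
          ultimately show False by simp
        qed
      qed
      then have card: "real (card (S i)) \<le> M * \<delta> i powr (- (2 * \<epsilon> * d))" by (simp add: d_def)
      have "(\<Sum>u\<in>S i. q u powr \<tau>') \<le> (\<Sum>u\<in>S i. \<delta> i powr \<tau>')"
      proof (rule sum_mono)
        fix u assume "u \<in> S i"
        then have "q u \<le> \<delta> i" "set u \<subseteq> F" by (auto simp: S_def H_def pattern_words_def)
        then show "q u powr \<tau>' \<le> \<delta> i powr \<tau>'" using q_pos[of u] \<tau>'(3) by (intro powr_mono2) auto
      qed
      also have "\<dots> = real (card (S i)) * \<delta> i powr \<tau>'" by simp
      also have "\<dots> \<le> M * \<delta> i powr (- (2 * \<epsilon> * d)) * \<delta> i powr \<tau>'" using card by (intro mult_right_mono) auto
      also have "\<dots> = M * \<delta> i powr (\<tau>' - 2 * \<epsilon> * d)" by (simp add: powr_add[symmetric])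
      also have "\<dots> \<le> M * \<delta> i powr \<tau>"
        using M \<epsilon>d \<delta> less_imp_le[OF \<delta>1[of i]] by (intro mult_left_mono powr_mono') (auto intro: less_imp_le)
      finally show "(\<Sum>u\<in>S i. q u powr \<tau>') \<le> M * \<delta> i powr \<tau>" .
    qed
    also have "\<dots> = M * (\<Sum>i<n0. \<delta> i powr \<tau>)" by (simp add: sum_distrib_left)
    also have "\<dots> \<le> M * \<eta>" using sm M by (intro mult_left_mono) auto
    finally show ?thesis .
  qed
  finally have "c2 \<le> k2 * (M * \<eta>)" using k2 by (simp add: k2_def)
  then show False using \<eta>c by simp
qed

lemma exists_pattern_shift_dim:
  assumes t: "0 < t" and big: "\<kappa> powr t \<le> (\<Sum>f\<in>F. r f powr t)"
  shows "\<exists>P. hausdorff_dim (JP P) = ennreal t"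
proof -
  interpret Q: quasi_multiplicative F f0 "\<lambda>ws. q ws powr t" "\<kappa> powr t"
    by (rule quasi_multiplicative_powr[OF t])
  have k: "0 < \<kappa>" using kappa_ge by linarith
  have big': "\<kappa> powr t \<le> (\<Sum>f\<in>F. q [f] powr t)" using big by (simp add: q_def)
  \<comment> \<open>Repeating \<open>f0\<close> often enough makes the weight smaller than
    \<open>1 / \<kappa>\<close>, so the fully forced pattern decays.\<close>
  have "0 < 1 / (\<kappa> * C0)" using k C0(1) by simp
  then obtain n where n: "\<theta> ^ n < 1 / (\<kappa> * C0)" using real_arch_pow_inv theta(2) by blast
  define u where "u = replicate n f0"
  have u: "set u \<subseteq> F" "length u = n" using f0_in by (auto simp: u_def)
  have "\<kappa> * q u \<le> \<kappa> * (C0 * \<theta> ^ n)" using q_decay[OF u(1)] k u(2) by (intro mult_left_mono) auto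
  also have "\<dots> < 1" using n k C0(1) by (simp add: field_simps)
  finally have "(\<kappa> * q u) powr t < 1"
    using powr_less_mono2[of t "\<kappa> * q u" 1] t k q_pos[OF u(1)] by simp
  then have small: "\<kappa> powr t * q (replicate n f0) powr t < 1"
    using k q_pos[OF u(1)] by (simp add: powr_mult u_def)
  obtain P where P: "\<forall>\<epsilon>::real. 0 < \<epsilon> \<longrightarrow> (\<exists>C>0. \<exists>U l. 0 < l \<and> P \<subseteq> U \<and> periodic U l \<and>
    (\<forall>m n. Q.Zs U m n \<le> C * exp (\<epsilon> * real n)) \<and> (\<forall>n. 1 \<le> C * exp (\<epsilon> * real n) * Q.Zs P 0 n))"
    using Q.balanced_pattern[OF big' small] by (elim exE)
  have "hausdorff_dim (JP P) \<le> ennreal t"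
  proof (rule hausdorff_dim_le)
    show "0 \<le> t" using t by simp
    fix \<tau> assume "t < \<tau>"
    then show "hausdorff_measure \<tau> (JP P) = 0"
      by (rule pattern_shift_dim_le[OF t]) (use P in \<open>unfold Q.Zs_def, meson\<close>)
  qed
  moreover have "ennreal t \<le> hausdorff_dim (JP P)"
  proof (rule hausdorff_dim_ge)
    fix \<tau> assume "0 < \<tau>" "\<tau> < t"
    then show "hausdorff_measure \<tau> (JP P) \<noteq> 0"
      by (rule pattern_shift_dim_ge) (use P in \<open>unfold Q.Zs_def, meson\<close>)
  qed
  ultimately show ?thesis by (intro exI[of _ P] antisym)
qed

end

context metric_gdms
begin

lemma exists_subshift_dim:
  assumes t: "0 < t" "ennreal t < hausdorff_dim (limit_set K \<phi> {\<omega>. adm_seq \<omega>})"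
  shows "\<exists>X. X \<subseteq> {\<omega>. adm_seq \<omega>} \<and> subshift A X \<and> hausdorff_dim (limit_set K \<phi> X) = ennreal t"
proof -
  have "\<exists>\<tau>>t. hausdorff_measure \<tau> (coding_map K \<phi> ` {\<omega>. adm_seq \<omega>}) \<noteq> 0"
  proof (rule ccontr)
    assume "\<not> ?thesis"
    then have "hausdorff_dim (coding_map K \<phi> ` {\<omega>. adm_seq \<omega>}) \<le> ennreal t"
      by (intro hausdorff_dim_le) (use t in auto)
    then show False using t(2) unfolding limit_set_def by (simp add: not_le[symmetric])
  qed
  then obtain \<tau> where \<tau>: "t < \<tau>" "hausdorff_measure \<tau> (coding_map K \<phi> ` {\<omega>. adm_seq \<omega>}) \<noteq> 0" by blast
  \<comment> \<open>The threshold \<open>\<kappa> powr t\<close> is what the full pattern must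
    exceed to count as high in the bisection at exponent \<open>t\<close>.\<close>
  obtain a k0 F where F: "a \<in> A" "F \<subseteq> returns a (Suc k0)" "finite F" "\<kappa> powr t < (\<Sum>u\<in>F. r u powr t)"
    using exists_large_returns[OF t(1) \<tau>] by blast
  have "F \<noteq> {}"
  proof
    assume "F = {}"
    then show False using F(4) powr_ge_zero[of \<kappa> t] by simp
  qed
  then obtain f0 where f0: "f0 \<in> F" by blast
  interpret R: return_system A T K \<phi> g y s L \<alpha> \<rho> Dm gmin gmax a k0 F f0
    by unfold_locales (use F f0 in auto)
  obtain P where P: "hausdorff_dim (coding_map K \<phi> ` R.pattern_shift P) = ennreal t"
    using R.exists_pattern_shift_dim[OF t(1) less_imp_le[OF F(4)]] by blast
  show ?thesis
  proof (intro exI conjI)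
    show "R.pattern_shift P \<subseteq> {\<omega>. adm_seq \<omega>}" using R.pattern_shift_adm by blast
    show "subshift A (R.pattern_shift P)" by (rule R.subshift_pattern_shift)
    show "hausdorff_dim (limit_set K \<phi> (R.pattern_shift P)) = ennreal t"
      using P by (simp add: limit_set_def)
  qed
qed

end

section \<open>Conformal systems\<close>

lemma onorm_similarity:
  fixes h :: "'v::euclidean_space \<Rightarrow> 'v"
  assumes h: "\<And>v. norm (h v) = b * norm v" and b: "0 \<le> b"
  shows "onorm h = b"
proof (rule antisym)
  show "onorm h \<le> b" by (rule onorm_le) (simp add: h)
  obtain u :: 'v where u: "norm u = 1" using vector_choose_size[of 1] by auto
  have "norm (h x) / norm x \<le> b" for x using b by (cases "x = 0") (simp_all add: h)
  then have "bdd_above (range (\<lambda>x. norm (h x) / norm x))" by (intro bdd_aboveI2)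
  then have "norm (h u) / norm u \<le> onorm h" unfolding onorm_def by (rule cSUP_upper2) auto
  then show "b \<le> onorm h" by (simp add: h u)
qed

lemma conformal_at_deriv_norm:
  fixes f :: "'v::euclidean_space \<Rightarrow> 'v"
  assumes "conformal_at f x"
  shows "0 < deriv_norm f x"
    and "norm (frechet_derivative f (at x) v) = deriv_norm f x * norm v"
    and "onorm (inv (frechet_derivative f (at x))) = 1 / deriv_norm f x"
proof -
  obtain c S where c: "0 < c" "orthogonal_transformation S" "(f has_derivative (\<lambda>v. c *\<^sub>R S v)) (at x)"
    using assms by (auto simp: conformal_at_def)
  define D where "D = frechet_derivative f (at x)"
  have D: "D v = c *\<^sub>R S v" for v using frechet_derivative_at[OF c(3), symmetric] by (simp add: D_def)
  have nD: "norm (D v) = c * norm v" for v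
    using c(1) orthogonal_transformation_norm[OF c(2)] by (simp add: D)
  have dn: "deriv_norm f x = c" unfolding deriv_norm_def D_def[symmetric]
    by (rule onorm_similarity) (use nD c(1) in auto)
  show "0 < deriv_norm f x" using dn c(1) by simp
  show "norm (frechet_derivative f (at x) v) = deriv_norm f x * norm v"
    using nD by (simp add: dn D_def)
  have "D (inv S ((1 / c) *\<^sub>R w)) = w" for w
    using c(1) surj_f_inv_f[OF orthogonal_transformation_surj[OF c(2)]] by (simp add: D)
  then have surj: "surj D" by (rule surjI)
  have "norm (inv D w) = 1 / c * norm w" for w
    using nD[of "inv D w"] surj_f_inv_f[OF surj, of w] c(1) by (simp add: field_simps)
  then have "onorm (inv D) = 1 / c" using c(1) by (intro onorm_similarity) auto
  then show "onorm (inv (frechet_derivative f (at x))) = 1 / deriv_norm f x" by (simp add: dn D_def)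
qed

lemma C1_on_deriv_norm:
  fixes f :: "'v::euclidean_space \<Rightarrow> 'v"
  assumes "C1_on W f"
  obtains f' :: "'v \<Rightarrow> 'v \<Rightarrow>\<^sub>L 'v" where "\<And>x. x \<in> W \<Longrightarrow> (f has_derivative blinfun_apply (f' x)) (at x)"
    "continuous_on W f'" "\<And>x. x \<in> W \<Longrightarrow> deriv_norm f x = norm (f' x)"
    "\<And>x. x \<in> W \<Longrightarrow> frechet_derivative f (at x) = blinfun_apply (f' x)"
proof -
  obtain f' :: "'v \<Rightarrow> 'v \<Rightarrow>\<^sub>L 'v" where f': "\<And>x. x \<in> W \<Longrightarrow> (f has_derivative blinfun_apply (f' x)) (at x)"
    "continuous_on W f'" using assms by (auto simp: C1_on_def)
  have *: "frechet_derivative f (at x) = blinfun_apply (f' x)" if "x \<in> W" for x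
    using frechet_derivative_at[OF f'(1)[OF that]] by simp
  show thesis by (rule that[OF f']) (simp_all add: * deriv_norm_def norm_blinfun.rep_eq)
qed

text \<open>The set \<open>S\<close> need not be convex, so segments between its points may leave
  it. A Lebesgue number provides a uniform radius at which they stay in balls inside
  \<open>W\<close> on which the derivative varies by at most \<open>\<eta>\<close>, and
  linearisation applies there.\<close>

lemma C1_conformal_linear_approx:
  fixes f :: "'v::euclidean_space \<Rightarrow> 'v"
  assumes W: "open W" and C1: "C1_on W f" and conf: "\<And>x. x \<in> W \<Longrightarrow> conformal_at f x"
    and S: "compact S" "S \<subseteq> W" and \<eta>: "0 < \<eta>"
  shows "\<exists>\<delta>>0. \<forall>x\<in>S. \<forall>z\<in>S. dist x z \<le> \<delta> \<longrightarrow>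
    \<bar>dist (f x) (f z) - deriv_norm f x * dist x z\<bar> \<le> \<eta> * dist x z"
proof -
  obtain f' :: "'v \<Rightarrow> 'v \<Rightarrow>\<^sub>L 'v" where f': "\<And>x. x \<in> W \<Longrightarrow> (f has_derivative blinfun_apply (f' x)) (at x)"
    "continuous_on W f'" "\<And>x. x \<in> W \<Longrightarrow> deriv_norm f x = norm (f' x)"
    "\<And>x. x \<in> W \<Longrightarrow> frechet_derivative f (at x) = blinfun_apply (f' x)"
    using C1_on_deriv_norm[OF C1] by metis
  have "\<exists>d>0. ball x d \<subseteq> W \<and> (\<forall>z\<in>ball x d. norm (f' z - f' x) \<le> \<eta> / 2)" if "x \<in> S" for x
  proof -
    have xW: "x \<in> W" using that S by blast
    obtain d1 where d1: "0 < d1" "ball x d1 \<subseteq> W" using W xW by (meson open_contains_ball)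
    have "0 < \<eta> / 2" using \<eta> by simp
    then obtain d2 where d2: "0 < d2" "\<And>z. z \<in> W \<Longrightarrow> dist z x < d2 \<Longrightarrow> dist (f' z) (f' x) < \<eta> / 2"
      using f'(2) xW unfolding continuous_on_iff by meson
    show ?thesis
    proof (intro exI[of _ "min d1 d2"] conjI ballI)
      show "0 < min d1 d2" using d1 d2 by simp
      show "ball x (min d1 d2) \<subseteq> W" using d1(2) by (auto simp: subset_iff)
      fix z assume z: "z \<in> ball x (min d1 d2)"
      then have "z \<in> W" "dist z x < d2" using d1(2) by (auto simp: dist_commute subset_iff)
      then show "norm (f' z - f' x) \<le> \<eta> / 2" using d2(2) by (fastforce simp: dist_norm)
    qed
  qed
  then obtain d where d: "\<And>x. x \<in> S \<Longrightarrow> 0 < d x" "\<And>x. x \<in> S \<Longrightarrow> ball x (d x) \<subseteq> W"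
    "\<And>x z. x \<in> S \<Longrightarrow> z \<in> ball x (d x) \<Longrightarrow> norm (f' z - f' x) \<le> \<eta> / 2" by metis
  obtain \<epsilon> where \<epsilon>: "0 < \<epsilon>" "\<And>x. x \<in> S \<Longrightarrow> \<exists>G\<in>(\<lambda>x. ball x (d x)) ` S. ball x \<epsilon> \<subseteq> G"
  proof (rule Heine_Borel_lemma[OF S(1)])
    show "S \<subseteq> \<Union> ((\<lambda>x. ball x (d x)) ` S)" using d(1) by (auto intro!: bexI)
  qed auto
  show ?thesis
  proof (intro exI[of _ "\<epsilon> / 2"] conjI ballI impI)
    show "0 < \<epsilon> / 2" using \<epsilon> by simp
    fix x z assume x: "x \<in> S" and z: "z \<in> S" "dist x z \<le> \<epsilon> / 2"
    obtain x0 where x0: "x0 \<in> S" "ball x \<epsilon> \<subseteq> ball x0 (d x0)" using \<epsilon>(2)[OF x] by blast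
    have near: "norm (f' u - f' x) \<le> \<eta>" if "u \<in> ball x \<epsilon>" for u
    proof -
      have "norm (f' u - f' x0) \<le> \<eta> / 2" "norm (f' x - f' x0) \<le> \<eta> / 2"
        using d(3)[OF x0(1)] subsetD[OF x0(2), of u] subsetD[OF x0(2), of x] that \<epsilon>(1) by simp_all
      then show ?thesis using norm_triangle_ineq4[of "f' u - f' x0" "f' x - f' x0"] by simp
    qed
    have inW: "u \<in> W" if "u \<in> ball x \<epsilon>" for u using that x0 d(2) by blast
    have zb: "z \<in> ball x \<epsilon>" using z \<epsilon>(1) by simp
    have "norm (f z - f x - blinfun_apply (f' x) (z - x)) \<le> norm (z - x) * \<eta>"
    proof (rule differentiable_bound_linearization[where S = "ball x \<epsilon>" and
          f' = "\<lambda>u. blinfun_apply (f' u)" and ?x0.0 = x])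
      fix t :: real assume t: "t \<in> {0..1}"
      have "x + t *\<^sub>R (z - x) = (1 - t) *\<^sub>R x + t *\<^sub>R z" by (simp add: algebra_simps)
      then show "x + t *\<^sub>R (z - x) \<in> ball x \<epsilon>"
        using convexD[OF convex_ball, of x x \<epsilon> z "1 - t" t] zb \<epsilon>(1) t by simp
    next
      show "(f has_derivative blinfun_apply (f' u)) (at u within ball x \<epsilon>)" if "u \<in> ball x \<epsilon>" for u
        using f'(1)[OF inW[OF that]] by (rule has_derivative_at_withinI)
      show "onorm (blinfun_apply (f' u) - blinfun_apply (f' x)) \<le> \<eta>" if "u \<in> ball x \<epsilon>" for u
        using near[OF that] by (simp add: norm_blinfun.rep_eq minus_blinfun.rep_eq fun_diff_def)
    qed (use \<epsilon>(1) in simp)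
    moreover have "norm (blinfun_apply (f' x) (z - x)) = deriv_norm f x * norm (z - x)"
    proof -
      have "x \<in> W" using x S(2) by blast
      then show ?thesis
        using conformal_at_deriv_norm(2)[OF conf, of x "z - x"] f'(4)[of x] by simp
    qed
    moreover have "\<bar>norm (f z - f x) - norm (blinfun_apply (f' x) (z - x))\<bar> \<le>
        norm (f z - f x - blinfun_apply (f' x) (z - x))" by (rule norm_triangle_ineq3)
    ultimately show "\<bar>dist (f x) (f z) - deriv_norm f x * dist x z\<bar> \<le> \<eta> * dist x z"
      by (simp add: dist_norm norm_minus_commute mult.commute)
  qed
qed

lemma continuous_on_deriv_norm:
  fixes f :: "'v::euclidean_space \<Rightarrow> 'v"
  assumes "C1_on W f"
  shows "continuous_on W (deriv_norm f)"
proof -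
  obtain f' :: "'v \<Rightarrow> 'v \<Rightarrow>\<^sub>L 'v" where f': "continuous_on W f'" "\<And>x. x \<in> W \<Longrightarrow> deriv_norm f x = norm (f' x)"
    using C1_on_deriv_norm[OF assms] by metis
  have "continuous_on W (\<lambda>x. norm (f' x))" using f'(1) by (rule continuous_on_norm)
  then show ?thesis using f'(2) by (simp cong: continuous_on_cong)
qed

text \<open>Minimum over the finite alphabet, for properties inherited by smaller constants; upper
  bounds are put into this form by writing them as \<open>1 / d\<close>.\<close>

lemma uniform_positive_bound:
  fixes Q :: "'b \<Rightarrow> real \<Rightarrow> bool"
  assumes "finite A" "\<And>e. e \<in> A \<Longrightarrow> \<exists>d>0. Q e d"
    and mono: "\<And>e d d'. e \<in> A \<Longrightarrow> Q e d \<Longrightarrow> 0 < d' \<Longrightarrow> d' \<le> d \<Longrightarrow> Q e d'"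
  shows "\<exists>d>0. d \<le> 1 \<and> (\<forall>e\<in>A. Q e d)"
proof -
  obtain d where d: "\<And>e. e \<in> A \<Longrightarrow> 0 < d e" "\<And>e. e \<in> A \<Longrightarrow> Q e (d e)" using assms(2) by metis
  define m where "m = Min (insert 1 (d ` A))"
  have fin: "finite (insert 1 (d ` A))" using assms(1) by simp
  have "m \<in> insert 1 (d ` A)" unfolding m_def using fin by (rule Min_in) simp
  then have m: "0 < m" using d(1) by auto
  have le: "m \<le> 1" "\<And>e. e \<in> A \<Longrightarrow> m \<le> d e" unfolding m_def using fin by (auto intro: Min_le)
  show ?thesis using m le d(2) mono by (intro exI[of _ m] conjI ballI) blast+
qed

text \<open>The inverse of \<open>inv_deriv_norm\<close> is at most every value of the derivative
  norm on \<open>S\<close>, so the additive Hoelder bound is relative to the value at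
  \<open>z\<close>, and \<open>1 + x \<le> exp x\<close> applies. The constant \<open>m\<close>
  bounds the supremum, which would otherwise carry no information.\<close>

lemma deriv_norm_holder_exp:
  fixes f :: "'v::euclidean_space \<Rightarrow> 'v"
  assumes conf: "\<And>x. x \<in> S \<Longrightarrow> conformal_at f x" and m: "0 < m" "\<And>x. x \<in> S \<Longrightarrow> m \<le> deriv_norm f x"
    and L: "0 \<le> L" and x: "x \<in> S" and z: "z \<in> S"
    and h: "\<bar>deriv_norm f x - deriv_norm f z\<bar> \<le> L * inverse (inv_deriv_norm S f) * dist x z powr \<alpha>"
  shows "deriv_norm f x \<le> deriv_norm f z * exp (L * dist x z powr \<alpha>)"
proof -
  have gz: "0 < deriv_norm f z" by (rule conformal_at_deriv_norm(1)[OF conf[OF z]])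
  have le: "1 / deriv_norm f u \<le> inv_deriv_norm S f" if "u \<in> S" for u
  proof -
    have "bdd_above ((\<lambda>x. onorm (inv (frechet_derivative f (at x)))) ` S)"
    proof (rule bdd_aboveI2)
      fix v assume v: "v \<in> S"
      show "onorm (inv (frechet_derivative f (at v))) \<le> 1 / m"
        unfolding conformal_at_deriv_norm(3)[OF conf[OF v]] using m(1) m(2)[OF v] by (intro divide_left_mono) auto
    qed
    then show ?thesis
      unfolding inv_deriv_norm_def conformal_at_deriv_norm(3)[OF conf[OF that], symmetric]
      using that by (intro cSUP_upper)
  qed
  have "0 < 1 / deriv_norm f z" using gz by simp
  then have "inverse (inv_deriv_norm S f) \<le> inverse (1 / deriv_norm f z)"
    using le[OF z] by (intro le_imp_inverse_le)
  then have "L * inverse (inv_deriv_norm S f) * dist x z powr \<alpha> \<le> L * deriv_norm f z * dist x z powr \<alpha>"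
    using L by (intro mult_right_mono mult_left_mono) auto
  then have "deriv_norm f x \<le> deriv_norm f z + L * deriv_norm f z * dist x z powr \<alpha>" using h by linarith
  also have "\<dots> = deriv_norm f z * (1 + L * dist x z powr \<alpha>)" by (simp add: algebra_simps)
  also have "\<dots> \<le> deriv_norm f z * exp (L * dist x z powr \<alpha>)"
    using gz exp_ge_add_one_self by (intro mult_left_mono) auto
  finally show ?thesis .
qed

lemma compact_deriv_norm_bounds:
  fixes f :: "'v::euclidean_space \<Rightarrow> 'v"
  assumes "compact S" "S \<noteq> {}" "S \<subseteq> W" "C1_on W f" "\<And>x. x \<in> W \<Longrightarrow> conformal_at f x"
  shows "\<exists>d>0. \<forall>x\<in>S. d \<le> deriv_norm f x" "\<exists>d>0. \<forall>x\<in>S. deriv_norm f x \<le> 1 / d"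
proof -
  have cont: "continuous_on S (deriv_norm f)"
    using continuous_on_deriv_norm[OF assms(4)] assms(3) by (rule continuous_on_subset)
  have pos: "0 < deriv_norm f x" if "x \<in> S" for x
    using conformal_at_deriv_norm(1)[OF assms(5)] assms(3) that by blast
  obtain x where x: "x \<in> S" "\<forall>z\<in>S. deriv_norm f x \<le> deriv_norm f z"
    using continuous_attains_inf[OF assms(1,2) cont] by blast
  show "\<exists>d>0. \<forall>x\<in>S. d \<le> deriv_norm f x" using x pos[OF x(1)] by blast
  obtain z where z: "z \<in> S" "\<forall>x\<in>S. deriv_norm f x \<le> deriv_norm f z"
    using continuous_attains_sup[OF assms(1,2) cont] by blast
  show "\<exists>d>0. \<forall>x\<in>S. deriv_norm f x \<le> 1 / d"
    using z pos[OF z(1)] by (intro exI[of _ "1 / deriv_norm f z"]) simp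
qed

text \<open>A defining set \<open>S\<close> may contain pairs that occur in no point of
  \<open>Z\<close>. Discarding them changes no sequence, and the remaining pairs are those for which
  the maps are composable.\<close>

lemma topological_markov_chain_eq:
  assumes "topological_markov_chain A Z"
  shows "Z = {\<omega>. \<forall>n. (\<omega> n, \<omega> (Suc n)) \<in> two_letter_words Z}" "two_letter_words Z \<subseteq> A \<times> A"
proof -
  obtain S where S: "S \<subseteq> A \<times> A" "Z = {x \<in> topspace (full_shift A). \<forall>n. (x n, x (Suc n)) \<in> S}"
    using assms by (auto simp: topological_markov_chain_def)
  have T: "two_letter_words Z \<subseteq> S" using S(2) by (auto simp: two_letter_words_def)
  show "two_letter_words Z \<subseteq> A \<times> A" using T S(1) by blast
  show "Z = {\<omega>. \<forall>n. (\<omega> n, \<omega> (Suc n)) \<in> two_letter_words Z}"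
  proof (intro equalityI subsetI)
    show "\<omega> \<in> {\<omega>. \<forall>n. (\<omega> n, \<omega> (Suc n)) \<in> two_letter_words Z}" if "\<omega> \<in> Z" for \<omega>
      using that by (auto simp: two_letter_words_def)
    fix \<omega> assume \<omega>: "\<omega> \<in> {\<omega>. \<forall>n. (\<omega> n, \<omega> (Suc n)) \<in> two_letter_words Z}"
    then have "(\<omega> n, \<omega> (Suc n)) \<in> S" for n using T by blast
    moreover from this have "\<omega> n \<in> A" for n using S(1) by blast
    ultimately show "\<omega> \<in> Z" unfolding S(2) by (auto simp: full_shift_def)
  qed
qed

lemma (in conformal_gdms) exists_metric_gdms:
  assumes finA: "finite A"
  shows "\<exists>g y s L \<alpha> \<rho> Dm gmin gmax. metric_gdms A (two_letter_words Z) Ye \<phi> g y s L \<alpha> \<rho> Dm gmin gmax"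
proof -
  let ?T = "two_letter_words Z"
  have Tsub: "?T \<subseteq> A \<times> A" by (rule topological_markov_chain_eq(2)[OF markov_chain])
  obtain s where s: "0 < s" "s < 1" "\<And>e. e \<in> A \<Longrightarrow> s-lipschitz_on (Ye e) (\<phi> e)"
    using maps_contract by blast
  obtain W \<Phi> where ext: "conformal_extension A Z Ye \<phi> W \<Phi>" and hol: "holder_derivatives A Ye \<Phi>"
    using conformal_holder_extension by blast
  have W: "open (W e)" "Ye e \<subseteq> W e" "\<And>x. x \<in> Ye e \<Longrightarrow> \<Phi> e x = \<phi> e x" "C1_on (W e) (\<Phi> e)"
    "\<And>x. x \<in> W e \<Longrightarrow> conformal_at (\<Phi> e) x" if "e \<in> A" for e
    using ext that by (auto simp: conformal_extension_def C1_conformal_diffeo_into_def)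
  obtain L \<alpha> where L: "1 \<le> L" "0 < \<alpha>"
    and hol': "\<And>e x z. e \<in> A \<Longrightarrow> x \<in> Ye e \<Longrightarrow> z \<in> Ye e \<Longrightarrow>
       \<bar>deriv_norm (\<Phi> e) x - deriv_norm (\<Phi> e) z\<bar>
             \<le> L * inverse (inv_deriv_norm (Ye e) (\<Phi> e)) * dist x z powr \<alpha>"
    using hol unfolding holder_derivatives_def by blast
  define g where "g e = deriv_norm (\<Phi> e)" for e
  have "\<exists>d>0. d \<le> 1 \<and> (\<forall>e\<in>A. \<forall>x\<in>Ye e. d \<le> g e x)"
    by (rule uniform_positive_bound[OF finA])
      (use compact_deriv_norm_bounds(1)[OF Ye_compact Ye_nonempty W(2,4,5)] in \<open>auto simp: g_def intro: order_trans\<close>)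
  then obtain gmin where gmin: "0 < gmin" "gmin \<le> 1" "\<And>e x. e \<in> A \<Longrightarrow> x \<in> Ye e \<Longrightarrow> gmin \<le> g e x" by blast
  have "\<exists>d>0. d \<le> 1 \<and> (\<forall>e\<in>A. \<forall>x\<in>Ye e. g e x \<le> 1 / d)"
  proof (rule uniform_positive_bound[OF finA])
    show "\<exists>d>0. \<forall>x\<in>Ye e. g e x \<le> 1 / d" if "e \<in> A" for e
      unfolding g_def by (rule compact_deriv_norm_bounds(2)[OF Ye_compact Ye_nonempty W(2,4,5)]) (use that in auto)
    fix e and d d' :: real assume d: "\<forall>x\<in>Ye e. g e x \<le> 1 / d" "0 < d'" "d' \<le> d"
    then have "1 / d \<le> 1 / d'" by (intro divide_left_mono) auto
    then show "\<forall>x\<in>Ye e. g e x \<le> 1 / d'" using d(1) by fastforce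
  qed
  then obtain dmax where dmax: "0 < dmax" "dmax \<le> 1" "\<And>e x. e \<in> A \<Longrightarrow> x \<in> Ye e \<Longrightarrow> g e x \<le> 1 / dmax" by blast
  have "\<exists>y. y \<in> interior (Ye e)" if "e \<in> A" for e
    using Ye_regular_closed[OF that] Ye_nonempty[OF that] by fastforce
  then obtain y where y: "\<And>e. e \<in> A \<Longrightarrow> y e \<in> interior (Ye e)" by metis
  have "\<exists>d>0. d \<le> 1 \<and> (\<forall>e\<in>A. cball (y e) d \<subseteq> interior (Ye e))"
  proof (rule uniform_positive_bound[OF finA])
    show "\<exists>d>0. cball (y e) d \<subseteq> interior (Ye e)" if "e \<in> A" for e
      using y[OF that] open_interior open_contains_cball by blast
    show "cball (y e) d' \<subseteq> interior (Ye e)" if "cball (y e) d \<subseteq> interior (Ye e)" "d' \<le> d" for e d d'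
      using that subset_cball by blast
  qed
  then obtain \<rho> where \<rho>: "0 < \<rho>" "\<And>e. e \<in> A \<Longrightarrow> cball (y e) \<rho> \<subseteq> interior (Ye e)" by blast
  have bY: "bounded Y" using Y_compact(1) by (rule compact_imp_bounded)
  \<comment> \<open>The diameter of \<open>Y\<close> bounds all distances in the sets
    \<open>Ye e\<close>; adding \<open>1\<close> makes its positivity immediate.\<close>
  have "metric_gdms A ?T Ye \<phi> g y s L \<alpha> \<rho> (diameter Y + 1) gmin (1 / dmax)"
  proof
    show "finite A" "?T \<subseteq> A \<times> A" "0 < s" "s < 1" "0 < \<alpha>" "0 < gmin" "gmin \<le> 1" "0 < \<rho>"
      using finA Tsub s L gmin \<rho> by auto
    show "0 \<le> L" using L by simp
    show "1 \<le> 1 / dmax" using dmax by simp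
    show "0 < diameter Y + 1" using diameter_ge_0[OF bY] by linarith
    show "compact (Ye e)" if "e \<in> A" for e by (rule Ye_compact[OF that])
    show "inj_on (\<phi> e) (Ye e)" if "e \<in> A" for e by (rule maps_inj[OF that])
    show "\<phi> f x \<in> Ye e" if "(e, f) \<in> ?T" "x \<in> Ye f" for e f x using maps_compose that by blast
    show "\<phi> e ` interior (Ye e) \<inter> \<phi> f ` interior (Ye f) = {}" if "e \<in> A" "f \<in> A" "e \<noteq> f" for e f
      by (rule open_set_condition[OF that])
    show "cball (y e) \<rho> \<subseteq> interior (Ye e)" if "e \<in> A" for e by (rule \<rho>(2)[OF that])
    show "dist (\<phi> e x) (\<phi> e z) \<le> s * dist x z" if "e \<in> A" "x \<in> Ye e" "z \<in> Ye e" for e x z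
      using lipschitz_onD[OF s(3)] that by blast
    show "gmin \<le> g e x" "g e x \<le> 1 / dmax" if "e \<in> A" "x \<in> Ye e" for e x
      using gmin(3) dmax(3) that by auto
    show "dist x z \<le> diameter Y + 1" if "e \<in> A" "x \<in> Ye e" "z \<in> Ye e" for e x z
      using diameter_bounded_bound[OF bY, of x z] Ye_subset[OF that(1)] that by fastforce
    show "g e x \<le> g e z * exp (L * dist x z powr \<alpha>)" if e: "e \<in> A" "x \<in> Ye e" "z \<in> Ye e" for e x z
      unfolding g_def
    proof (rule deriv_norm_holder_exp[where S = "Ye e" and m = gmin])
      show "conformal_at (\<Phi> e) u" if "u \<in> Ye e" for u using W(2,5)[OF e(1)] that by blast
      show "gmin \<le> deriv_norm (\<Phi> e) u" if "u \<in> Ye e" for u using gmin(3)[OF e(1) that] by (simp add: g_def)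
    qed (use gmin L e hol'[OF e] in auto)
    fix \<eta> :: real assume \<eta>: "0 < \<eta>"
    have "\<exists>d>0. d \<le> 1 \<and> (\<forall>e\<in>A. \<forall>x\<in>Ye e. \<forall>z\<in>Ye e. dist x z \<le> d \<longrightarrow>
        \<bar>dist (\<phi> e x) (\<phi> e z) - g e x * dist x z\<bar> \<le> \<eta> * dist x z)"
    proof (rule uniform_positive_bound[OF finA])
      fix e assume e: "e \<in> A"
      have "\<exists>\<delta>>0. \<forall>x\<in>Ye e. \<forall>z\<in>Ye e. dist x z \<le> \<delta> \<longrightarrow>
          \<bar>dist (\<Phi> e x) (\<Phi> e z) - deriv_norm (\<Phi> e) x * dist x z\<bar> \<le> \<eta> * dist x z"
        by (rule C1_conformal_linear_approx[OF W(1)[OF e] W(4)[OF e] W(5)[OF e] Ye_compact[OF e] W(2)[OF e] \<eta>])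
      then show "\<exists>\<delta>>0. \<forall>x\<in>Ye e. \<forall>z\<in>Ye e. dist x z \<le> \<delta> \<longrightarrow>
          \<bar>dist (\<phi> e x) (\<phi> e z) - g e x * dist x z\<bar> \<le> \<eta> * dist x z"
        using W(3)[OF e] by (simp add: g_def)
    qed auto
    then show "\<exists>\<delta>>0. \<forall>e\<in>A. \<forall>x\<in>Ye e. \<forall>z\<in>Ye e. dist x z \<le> \<delta> \<longrightarrow>
        \<bar>dist (\<phi> e x) (\<phi> e z) - g e x * dist x z\<bar> \<le> \<eta> * dist x z" by blast
  qed
  then show ?thesis by blast
qed

theorem theorem3p4:
  fixes A :: "'a set"
    and Z :: "(nat \<Rightarrow> 'a) set"
    and Y :: "'v::euclidean_space set"
    and Ye :: "'a \<Rightarrow> 'v set"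
    and \<phi> :: "'a \<Rightarrow> 'v \<Rightarrow> 'v"
  assumes "finite A" and "2 \<le> card A"
    and "topological_markov_chain A Z"
    and "conformal_gdms A Z Y Ye \<phi>"
  shows "{hausdorff_dim (limit_set Ye \<phi> X) | X. X \<subseteq> Z \<and> subshift A X} =
         {0..hausdorff_dim (limit_set Ye \<phi> Z)}"
proof (intro equalityI subsetI)
  fix d assume "d \<in> {hausdorff_dim (limit_set Ye \<phi> X) | X. X \<subseteq> Z \<and> subshift A X}"
  then obtain X where X: "d = hausdorff_dim (limit_set Ye \<phi> X)" "X \<subseteq> Z" by blast
  have "limit_set Ye \<phi> X \<subseteq> limit_set Ye \<phi> Z" unfolding limit_set_def using X(2) by (rule image_mono)
  then show "d \<in> {0..hausdorff_dim (limit_set Ye \<phi> Z)}" using X(1) hausdorff_dim_mono by auto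
next
  fix d assume "d \<in> {0..hausdorff_dim (limit_set Ye \<phi> Z)}"
  \<comment> \<open>The endpoints are attained by the empty shift and by \<open>Z\<close> itself; a
    value strictly between them is finite, even if the type allows infinity.\<close>
  then consider "d = 0" | "d = hausdorff_dim (limit_set Ye \<phi> Z)"
    | "0 < d" "d < hausdorff_dim (limit_set Ye \<phi> Z)" by fastforce
  then have "\<exists>X. X \<subseteq> Z \<and> subshift A X \<and> hausdorff_dim (limit_set Ye \<phi> X) = d"
  proof cases
    case 1
    have "subshift A {}" by (simp add: subshift_def)
    then show ?thesis using 1 hausdorff_dim_empty by (intro exI[of _ "{}"]) (simp add: limit_set_def)
  next
    case 2
    then show ?thesis using assms(3) by (auto simp: topological_markov_chain_def)
  next
    case 3
    then have "d < top" using less_le_trans top_greatest by blast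
    then obtain t where t: "d = ennreal t" "0 \<le> t" by (cases d) auto
    then have "0 < t" using 3(1) by (simp add: ennreal_less_zero_iff)
    obtain g y s L \<alpha> \<rho> Dm gmin gmax where
      "metric_gdms A (two_letter_words Z) Ye \<phi> g y s L \<alpha> \<rho> Dm gmin gmax"
      using conformal_gdms.exists_metric_gdms[OF assms(4,1)] by blast
    then interpret M: metric_gdms A "two_letter_words Z" Ye \<phi> g y s L \<alpha> \<rho> Dm gmin gmax .
    have Z: "Z = {\<omega>. M.adm_seq \<omega>}"
      unfolding M.adm_seq_def by (rule topological_markov_chain_eq(1)[OF assms(3)])
    then show ?thesis using M.exists_subshift_dim[OF \<open>0 < t\<close>] 3(2) t(1) by metis
  qed
  then show "d \<in> {hausdorff_dim (limit_set Ye \<phi> X) | X. X \<subseteq> Z \<and> subshift A X}" by blast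
qed

end
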